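(* Let $(\mathbf S,\mathbf M)$ be an unpunctured non-orientable marked surface with a triangulation $T$ and a principal lamination $\mathcal L_T$. Let $\alpha$ be a one-sided closed curve, and let $\alpha^2$ be the two-sided closed curve enclosing the crosscap obtained from resolving an intersection of $\alpha$ with another one-sided closed curve homotopic to $\alpha$. Then $$(\overline\chi_{\alpha,\mathcal L_T})^2=\overline\chi_{\alpha^2,\mathcal L_T}-2.$$
   Context: **Surfaces.** $\mathbf S$ is a compact connected surface with boundary, $\mathbf M\subset\partial\mathbf S$ a finite set of marked points meeting every boundary component. An arc is a simple curve (up to isotopy) with endpoints in $\mathbf M$, otherwise disjoint from $\mathbf M\cup\partial\mathbf S$, not cutting out a monogon or bigon. A triangulation $T$ is a maximal collection of pairwise non-crossing arcs (with no one-sided closed curve). Each arc or boundary segment $\tau$ has a variable $x_\tau$, and each arc $\tau\in T$ a variable $y_\tau$. A closed curve is one-sided if it has no orientable regular neighbourhood. Curves are considered up to isotopy and are drawn with the minimal number of crossings with $T$. The curve $\alpha^2$ is the closed curve of multiplicity two along $\alpha$ (i.e. $\alpha$ traversed twice; its lift to the orientable double cover is the concatenation of the two lifts of $\alpha$). **Principal laminations and signs.** For each $\tau\in T$, $L_\tau$ is a lamination associated to $\tau$: a non-self-intersecting curve running along $\tau$ in a small neighbourhood which at both ends turns clockwise (or at both ends counterclockwise, directions being transported along $\tau$) and ends on the boundary near the endpoint of $\tau$; when this would self-intersect, it is the corresponding one-sided closed curve instead. There are two choices for each $\tau$; a principal lamination is a choice $\mathcal L_T=\{L_\tau:\tau\in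 T\}$. Points of the orientable double cover of $\mathbf S$ are pairs (point of $\mathbf S$, local orientation there). For a lift $\tau'$ of $\tau$, let $b_T(\mathcal L_T,\tau')$ be the shear coordinate at $\tau'$ of the preimage of $L_\tau$, i.e. the number of $S$-intersections minus the number of $Z$-intersections with the quadrilateral of the lifted triangulation having $\tau'$ as diagonal. (A directed segment crossing a side, then $\tau'$, then the opposite side is an $S$-intersection if the common endpoint of the first side and $\tau'$ lies to its right and the common endpoint of $\tau'$ and the last side lies to its left; a $Z$-intersection with left and right exchanged.) One has $b_T(\mathcal L_T,\tau')\in\{1,-1\}$, and the two lifts of $\tau$ have opposite signs. For a point of $\tau$ with a local orientation, $b_T(\mathcal L_T,\tau)$ denotes the sign of the corresponding lift. **Elementary steps (determinant $\pm1$ version).** Around each $m\in\mathbf M$ draw a small arc $h_m$ (horocycle) in $\mathbf S$, all disjoint, and fix a local orientation $o_m$ near $m$ (as given by a planar drawing of $\mathbf S$ with crosscaps). For an end at $m$ of an arc or boundary segment $\tau$ of $T$, $v_{m,\tau}=h_m\cap\tau$, and $v^{+}_{m,\tau}$, $v^-_{m,\tau}$ are points of $h_m$ just clockwise, resp. counterclockwise, of $v_{m,\tau}$ (w.r.t. $o_m$). - Type 1: move along $h_m$ inside the corner at $m$ of a triangle of $T$, from $\tau$ to $\tau'$, where $\sigma$ is the third side of the triangle; matrix $\begin{bmatrix}1&0\\ \pm\frac{x_\sigma}{x_\tau x_{\tau'}}&1\end{bmatrix}$, sign $+$ if clockwise and $-$ otherwise. - Type 2: cross $\tau\in T$ along $h_m$.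 With $b=b_T(\mathcal L_T,\tau)$ at the point $v_{m,\tau}$ with orientation $o_m$: the matrix is $\operatorname{diag}(y_\tau^{-1/2},y_\tau^{1/2})$ if (clockwise and $b=1$) or (counterclockwise and $b=-1$), and $\operatorname{diag}(y_\tau^{1/2},y_\tau^{-1/2})$ otherwise. - Type 3: follow a path parallel to $\tau$ from a point near one end, at $m$, to a point near its other end, at $m'$, not crossing $\tau$, when transport along $\tau$ carries $o_m$ to $o_{m'}$ (so the path goes from $v^\pm_{m,\tau}$ to $v^\mp_{m',\tau}$); matrix $\begin{bmatrix}0&x_\tau\\-\frac1{x_\tau}&0\end{bmatrix}$ if $\tau$ is seen on the right at the start, and $\begin{bmatrix}0&-x_\tau\\ \frac1{x_\tau}&0\end{bmatrix}$ otherwise. - Type $3'$: the same when transport along $\tau$ reverses orientation, i.e. the path goes through the crosscap, from $v^{\pm}_{m,\tau}$ to $v^{\pm}_{m',\tau}$; matrix $\begin{bmatrix}0&x_\tau\\ \frac1{x_\tau}&0\end{bmatrix}$ if $\tau$ is seen on the right at the start and $\begin{bmatrix}0&-x_\tau\\-\frac1{x_\tau}&0\end{bmatrix}$ otherwise. **$\overline\chi$.** An $M$-path for a closed curve $\beta$ is a closed path $\rho$ that is a concatenation of elementary steps $\rho_1,\dots,\rho_t$ (in this order), is isotopic to $\beta$, and whose intersections with $T$ are in bijection with those of $\beta$. Put $\overline M(\rho)=\overline M(\rho_t)\cdots\overline M(\rho_1)$, the product of the matrices above, and $\overline\chi_{\beta,\mathcal L_T}=|\operatorname{tr}\overline M(\rho)|$,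 which does not depend on $\rho$; here $|f|$ is whichever of $f,-f$ has positive coefficients. *)

theory Defs
  imports "HOL-Analysis.Analysis" "HOL-Library.Poly_Mapping"
begin

section \<open>Surfaces, marked points and arcs\<close>

text \<open>A compact surface is metrizable, so surfaces are subsets of a metric space.  Closed curves and
  isotopies of closed curves live in the interior of the surface.\<close>

definition surface_interior :: "'a::metric_space set \<Rightarrow> 'a set" where
  "surface_interior S =
    {x \<in> S. \<exists>U. openin (top_of_set S) U \<and> x \<in> U \<and> U homeomorphic (ball 0 1 :: complex set)}"

definition surface_boundary :: "'a::metric_space set \<Rightarrow> 'a set" where
  "surface_boundary S = S - surface_interior S"

definition compact_surface :: "'a::metric_space set \<Rightarrow> bool" where
  "compact_surface S \<longleftrightarrow> compact S \<and> connected S \<and> surface_boundary S \<noteq> {} \<and>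
    (\<forall>x\<in>S. \<exists>U. openin (top_of_set S) U \<and> x \<in> U \<and>
       (U homeomorphic (ball 0 1 :: complex set) \<or>
        U homeomorphic {z \<in> ball 0 1 :: complex set. 0 \<le> Im z}))"

text \<open>Unpunctured: all marked points lie on the boundary.\<close>

definition marked_points :: "'a::metric_space set \<Rightarrow> 'a set \<Rightarrow> bool" where
  "marked_points S M \<longleftrightarrow> finite M \<and> M \<subseteq> surface_boundary S \<and>
    (\<forall>C \<in> components (surface_boundary S). C \<inter> M \<noteq> {})"

definition boundary_segments :: "'a::metric_space set \<Rightarrow> 'a set \<Rightarrow> 'a set set" where
  "boundary_segments S M = closure ` components (surface_boundary S - M)"

definition cuts_out_monogon :: "'a::metric_space set \<Rightarrow> (real \<Rightarrow> 'a) \<Rightarrow> bool" where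
  "cuts_out_monogon S g \<longleftrightarrow> (\<exists>h :: complex \<Rightarrow> 'a.
     continuous_on (cball 0 1) h \<and> h ` cball 0 1 \<subseteq> S \<and> inj_on h (cball 0 1) \<and>
     h ` sphere 0 1 = path_image g)"

text \<open>The two vertices of a bigon may be the same marked point, so \<open>h\<close> need not be injective there.\<close>

definition cuts_out_bigon :: "'a::metric_space set \<Rightarrow> 'a set \<Rightarrow> (real \<Rightarrow> 'a) \<Rightarrow> bool" where
  "cuts_out_bigon S M g \<longleftrightarrow> (\<exists>h :: complex \<Rightarrow> 'a.
     continuous_on (cball 0 1) h \<and> h ` cball 0 1 \<subseteq> S \<and> inj_on h (cball 0 1 - {1, -1}) \<and>
     h ` {1, -1} \<subseteq> M \<and>
     h ` {z \<in> sphere 0 1. 0 \<le> Im z} = path_image g \<and>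
     h ` {z \<in> sphere 0 1. Im z \<le> 0} \<in> boundary_segments S M)"

definition is_arc :: "'a::metric_space set \<Rightarrow> 'a set \<Rightarrow> (real \<Rightarrow> 'a) \<Rightarrow> bool" where
  "is_arc S M g \<longleftrightarrow> simple_path g \<and> pathstart g \<in> M \<and> pathfinish g \<in> M \<and>
     g ` {0<..<1} \<subseteq> surface_interior S \<and>
     \<not> cuts_out_monogon S g \<and> \<not> cuts_out_bigon S M g"

definition arc_isotopic :: "'a::metric_space set \<Rightarrow> 'a set \<Rightarrow> (real \<Rightarrow> 'a) \<Rightarrow> (real \<Rightarrow> 'a) \<Rightarrow> bool" where
  "arc_isotopic S M g g' \<longleftrightarrow>
     homotopic_with_canon
       (\<lambda>f. is_arc S M f \<and> pathstart f = pathstart g \<and> pathfinish f = pathfinish g) {0..1} S g g'"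

text \<open>An arc of a triangulation is represented by its image in the surface; as arcs are not
  oriented, all parametrisations are considered.  The arcs of \<open>T\<close> are pairwise non-crossing
  representatives of distinct isotopy classes.\<close>

definition triangulation :: "'a::metric_space set \<Rightarrow> 'a set \<Rightarrow> 'a set set \<Rightarrow> bool" where
  "triangulation S M T \<longleftrightarrow> finite T \<and>
     (\<forall>\<tau>\<in>T. \<exists>g. is_arc S M g \<and> path_image g = \<tau>) \<and>
     (\<forall>\<tau>\<in>T. \<forall>\<tau>'\<in>T. \<tau> \<noteq> \<tau>' \<longrightarrow> \<tau> \<inter> \<tau>' \<subseteq> M) \<and>
     (\<forall>g g'. is_arc S M g \<and> path_image g \<in> T \<and> is_arc S M g' \<and> path_image g' \<in> T \<and>
        arc_isotopic S M g g' \<longrightarrow> path_image g = path_image g') \<and>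
     (\<forall>g. is_arc S M g \<and> (\<forall>\<tau>\<in>T. path_image g \<inter> \<tau> \<subseteq> M) \<longrightarrow>
        (\<exists>g'. is_arc S M g' \<and> path_image g' \<in> T \<and> arc_isotopic S M g g'))"


section \<open>The triangles of a triangulation\<close>

text \<open>The standard triangle is the simplex in barycentric coordinates; its corners are indexed by the
  type \<open>3\<close> (arithmetic modulo 3).  Its reference orientation is the one for which
  the corners 0, 1, 2 follow each other counterclockwise.  Side \<open>k\<close> is opposite to corner
  \<open>k\<close> and runs from corner \<open>k + 1\<close> to corner \<open>k + 2\<close>, with the triangle on its left.\<close>

definition simplex3 :: "(real^3) set" where
  "simplex3 = {p. (\<forall>i. 0 \<le> p $ i) \<and> (\<Sum>i\<in>UNIV. p $ i) = 1}"

definition open_simplex3 :: "(real^3) set" where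
  "open_simplex3 = {p \<in> simplex3. \<forall>i. 0 < p $ i}"

definition side_point :: "3 \<Rightarrow> real \<Rightarrow> real^3" where
  "side_point k s = (1 - s) *\<^sub>R axis (k + 1) 1 + s *\<^sub>R axis (k + 2) 1"

text \<open>For distinct \<open>i\<close>, \<open>j\<close> this is the remaining index, because 0 + 1 + 2 = 0 modulo 3.\<close>

definition third :: "3 \<Rightarrow> 3 \<Rightarrow> 3" where
  "third i j = - (i + j)"

record 'a tsurface =
  surf :: "'a set"
  marked :: "'a set"
  arcs :: "'a set set"
  chart :: "'a set \<Rightarrow> real^3 \<Rightarrow> 'a"

text \<open>A triangle of \<open>T\<close> is identified with its open part, a component of the complement of the arcs;
  \<open>chart \<Sigma> t\<close> parametrises its closure by the standard triangle.\<close>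

definition triangles :: "'a::metric_space tsurface \<Rightarrow> 'a set set" where
  "triangles \<Sigma> = components (surface_interior (surf \<Sigma>) - \<Union> (arcs \<Sigma>))"

definition bsegs :: "'a::metric_space tsurface \<Rightarrow> 'a set set" where
  "bsegs \<Sigma> = boundary_segments (surf \<Sigma>) (marked \<Sigma>)"

definition edge :: "'a::metric_space tsurface \<Rightarrow> 'a set \<Rightarrow> 3 \<Rightarrow> 'a set" where
  "edge \<Sigma> t k = chart \<Sigma> t ` side_point k ` {0..1}"

text \<open>The arcs cut the surface into triangles: an arc is a side twice (possibly of the same
  triangle), a boundary segment is a side once.  The charts are chosen so that the two
  parametrisations that an arc gets from its two sides agree up to reversal.\<close>

definition triangle_charts :: "'a::metric_space tsurface \<Rightarrow> bool" where
  "triangle_charts \<Sigma> \<longleftrightarrow> finite (triangles \<Sigma>) \<and>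
     (\<forall>t \<in> triangles \<Sigma>.
        continuous_on simplex3 (chart \<Sigma> t) \<and>
        inj_on (chart \<Sigma> t) open_simplex3 \<and> chart \<Sigma> t ` open_simplex3 = t \<and>
        (\<forall>c. chart \<Sigma> t (axis c 1) \<in> marked \<Sigma>) \<and>
        (\<forall>k. edge \<Sigma> t k \<in> arcs \<Sigma> \<union> bsegs \<Sigma> \<and>
             inj_on (\<lambda>s. chart \<Sigma> t (side_point k s)) {0<..<1} \<and>
             (\<forall>s\<in>{0<..<1}. chart \<Sigma> t (side_point k s) \<notin> marked \<Sigma>))) \<and>
     (\<forall>\<tau> \<in> arcs \<Sigma>. card {(t, k). t \<in> triangles \<Sigma> \<and> edge \<Sigma> t k = \<tau>} = 2) \<and>
     (\<forall>\<tau> \<in> bsegs \<Sigma>. card {(t, k). t \<in> triangles \<Sigma> \<and> edge \<Sigma> t k = \<tau>} = 1) \<and>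
     (\<forall>t\<in>triangles \<Sigma>. \<forall>t'\<in>triangles \<Sigma>. \<forall>k k'.
        (t, k) \<noteq> (t', k') \<and> edge \<Sigma> t k = edge \<Sigma> t' k' \<longrightarrow>
          (\<forall>s\<in>{0..1}. chart \<Sigma> t (side_point k s) = chart \<Sigma> t' (side_point k' s)) \<or>
          (\<forall>s\<in>{0..1}. chart \<Sigma> t (side_point k s) = chart \<Sigma> t' (side_point k' (1 - s))))"

definition triangulated_surface :: "'a::metric_space tsurface \<Rightarrow> bool" where
  "triangulated_surface \<Sigma> \<longleftrightarrow>
     compact_surface (surf \<Sigma>) \<and> marked_points (surf \<Sigma>) (marked \<Sigma>) \<and>
     triangulation (surf \<Sigma>) (marked \<Sigma>) (arcs \<Sigma>) \<and> triangle_charts \<Sigma>"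

text \<open>The other side along the same arc, for an arc that is a side of \<open>t\<close>.\<close>

definition partner :: "'a::metric_space tsurface \<Rightarrow> 'a set \<Rightarrow> 3 \<Rightarrow> 'a set \<times> 3" where
  "partner \<Sigma> t k =
     (THE q. fst q \<in> triangles \<Sigma> \<and> q \<noteq> (t, k) \<and> edge \<Sigma> (fst q) (snd q) = edge \<Sigma> t k)"

text \<open>Two triangles glued along an arc have reference orientations that agree across the arc iff
  they induce opposite directions on it.\<close>

definition coherent :: "'a::metric_space tsurface \<Rightarrow> 'a set \<Rightarrow> 3 \<Rightarrow> bool" where
  "coherent \<Sigma> t k \<longleftrightarrow> (case partner \<Sigma> t k of (t', k') \<Rightarrow>
     \<forall>s\<in>{0..1}. chart \<Sigma> t (side_point k s) = chart \<Sigma> t' (side_point k' (1 - s)))"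


section \<open>Local orientations and one-sided curves\<close>

text \<open>A local orientation at the point \<open>chart \<Sigma> t p\<close> is recorded by the sign \<open>\<epsilon> t p\<close> comparing it with
  the reference orientation of \<open>t\<close>; a point of an arc is seen from both sides of the arc.
  So \<open>\<epsilon>\<close> is a continuous section over \<open>U\<close> of the orientable double cover.\<close>

definition orientation_on ::
    "'a::metric_space tsurface \<Rightarrow> 'a set \<Rightarrow> ('a set \<Rightarrow> real^3 \<Rightarrow> real) \<Rightarrow> bool" where
  "orientation_on \<Sigma> U \<epsilon> \<longleftrightarrow>
     (\<forall>t \<in> triangles \<Sigma>. continuous_on {p \<in> simplex3. chart \<Sigma> t p \<in> U} (\<epsilon> t) \<and>
        (\<forall>p \<in> simplex3. chart \<Sigma> t p \<in> U \<longrightarrow> \<epsilon> t p \<in> {1, -1})) \<and>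
     (\<forall>t \<in> triangles \<Sigma>. \<forall>k. \<forall>s\<in>{0..1}.
        edge \<Sigma> t k \<in> arcs \<Sigma> \<and> chart \<Sigma> t (side_point k s) \<in> U \<longrightarrow>
        (case partner \<Sigma> t k of (t', k') \<Rightarrow>
           \<epsilon> t (side_point k s) =
             (if coherent \<Sigma> t k then \<epsilon> t' (side_point k' (1 - s)) else - \<epsilon> t' (side_point k' s))))"

definition orientable_on :: "'a::metric_space tsurface \<Rightarrow> 'a set \<Rightarrow> bool" where
  "orientable_on \<Sigma> U \<longleftrightarrow> (\<exists>\<epsilon>. orientation_on \<Sigma> U \<epsilon>)"

definition nonorientable :: "'a::metric_space tsurface \<Rightarrow> bool" where
  "nonorientable \<Sigma> \<longleftrightarrow> \<not> orientable_on \<Sigma> (surface_interior (surf \<Sigma>))"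

definition closed_curve :: "'a::metric_space tsurface \<Rightarrow> (real \<Rightarrow> 'a) \<Rightarrow> bool" where
  "closed_curve \<Sigma> \<alpha> \<longleftrightarrow> simple_path \<alpha> \<and> pathfinish \<alpha> = pathstart \<alpha> \<and>
     path_image \<alpha> \<subseteq> surface_interior (surf \<Sigma>)"

text \<open>Every neighbourhood of the curve contains a regular one, and orientability passes to subsets.\<close>

definition one_sided :: "'a::metric_space tsurface \<Rightarrow> (real \<Rightarrow> 'a) \<Rightarrow> bool" where
  "one_sided \<Sigma> \<alpha> \<longleftrightarrow> \<not> (\<exists>U. openin (top_of_set (surf \<Sigma>)) U \<and> path_image \<alpha> \<subseteq> U \<and>
     U \<subseteq> surface_interior (surf \<Sigma>) \<and> orientable_on \<Sigma> U)"

definition curve_square :: "(real \<Rightarrow> 'a::metric_space) \<Rightarrow> real \<Rightarrow> 'a" where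
  "curve_square \<alpha> = \<alpha> +++ \<alpha>"


section \<open>Positions near the marked points\<close>

text \<open>A position \<open>(t, c, k)\<close> with \<open>c \<noteq> k\<close> is the point of the horocycle at the marked point
  \<open>chart \<Sigma> t (axis c 1)\<close> that lies inside triangle \<open>t\<close>, in its corner \<open>c\<close>, next to its side
  \<open>k\<close>.  These are the points written \<open>v\<close> with superscript plus or minus.\<close>

type_synonym 'a position = "'a set \<times> 3 \<times> 3"

definition is_position :: "'a::metric_space tsurface \<Rightarrow> 'a position \<Rightarrow> bool" where
  "is_position \<Sigma> p \<longleftrightarrow> (case p of (t, c, k) \<Rightarrow> t \<in> triangles \<Sigma> \<and> c \<noteq> k)"

text \<open>\<open>Turn\<close> is type 1, \<open>Cross\<close> is type 2, and \<open>Along\<close> is type 3 or 3'.\<close>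

datatype step = Turn | Cross | Along

fun move :: "'a::metric_space tsurface \<Rightarrow> 'a position \<Rightarrow> step \<Rightarrow> 'a position" where
  "move \<Sigma> (t, c, k) Turn = (t, c, third c k)"
| "move \<Sigma> (t, c, k) Along = (t, third c k, k)"
| "move \<Sigma> (t, c, k) Cross = (case partner \<Sigma> t k of (t', k') \<Rightarrow>
     (t', (if (c = k + 1) = coherent \<Sigma> t k then k' + 2 else k' + 1), k'))"

text \<open>The local orientations \<open>o_m\<close>, given at each corner \<open>c\<close> of a triangle \<open>t\<close> by the sign
  \<open>\<omega> t c\<close> that compares them with the reference orientation of \<open>t\<close>.  The condition says that the
  corners around one marked point carry the same local orientation.\<close>

definition local_orientations :: "'a::metric_space tsurface \<Rightarrow> ('a set \<Rightarrow> 3 \<Rightarrow> int) \<Rightarrow> bool" where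
  "local_orientations \<Sigma> \<omega> \<longleftrightarrow>
     (\<forall>t \<in> triangles \<Sigma>. \<forall>c. \<omega> t c \<in> {1, -1}) \<and>
     (\<forall>t \<in> triangles \<Sigma>. \<forall>c k. c \<noteq> k \<and> edge \<Sigma> t k \<in> arcs \<Sigma> \<longrightarrow>
        (case move \<Sigma> (t, c, k) Cross of (t', c', k') \<Rightarrow>
           \<omega> t c = (if coherent \<Sigma> t k then \<omega> t' c' else - \<omega> t' c')))"


section \<open>Principal laminations and shear coordinates\<close>

text \<open>A lamination enters only through its crossings with \<open>T\<close>.  It is recorded by its successive
  passages \<open>(t, i, j)\<close>: it crosses triangle \<open>t\<close> from side \<open>i\<close> to side \<open>j\<close>.\<close>

type_synonym 'a passage = "'a set \<times> 3 \<times> 3"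

datatype 'a lamination_curve = Strand "'a passage list" | Loop "'a passage list"

text \<open>\<open>ray \<Sigma> (t, c, k) ps\<close>: having entered \<open>t\<close> through side \<open>k\<close>, the curve turns around the marked
  point at corner \<open>c\<close> until it reaches the boundary; \<open>ps\<close> lists its passages.\<close>

inductive ray :: "'a::metric_space tsurface \<Rightarrow> 'a position \<Rightarrow> 'a passage list \<Rightarrow> bool" for \<Sigma> where
  ray_end: "edge \<Sigma> t (third c k) \<in> bsegs \<Sigma> \<Longrightarrow> ray \<Sigma> (t, c, k) [(t, k, third c k)]"
| ray_step: "edge \<Sigma> t (third c k) \<in> arcs \<Sigma> \<Longrightarrow> ray \<Sigma> (move \<Sigma> (t, c, third c k) Cross) ps \<Longrightarrow>
    ray \<Sigma> (t, c, k) ((t, k, third c k) # ps)"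

definition flip_passage :: "'a passage \<Rightarrow> 'a passage" where
  "flip_passage = (\<lambda>(t, i, j). (t, j, i))"

definition exits_through :: "'a::metric_space tsurface \<Rightarrow> 'a set \<Rightarrow> 'a passage \<Rightarrow> bool" where
  "exits_through \<Sigma> \<tau> = (\<lambda>(t, i, j). edge \<Sigma> t j = \<tau>)"

definition upto_first :: "('b \<Rightarrow> bool) \<Rightarrow> 'b list \<Rightarrow> 'b list" where
  "upto_first P xs = takeWhile (\<lambda>x. \<not> P x) xs @ take 1 (dropWhile (\<lambda>x. \<not> P x) xs)"

text \<open>A lamination associated to \<open>\<tau>\<close> runs along \<open>\<tau>\<close>, crossing it once in the middle; it turns around
  the end \<open>c\<close> of \<open>\<tau>\<close> on the side of \<open>t\<close> (passages \<open>ps\<close>) and around the other end on the other side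
  (passages \<open>qs\<close>).  Then both turns have the same direction, transported along \<open>\<tau>\<close>; the
  two choices of \<open>c\<close> give the two laminations.  The two turning ends cross each other
  iff each of them meets the other end of \<open>\<tau>\<close>.  In that case the one-sided closed
  curve follows \<open>qs\<close> until it meets \<open>\<tau>\<close> again, where it closes up.\<close>

definition associated_lamination ::
    "'a::metric_space tsurface \<Rightarrow> 'a set \<Rightarrow> 'a lamination_curve \<Rightarrow> bool" where
  "associated_lamination \<Sigma> \<tau> l \<longleftrightarrow>
     (\<exists>t c k ps qs. t \<in> triangles \<Sigma> \<and> edge \<Sigma> t k = \<tau> \<and> c \<noteq> k \<and>
        ray \<Sigma> (t, c, k) ps \<and> ray \<Sigma> (move \<Sigma> (move \<Sigma> (t, c, k) Cross) Along) qs \<and>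
        l = (if list_ex (exits_through \<Sigma> \<tau>) ps \<and> list_ex (exits_through \<Sigma> \<tau>) qs
             then Loop (upto_first (exits_through \<Sigma> \<tau>) qs)
             else Strand (rev (map flip_passage ps) @ qs)))"

definition principal_lamination ::
    "'a::metric_space tsurface \<Rightarrow> ('a set \<Rightarrow> 'a lamination_curve) \<Rightarrow> bool" where
  "principal_lamination \<Sigma> L \<longleftrightarrow> (\<forall>\<tau> \<in> arcs \<Sigma>. associated_lamination \<Sigma> \<tau> (L \<tau>))"

text \<open>Each crossing with an arc is given by the passages before and after it.\<close>

fun crossings :: "'a lamination_curve \<Rightarrow> ('a passage \<times> 'a passage) list" where
  "crossings (Strand ps) = zip ps (tl ps)"
| "crossings (Loop ps) = zip ps (rotate1 ps)"

text \<open>The common endpoint of the sides \<open>i\<close>, \<open>j\<close> of a passage \<open>(t, i, j)\<close> lies on its right, with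
  respect to the reference orientation of \<open>t\<close>, iff \<open>j = i + 1\<close>.  The value is 1 for an
  \<open>S\<close>-intersection and -1 for a \<open>Z\<close>-intersection, for the reference orientation of
  the triangle of the first passage.\<close>

definition sz_sign :: "'a::metric_space tsurface \<Rightarrow> 'a passage \<times> 'a passage \<Rightarrow> int" where
  "sz_sign \<Sigma> = (\<lambda>((t, i, j), (t', i', j')).
     (let before_right = (j = i + 1);
          after_right = ((j' = i' + 1) = coherent \<Sigma> t j)
      in if before_right \<and> \<not> after_right then 1
         else if \<not> before_right \<and> after_right then - 1 else 0))"

text \<open>Shear coordinate of the preimage of \<open>l\<close> at the lift of the arc \<open>edge \<Sigma> t k\<close> which carries, next
  to side \<open>k\<close> of \<open>t\<close>, the reference orientation of \<open>t\<close>; the preimage meets this lift once for every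
  crossing of \<open>l\<close> with the arc.  The other lift has the opposite orientation, and its
  shear coordinate is the negative, as reversing the orientation exchanges left and right.\<close>

definition shear :: "'a::metric_space tsurface \<Rightarrow> 'a lamination_curve \<Rightarrow> 'a set \<Rightarrow> 3 \<Rightarrow> int" where
  "shear \<Sigma> l t k = (\<Sum>x \<leftarrow> crossings l. (case fst x of (u, i, j) \<Rightarrow>
      if (u, j) = (t, k) then sz_sign \<Sigma> x
      else if (u, j) = partner \<Sigma> t k then (if coherent \<Sigma> t k then sz_sign \<Sigma> x else - sz_sign \<Sigma> x)
      else 0))"


section \<open>Laurent polynomials\<close>

text \<open>Monomials are finitely supported exponent functions.  The variable \<open>YV \<tau>\<close> stands for the square
  root of \<open>y_\<tau>\<close>.\<close>

datatype 'e lvar = XV 'e | YV 'e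

type_synonym 'e laurent = "('e lvar \<Rightarrow>\<^sub>0 int) \<Rightarrow>\<^sub>0 int"

definition x_pow :: "'e \<Rightarrow> int \<Rightarrow> 'e laurent" where
  "x_pow \<tau> n = Poly_Mapping.single (Poly_Mapping.single (XV \<tau>) n) 1"

definition y_half_pow :: "'e \<Rightarrow> int \<Rightarrow> 'e laurent" where
  "y_half_pow \<tau> n = Poly_Mapping.single (Poly_Mapping.single (YV \<tau>) n) 1"

definition positive_version :: "'e laurent \<Rightarrow> 'e laurent" where
  "positive_version f = (THE g. (g = f \<or> g = - f) \<and> (\<forall>m. 0 \<le> Poly_Mapping.lookup g m))"

definition mat2 :: "'r::zero \<Rightarrow> 'r \<Rightarrow> 'r \<Rightarrow> 'r \<Rightarrow> 'r^2^2" where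
  "mat2 a b c d = vector [vector [a, b], vector [c, d]]"


section \<open>Elementary steps and M-paths\<close>

text \<open>In the corner \<open>c\<close> of a triangle with its reference orientation, moving from side \<open>c + 2\<close> to side
  \<open>c + 1\<close> is counterclockwise around \<open>c\<close>; hence \<open>Turn\<close> from \<open>k\<close> is clockwise iff \<open>k = c + 1\<close>, and
  leaving the triangle through \<open>k\<close> is clockwise iff \<open>k = c + 2\<close>.  Going along side \<open>k\<close> from
  corner \<open>c\<close> inside the triangle, the side is on the right iff \<open>c = k + 1\<close>.  All this is
  reversed if \<open>\<omega> t c = -1\<close>.\<close>

fun step_matrix :: "'a::metric_space tsurface \<Rightarrow> ('a set \<Rightarrow> 3 \<Rightarrow> int) \<Rightarrow> ('a set \<Rightarrow> 'a lamination_curve) \<Rightarrow>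
    'a position \<Rightarrow> step \<Rightarrow> ('a set laurent)^2^2" where
  "step_matrix \<Sigma> \<omega> L (t, c, k) Turn =
     (let clockwise = ((k = c + 1) = (\<omega> t c = 1));
          a = x_pow (edge \<Sigma> t c) 1 * x_pow (edge \<Sigma> t k) (- 1) * x_pow (edge \<Sigma> t (third c k)) (- 1)
      in mat2 1 0 (if clockwise then a else - a) 1)"
| "step_matrix \<Sigma> \<omega> L (t, c, k) Cross =
     (let \<tau> = edge \<Sigma> t k;
          clockwise = ((k = c + 2) = (\<omega> t c = 1));
          b = \<omega> t c * shear \<Sigma> (L \<tau>) t k
      in if (clockwise \<and> b = 1) \<or> (\<not> clockwise \<and> b = - 1)
         then mat2 (y_half_pow \<tau> (- 1)) 0 0 (y_half_pow \<tau> 1)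
         else mat2 (y_half_pow \<tau> 1) 0 0 (y_half_pow \<tau> (- 1)))"
| "step_matrix \<Sigma> \<omega> L (t, c, k) Along =
     (let \<tau> = edge \<Sigma> t k;
          on_right = ((c = k + 1) = (\<omega> t c = 1))
      in if \<omega> t c = \<omega> t (third c k)
         then (if on_right then mat2 0 (x_pow \<tau> 1) (- x_pow \<tau> (- 1)) 0
               else mat2 0 (- x_pow \<tau> 1) (x_pow \<tau> (- 1)) 0)
         else (if on_right then mat2 0 (x_pow \<tau> 1) (x_pow \<tau> (- 1)) 0
               else mat2 0 (- x_pow \<tau> 1) (- x_pow \<tau> (- 1)) 0))"

text \<open>An elementary path is given by its starting position and its steps; arcs, but not
  boundary segments, may be crossed.\<close>

fun elementary_path :: "'a::metric_space tsurface \<Rightarrow> 'a position \<Rightarrow> step list \<Rightarrow> bool" where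
  "elementary_path \<Sigma> p [] = is_position \<Sigma> p"
| "elementary_path \<Sigma> p (s # ss) \<longleftrightarrow> is_position \<Sigma> p \<and>
     (s = Cross \<longrightarrow> edge \<Sigma> (fst p) (snd (snd p)) \<in> arcs \<Sigma>) \<and> elementary_path \<Sigma> (move \<Sigma> p s) ss"

definition endpoint :: "'a::metric_space tsurface \<Rightarrow> 'a position \<Rightarrow> step list \<Rightarrow> 'a position" where
  "endpoint \<Sigma> p ss = foldl (move \<Sigma>) p ss"

fun path_matrix :: "'a::metric_space tsurface \<Rightarrow> ('a set \<Rightarrow> 3 \<Rightarrow> int) \<Rightarrow> ('a set \<Rightarrow> 'a lamination_curve) \<Rightarrow>
    'a position \<Rightarrow> step list \<Rightarrow> ('a set laurent)^2^2" where
  "path_matrix \<Sigma> \<omega> L p [] = mat 1"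
| "path_matrix \<Sigma> \<omega> L p (s # ss) = path_matrix \<Sigma> \<omega> L (move \<Sigma> p s) ss ** step_matrix \<Sigma> \<omega> L p s"

text \<open>The curve on the surface: inside a triangle every step is drawn as a straight segment in the
  chart, which is isotopic to the step along the horocycle or parallel to the side.\<close>

definition position_point :: "3 \<Rightarrow> 3 \<Rightarrow> real^3" where
  "position_point c k = (\<chi> i. if i = c then 7/10 else if i = k then 1/10 else 2/10)"

definition crossing_point :: "3 \<Rightarrow> 3 \<Rightarrow> real^3" where
  "crossing_point c k = (\<chi> i. if i = c then 3/4 else if i = k then 0 else 1/4)"

fun step_curve :: "'a::metric_space tsurface \<Rightarrow> 'a position \<Rightarrow> step \<Rightarrow> real \<Rightarrow> 'a" where
  "step_curve \<Sigma> (t, c, k) Cross = (case move \<Sigma> (t, c, k) Cross of (t', c', k') \<Rightarrow>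
     (chart \<Sigma> t \<circ> linepath (position_point c k) (crossing_point c k)) +++
     (chart \<Sigma> t' \<circ> linepath (crossing_point c' k') (position_point c' k')))"
| "step_curve \<Sigma> (t, c, k) Turn =
     chart \<Sigma> t \<circ> linepath (position_point c k) (position_point c (third c k))"
| "step_curve \<Sigma> (t, c, k) Along =
     chart \<Sigma> t \<circ> linepath (position_point c k) (position_point (third c k) k)"

fun path_curve :: "'a::metric_space tsurface \<Rightarrow> 'a position \<Rightarrow> step list \<Rightarrow> real \<Rightarrow> 'a" where
  "path_curve \<Sigma> (t, c, k) [] = (\<lambda>_. chart \<Sigma> t (position_point c k))"
| "path_curve \<Sigma> p (s # ss) = step_curve \<Sigma> p s +++ path_curve \<Sigma> (move \<Sigma> p s) ss"

definition crossing_number :: "'a::metric_space tsurface \<Rightarrow> (real \<Rightarrow> 'a) \<Rightarrow> nat" where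
  "crossing_number \<Sigma> \<beta> = (LEAST n. \<exists>\<gamma>. homotopic_loops (surface_interior (surf \<Sigma>)) \<beta> \<gamma> \<and>
     finite {s \<in> {0..<1}. \<gamma> s \<in> \<Union> (arcs \<Sigma>)} \<and> card {s \<in> {0..<1}. \<gamma> s \<in> \<Union> (arcs \<Sigma>)} = n)"

text \<open>An M-path traverses \<open>curve_square \<alpha>\<close> twice along \<open>\<alpha>\<close> and is in general not simple, so being
  isotopic to \<open>\<beta>\<close> means freely homotopic.  As \<open>\<beta>\<close> is drawn with the minimal number of
  crossings with \<open>T\<close>, this is also the number of crossings of the M-path.\<close>

definition M_path :: "'a::metric_space tsurface \<Rightarrow> (real \<Rightarrow> 'a) \<Rightarrow> 'a position \<Rightarrow> step list \<Rightarrow> bool" where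
  "M_path \<Sigma> \<beta> p ss \<longleftrightarrow> elementary_path \<Sigma> p ss \<and> endpoint \<Sigma> p ss = p \<and>
     homotopic_loops (surface_interior (surf \<Sigma>)) \<beta> (path_curve \<Sigma> p ss) \<and>
     length (filter (\<lambda>s. s = Cross) ss) = crossing_number \<Sigma> \<beta>"

definition chi_bar :: "'a::metric_space tsurface \<Rightarrow> ('a set \<Rightarrow> 3 \<Rightarrow> int) \<Rightarrow>
    ('a set \<Rightarrow> 'a lamination_curve) \<Rightarrow> (real \<Rightarrow> 'a) \<Rightarrow> 'a set laurent" where
  "chi_bar \<Sigma> \<omega> L \<beta> = (THE f. \<exists>p ss. M_path \<Sigma> \<beta> p ss \<and>
     f = positive_version (trace (path_matrix \<Sigma> \<omega> L p ss)))"

end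

theory Submission
  imports Defs
begin

text \<open>The matrices of the elementary steps define a local system of rank two on the surface: the matrices
  of closed elementary paths inside a triangle, and of those that go once around an arc, are trivial up to
  sign.  So the trace of the matrix of an M-path depends, up to sign, only on the free homotopy class of the
  curve: it is the trace of the holonomy \<open>T\<close> of a flat connection along the curve.  The holonomy of
  \<open>\<alpha>\<^sup>2\<close> is \<open>T ** T\<close>, and \<open>trace (T ** T) = (trace T)\<^sup>2 - 2 * det T\<close>.  The determinant of the holonomy is
  the monodromy of the orientation double cover, hence \<open>det T = -1\<close> for a one-sided curve.  Finally,
  \<open>trace T\<close> is positive up to sign because, after removing backtracks, \<open>T\<close> is conjugate to a product of
  matrices that are non-negative up to sign.\<close>

text \<open>\<open>chi_bar\<close> is a definite description over all M-paths, so besides uniqueness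
  of the value an M-path has to exist: a curve with the minimal number of crossings must be redrawn
  in elementary steps without additional crossings. Since the surface is given only topologically,
  discs around the triangles and the arcs are built from the charts for this purpose. The step
  matrices obey the relations of a local system only up to sign; a circuit of the six positions
  inside a triangle gives -1. A genuine local system arises by giving each triangle one fibre and
  choosing one matrix for each arc. These choices need not satisfy any relation, because the marked
  points lie on the boundary and no interior point meets several arcs. The lost sign is harmless: it
  disappears in \<open>positive_version\<close>, in squares and in determinants of size two. The
  determinant -1 comes from arcs between triangles with opposite reference orientations.
  One-sidedness, however, is defined through neighbourhoods; to use it, a sign that is preserved
  along the curve has to be extended to an orientation of a neighbourhood.\<close>

lemma index3_arith [simp]:
  fixes k :: 3
  shows "k + 1 + 1 = k + 2" "k + 1 + 2 = k" "k + 2 + 1 = k" "k + 2 + 2 = k + 1"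
    "k + 1 \<noteq> k" "k + 2 \<noteq> k" "k + 1 \<noteq> k + 2" "k + 2 \<noteq> k + 1" "k \<noteq> k + 1" "k \<noteq> k + 2"
  by (simp_all add: add.assoc)

lemma index3_cases: "(c::3) = k \<or> c = k + 1 \<or> c = k + 2"
  using exhaust_3[of c] exhaust_3[of k] by (elim disjE; hypsubst; simp)

lemma position_cases: "c \<noteq> k \<Longrightarrow> c = k + 1 \<or> c = k + (2::3)"
  using index3_cases[of c k] by auto

text \<open>Enumerating the indices from an arbitrary side \<open>k\<close> keeps later arguments
  symmetric under rotation of the triangle and replaces a case split over 0, 1, 2.\<close>

lemma UNIV3_shift: "UNIV = {k, k + 1, k + (2::3)}"
  using index3_cases by fastforce

lemma sum3_shift: "(\<Sum>i\<in>UNIV. f i) = f k + f (k + 1) + f (k + (2::3))"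
  by (subst UNIV3_shift[of k]) (simp add: add.assoc)

lemma all3_shift: "(\<forall>i. P i) \<longleftrightarrow> P k \<and> P (k + 1) \<and> P (k + (2::3))"
  by (metis index3_cases)

lemma third_shift [simp]:
  "third (k + 1) k = k + 2" "third (k + 2) k = k + 1" "third k (k + 1) = k + 2" "third k (k + 2) = k + 1"
  "third (k + 1) (k + 2) = k" "third (k + 2) (k + 1) = k"
  using exhaust_3[of k] by (elim disjE; hypsubst; simp add: third_def)+

lemma third_third [simp]: "third c (third c k) = k" "third (third c k) k = c"
  by (simp_all add: third_def)

lemma third_neq: "c \<noteq> k \<Longrightarrow> third c k \<noteq> k" "c \<noteq> k \<Longrightarrow> third c k \<noteq> c" "c \<noteq> k \<Longrightarrow> c \<noteq> third c k"
  using index3_cases[of c k] by auto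

section \<open>Local systems: flat sections and parallel transport\<close>

lemma eventually_compose_within:
  assumes "continuous_on K f" "z \<in> K" "f ` K \<subseteq> X"
    and "eventually P (at (f z) within X)" "P (f z)"
  shows "\<forall>\<^sub>F w in at z within K. P (f w)"
proof -
  obtain S where S: "open S" "f z \<in> S" "\<And>y. y \<in> S \<Longrightarrow> y \<noteq> f z \<Longrightarrow> y \<in> X \<Longrightarrow> P y"
    using assms(4) unfolding eventually_at_topological by blast
  then obtain A where A: "open A" "z \<in> A" "\<And>w. w \<in> K \<Longrightarrow> w \<in> A \<Longrightarrow> f w \<in> S"
    using assms(1,2) unfolding continuous_on_topological by metis
  \<comment> \<open>The filter at \<open>f z\<close> omits the point \<open>f z\<close>, which
    \<open>f\<close> may take again near \<open>z\<close>; this is where \<open>P (f z)\<close>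
    enters.\<close>
  have "P (f w)" if "w \<in> A" "w \<in> K" for w
    using S A that assms by (cases "f w = f z") auto
  with A show ?thesis unfolding eventually_at_topological by blast
qed

text \<open>A locally constant sheaf whose stalks are all identified with the type
  \<open>'f\<close>: \<open>s i x\<close> is the coordinate of the stalk at \<open>x\<close> in the
  patch \<open>U i\<close>, and \<open>transition\<close> says that changes of coordinates are
  locally constant. The identification with \<open>'f\<close> need not be continuous in
  \<open>x\<close>, so a single type serves for a twisted sheaf.\<close>

locale local_system =
  fixes X :: "'a::topological_space set" and I :: "'i set" and U :: "'i \<Rightarrow> 'a set"
    and s :: "'i \<Rightarrow> 'a \<Rightarrow> 'f \<Rightarrow> 'f"
  assumes open_U: "i \<in> I \<Longrightarrow> openin (top_of_set X) (U i)"
    and cover: "x \<in> X \<Longrightarrow> \<exists>i\<in>I. x \<in> U i"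
    and bij_s: "i \<in> I \<Longrightarrow> x \<in> U i \<Longrightarrow> bij (s i x)"
    and transition: "i \<in> I \<Longrightarrow> j \<in> I \<Longrightarrow> x \<in> U i \<Longrightarrow> x \<in> U j \<Longrightarrow>
      \<forall>\<^sub>F y in at x within X. \<forall>v w. s i y v = s i x w \<longrightarrow> s j y v = s j x w"
begin

text \<open>Sections along a map \<open>f\<close> from any space \<open>K\<close>, so that paths,
  homotopy squares and subsets of \<open>X\<close> are treated alike.\<close>

definition flat :: "'b::topological_space set \<Rightarrow> ('b \<Rightarrow> 'a) \<Rightarrow> ('b \<Rightarrow> 'f) \<Rightarrow> bool" where
  "flat K f \<sigma> \<longleftrightarrow> (\<forall>z\<in>K. \<forall>i\<in>I. f z \<in> U i \<longrightarrow>
     (\<forall>\<^sub>F w in at z within K. s i (f w) (\<sigma> w) = s i (f z) (\<sigma> z)))"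

lemma U_subset: "i \<in> I \<Longrightarrow> U i \<subseteq> X"
  using open_U openin_imp_subset by blast

lemma s_inj: "i \<in> I \<Longrightarrow> x \<in> U i \<Longrightarrow> s i x v = s i x w \<longleftrightarrow> v = w"
  using bij_s bij_is_inj inj_eq by metis

lemma eventually_in_U:
  assumes "continuous_on K f" "z \<in> K" "f ` K \<subseteq> X" "i \<in> I" "f z \<in> U i"
  shows "\<forall>\<^sub>F w in at z within K. f w \<in> U i"
proof (rule eventually_compose_within[OF assms(1,2,3)])
  obtain T where "open T" "U i = X \<inter> T"
    using open_U[OF assms(4)] unfolding openin_open by blast
  with assms show "\<forall>\<^sub>F y in at (f z) within X. y \<in> U i"
    unfolding eventually_at_topological by blast
qed (use assms in auto)

text \<open>The definition tests every patch around \<open>f z\<close>; by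
  \<open>transition\<close>, constancy in one patch carries over to all others.\<close>

lemma flatI:
  assumes "continuous_on K f" "f ` K \<subseteq> X"
    and "\<And>z. z \<in> K \<Longrightarrow> \<exists>i\<in>I. f z \<in> U i \<and> (\<forall>\<^sub>F w in at z within K. s i (f w) (\<sigma> w) = s i (f z) (\<sigma> z))"
  shows "flat K f \<sigma>"
  unfolding flat_def
proof (intro ballI impI)
  fix z j assume z: "z \<in> K" and j: "j \<in> I" "f z \<in> U j"
  obtain i where i: "i \<in> I" "f z \<in> U i"
    and ev: "\<forall>\<^sub>F w in at z within K. s i (f w) (\<sigma> w) = s i (f z) (\<sigma> z)"
    using assms(3)[OF z] by blast
  have "\<forall>\<^sub>F w in at z within K. \<forall>v u. s i (f w) v = s i (f z) u \<longrightarrow> s j (f w) v = s j (f z) u"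
    by (rule eventually_compose_within[OF assms(1) z assms(2)])
      (use transition[OF i(1) j(1) i(2) j(2)] s_inj[OF i] in auto)
  with ev show "\<forall>\<^sub>F w in at z within K. s j (f w) (\<sigma> w) = s j (f z) (\<sigma> z)"
    by eventually_elim blast
qed

lemma flat_subset: "flat K f \<sigma> \<Longrightarrow> K' \<subseteq> K \<Longrightarrow> flat K' f \<sigma>"
  unfolding flat_def by (meson at_le filter_leD subsetD)

lemma flat_cong:
  assumes "flat K f \<sigma>" "\<And>z. z \<in> K \<Longrightarrow> f z = g z" "\<And>z. z \<in> K \<Longrightarrow> \<sigma> z = \<tau> z"
  shows "flat K g \<tau>"
  unfolding flat_def
proof (intro ballI impI)
  fix z i assume *: "z \<in> K" "i \<in> I" "g z \<in> U i"
  then have "\<forall>\<^sub>F w in at z within K. s i (f w) (\<sigma> w) = s i (f z) (\<sigma> z)"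
    using assms by (auto simp: flat_def)
  moreover have "\<forall>\<^sub>F w in at z within K. w \<in> K"
    by (simp add: eventually_at_filter)
  ultimately show "\<forall>\<^sub>F w in at z within K. s i (g w) (\<tau> w) = s i (g z) (\<tau> z)"
    by eventually_elim (use assms * in auto)
qed

lemma flat_compose:
  assumes "flat K f \<sigma>" "continuous_on K' \<phi>" "\<phi> ` K' \<subseteq> K"
  shows "flat K' (f \<circ> \<phi>) (\<sigma> \<circ> \<phi>)"
  unfolding flat_def
proof (intro ballI impI)
  fix z i assume "z \<in> K'" "i \<in> I" "(f \<circ> \<phi>) z \<in> U i"
  then show "\<forall>\<^sub>F w in at z within K'. s i ((f \<circ> \<phi>) w) ((\<sigma> \<circ> \<phi>) w) = s i ((f \<circ> \<phi>) z) ((\<sigma> \<circ> \<phi>) z)"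
    using assms
    by (auto simp: flat_def intro!: eventually_compose_within[of K' \<phi> z K "\<lambda>w. s i (f w) (\<sigma> w) = s i (f (\<phi> z)) (\<sigma> (\<phi> z))"])
qed

lemma flat_const_on:
  assumes "continuous_on K f" "i \<in> I" "f ` K \<subseteq> U i" "\<And>z. z \<in> K \<Longrightarrow> s i (f z) (\<sigma> z) = c"
  shows "flat K f \<sigma>"
proof (rule flatI)
  show "\<exists>i\<in>I. f z \<in> U i \<and> (\<forall>\<^sub>F w in at z within K. s i (f w) (\<sigma> w) = s i (f z) (\<sigma> z))" if "z \<in> K" for z
    using assms that by (intro bexI[of _ i]) (auto simp: eventually_at_filter)
qed (use assms U_subset in auto)

text \<open>In a patch around any point both sections have locally constant coordinates, and
  coordinates are injective; so agreement is locally constant and spreads over the connected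
  set.\<close>

lemma flat_unique:
  assumes "connected K" "continuous_on K f" "f ` K \<subseteq> X" "flat K f \<sigma>" "flat K f \<tau>"
    and "a \<in> K" "\<sigma> a = \<tau> a" "b \<in> K"
  shows "\<sigma> b = \<tau> b"
proof (rule connected_induction_simple[OF assms(1,6,8), of "\<lambda>z. \<sigma> z = \<tau> z"])
  fix z assume z: "z \<in> K"
  then obtain i where i: "i \<in> I" "f z \<in> U i" using cover assms(3) by blast
  have "\<forall>\<^sub>F w in at z within K. f w \<in> U i \<and> s i (f w) (\<sigma> w) = s i (f z) (\<sigma> z) \<and> s i (f w) (\<tau> w) = s i (f z) (\<tau> z)"
    using eventually_in_U[OF assms(2) z assms(3) i] assms(4,5) z i
    by (simp add: flat_def eventually_conj_iff)
  then obtain S where S: "open S" "z \<in> S" "\<And>w. w \<in> S \<Longrightarrow> w \<noteq> z \<Longrightarrow> w \<in> K \<Longrightarrow>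
      f w \<in> U i \<and> s i (f w) (\<sigma> w) = s i (f z) (\<sigma> z) \<and> s i (f w) (\<tau> w) = s i (f z) (\<tau> z)"
    unfolding eventually_at_topological by blast
  then have "\<sigma> w = \<tau> w \<longleftrightarrow> \<sigma> z = \<tau> z" if "w \<in> S \<inter> K" for w
  proof (cases "w = z")
    case False
    then have "f w \<in> U i" "s i (f w) (\<sigma> w) = s i (f z) (\<sigma> z)" "s i (f w) (\<tau> w) = s i (f z) (\<tau> z)"
      using S(3) that by auto
    then show ?thesis using s_inj[OF i(1), of "f w"] s_inj[OF i(1,2)] by metis
  qed simp
  then have "\<forall>x\<in>K \<inter> S. \<forall>y\<in>K \<inter> S. \<sigma> x = \<tau> x \<longrightarrow> \<sigma> y = \<tau> y" by blast
  moreover have "openin (top_of_set K) (K \<inter> S)" using S(1) by (rule openin_open_Int)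
  ultimately show "\<exists>T. openin (top_of_set K) T \<and> z \<in> T \<and> (\<forall>x\<in>T. \<forall>y\<in>T. \<sigma> x = \<tau> x \<longrightarrow> \<sigma> y = \<tau> y)"
    using S(2) z by blast
qed (use assms in auto)

text \<open>Near a point outside one of the closed pieces that piece is invisible; at a common point
  the filters of both pieces together give the filter of the union.\<close>

lemma flat_Un:
  assumes "closed K1" "closed K2" "flat K1 f \<sigma>" "flat K2 f \<tau>" "\<And>z. z \<in> K1 \<inter> K2 \<Longrightarrow> \<sigma> z = \<tau> z"
  shows "flat (K1 \<union> K2) f (\<lambda>z. if z \<in> K1 then \<sigma> z else \<tau> z)"
  unfolding flat_def
proof (intro ballI impI)
  let ?\<rho> = "\<lambda>z. if z \<in> K1 then \<sigma> z else \<tau> z"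
  fix z i assume z: "z \<in> K1 \<union> K2" and i: "i \<in> I" "f z \<in> U i"
  have ev: "\<forall>\<^sub>F w in at z within K. s i (f w) (?\<rho> w) = s i (f z) (?\<rho> z)"
    if K: "closed K" "flat K f ?\<rho>" for K
  proof (cases "z \<in> K")
    case False
    then show ?thesis
      using K(1) unfolding eventually_at_topological by (intro exI[of _ "- K"]) auto
  qed (use K i in \<open>auto simp: flat_def\<close>)
  have "flat K1 f ?\<rho>" by (rule flat_cong[OF assms(3)]) auto
  moreover have "flat K2 f ?\<rho>" by (rule flat_cong[OF assms(4)]) (use assms(5) in auto)
  ultimately show "\<forall>\<^sub>F w in at z within K1 \<union> K2. s i (f w) (?\<rho> w) = s i (f z) (?\<rho> z)"
    using ev assms(1,2) unfolding at_within_union eventually_sup by blast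
qed

definition liftable :: "'b::topological_space set \<Rightarrow> ('b \<Rightarrow> 'a) \<Rightarrow> bool" where
  "liftable K f \<longleftrightarrow> (\<forall>a\<in>K. \<forall>v. \<exists>\<sigma>. flat K f \<sigma> \<and> \<sigma> a = v)"

lemma liftable_in_U:
  assumes "continuous_on K f" "i \<in> I" "f ` K \<subseteq> U i"
  shows "liftable K f"
  unfolding liftable_def
proof (intro ballI allI)
  fix a v assume a: "a \<in> K"
  have bij: "bij (s i (f z))" if "z \<in> K" for z using assms that bij_s by auto
  have "flat K f (\<lambda>z. inv (s i (f z)) (s i (f a) v))"
    by (rule flat_const_on[OF assms, where c = "s i (f a) v"])
      (use bij in \<open>auto simp: surj_f_inv_f bij_is_surj\<close>)
  then show "\<exists>\<sigma>. flat K f \<sigma> \<and> \<sigma> a = v"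
    using bij[OF a] by (intro exI conjI) (assumption, auto simp: inv_f_f bij_is_inj)
qed

text \<open>A section over one piece is continued from a point of the overlap; connectedness of the
  overlap and \<open>flat_unique\<close> make both sections agree there.\<close>

lemma liftable_Un:
  assumes "closed K1" "closed K2" "connected (K1 \<inter> K2)" "continuous_on (K1 \<union> K2) f" "f ` (K1 \<union> K2) \<subseteq> X"
    and "liftable K1 f" "liftable K2 f"
  shows "liftable (K1 \<union> K2) f"
proof -
  have main: "\<exists>\<rho>. flat (A \<union> B) f \<rho> \<and> \<rho> a = v"
    if AB: "closed A" "closed B" "connected (A \<inter> B)" "continuous_on (A \<union> B) f" "f ` (A \<union> B) \<subseteq> X"
      "liftable A f" "liftable B f" and a: "a \<in> A" for A B :: "'b set" and a v
  proof -
    obtain \<sigma> where \<sigma>: "flat A f \<sigma>" "\<sigma> a = v"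
      using AB(6) a unfolding liftable_def by blast
    have "\<exists>\<tau>. flat B f \<tau> \<and> (\<forall>z\<in>A \<inter> B. \<sigma> z = \<tau> z)"
    proof (cases "A \<inter> B = {}")
      case True
      have "\<exists>\<tau>. flat B f \<tau>"
        using AB(7) unfolding liftable_def by (metis empty_iff equals0I flat_def)
      with True show ?thesis by auto
    next
      case False
      then obtain b where b: "b \<in> A \<inter> B" by blast
      then obtain \<tau> where \<tau>: "flat B f \<tau>" "\<tau> b = \<sigma> b"
        using AB(7) unfolding liftable_def by auto
      have "\<sigma> z = \<tau> z" if "z \<in> A \<inter> B" for z
        by (rule flat_unique[OF AB(3) _ _ flat_subset[OF \<sigma>(1)] flat_subset[OF \<tau>(1)] b _ that])
          (use AB \<tau> in \<open>auto intro: continuous_on_subset\<close>)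
      with \<tau> show ?thesis by auto
    qed
    then obtain \<tau> where \<tau>: "flat B f \<tau>" "\<And>z. z \<in> A \<inter> B \<Longrightarrow> \<sigma> z = \<tau> z" by auto
    show ?thesis
      using flat_Un[OF AB(1,2) \<sigma>(1) \<tau>(1) \<tau>(2)] \<sigma>(2) a by auto
  qed
  show ?thesis
    unfolding liftable_def
  proof (intro ballI allI)
    fix a v assume "a \<in> K1 \<union> K2"
    then show "\<exists>\<sigma>. flat (K1 \<union> K2) f \<sigma> \<and> \<sigma> a = v"
      using main[of K1 K2 a v] main[of K2 K1 a v] assms by (auto simp: Int_commute Un_commute)
  qed
qed

text \<open>Bisection in each coordinate plays the role of a Lebesgue number: small rectangles lie
  in one patch, and neighbouring rectangles meet in a convex, hence connected, set.\<close>

lemma liftable_square: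
  fixes f :: "real \<times> real \<Rightarrow> 'a"
  defines "R \<equiv> {0..1} \<times> {0..1}"
  assumes f: "continuous_on R f" "f ` R \<subseteq> X"
  shows "liftable R f"
proof -
  let ?K = "\<lambda>a b c d. ({a..b} \<times> {c..d}) \<inter> R"
  have conv: "convex R" unfolding R_def by (intro convex_Times) auto
  have clR: "closed R" unfolding R_def by (intro closed_Times) auto
  have cl: "closed (?K a b c d)" for a b c d
    using clR by (intro closed_Int closed_Times) auto
  have con: "connected (?K a b c d \<inter> ?K a' b' c' d')" for a b c d a' b' c' d'
    by (intro convex_connected convex_Int convex_Times conv) auto
  have un: "liftable (A \<union> B) f" if "A = ?K a b c d" "B = ?K a' b' c' d'" "liftable A f" "liftable B f"
    for A B a b c d a' b' c' d'
    by (rule liftable_Un)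
      (use that cl con f in \<open>auto intro: continuous_on_subset simp del: Int_iff\<close>)
  \<comment> \<open>For fixed \<open>x\<close>, bisection of the second coordinate produces a full
    vertical strip, whose admissible width depends on \<open>x\<close>; the outer bisection joins
    such strips.\<close>
  have strip: "\<exists>\<delta>>0. \<forall>a b. a \<le> x \<and> x \<le> b \<and> b - a < \<delta> \<longrightarrow> liftable (?K a b 0 1) f"
    if x: "0 \<le> x" "x \<le> 1" for x
  proof (rule Bolzano[of 0 1 "\<lambda>c d. \<exists>\<delta>>0. \<forall>a b. a \<le> x \<and> x \<le> b \<and> b - a < \<delta> \<longrightarrow> liftable (?K a b c d) f"])
    fix c d e :: real
    assume le: "c \<le> d" "d \<le> e"
      and "\<exists>\<delta>>0. \<forall>a b. a \<le> x \<and> x \<le> b \<and> b - a < \<delta> \<longrightarrow> liftable (?K a b c d) f"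
      and "\<exists>\<delta>>0. \<forall>a b. a \<le> x \<and> x \<le> b \<and> b - a < \<delta> \<longrightarrow> liftable (?K a b d e) f"
    then obtain \<delta>1 \<delta>2 where \<delta>: "\<delta>1 > 0" "\<delta>2 > 0"
      "\<And>a b. a \<le> x \<and> x \<le> b \<and> b - a < \<delta>1 \<Longrightarrow> liftable (?K a b c d) f"
      "\<And>a b. a \<le> x \<and> x \<le> b \<and> b - a < \<delta>2 \<Longrightarrow> liftable (?K a b d e) f"
      by blast
    have "?K a b c e = ?K a b c d \<union> ?K a b d e" for a b using le by auto
    then show "\<exists>\<delta>>0. \<forall>a b. a \<le> x \<and> x \<le> b \<and> b - a < \<delta> \<longrightarrow> liftable (?K a b c e) f"
      using \<delta> un[OF refl refl] by (intro exI[of _ "min \<delta>1 \<delta>2"]) auto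
  next
    fix y :: real assume y: "0 \<le> y" "y \<le> 1"
    then have xy: "(x, y) \<in> R" using x by (auto simp: R_def)
    then obtain i where i: "i \<in> I" "f (x, y) \<in> U i" using f(2) cover by blast
    have "\<forall>\<^sub>F w in at (x, y) within R. f w \<in> U i"
      by (rule eventually_in_U[OF f(1) xy f(2) i])
    then obtain r where r: "r > 0" "\<And>w. w \<in> R \<Longrightarrow> dist w (x, y) < r \<Longrightarrow> f w \<in> U i"
      unfolding eventually_at using i by (metis)
    \<comment> \<open>Sides shorter than \<open>r / 2\<close> keep the rectangle in the ball of
      radius \<open>r\<close>, as the distance is at most the sum of the coordinate
      distances.\<close>
    have *: "liftable (?K a b c d) f"
      if "a \<le> x" "x \<le> b" "b - a < r / 2" "c \<le> y" "y \<le> d" "d - c < r / 2" for a b c d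
    proof (rule liftable_in_U[OF _ i(1)])
      show "f ` ?K a b c d \<subseteq> U i"
      proof safe
        fix u w assume *: "u \<in> {a..b}" "w \<in> {c..d}" "(u, w) \<in> R"
        have "dist (u, w) (x, y) \<le> \<bar>u - x\<bar> + \<bar>w - y\<bar>"
          by (simp add: dist_Pair_Pair dist_real_def sqrt_sum_squares_le_sum_abs)
        also have "\<dots> < r" using * that by auto
        finally show "f (u, w) \<in> U i" using r * by blast
      qed
    qed (use f in \<open>auto intro: continuous_on_subset\<close>)
    show "\<exists>\<epsilon>>0. \<forall>c d. c \<le> y \<and> y \<le> d \<and> d - c < \<epsilon> \<longrightarrow>
        (\<exists>\<delta>>0. \<forall>a b. a \<le> x \<and> x \<le> b \<and> b - a < \<delta> \<longrightarrow> liftable (?K a b c d) f)"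
      using r(1) * by (intro exI[of _ "r / 2"] conjI allI impI) auto
  qed auto
  have "liftable (?K 0 1 0 1) f"
  proof (rule Bolzano[of 0 1 "\<lambda>a b. liftable (?K a b 0 1) f"])
    fix a b c :: real
    assume "a \<le> b" "b \<le> c" "liftable (?K a b 0 1) f" "liftable (?K b c 0 1) f"
    moreover from this have "?K a c 0 1 = ?K a b 0 1 \<union> ?K b c 0 1" by auto
    ultimately show "liftable (?K a c 0 1) f" using un[OF refl refl] by simp
  qed (use strip in auto)
  then show ?thesis by (simp add: R_def)
qed

text \<open>A path is a square that is constant in its first coordinate; restriction to a vertical
  edge turns a section over the square into one over the path.\<close>

lemma liftable_path:
  assumes "path \<gamma>" "path_image \<gamma> \<subseteq> X"
  shows "liftable {0..1} \<gamma>"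
  unfolding liftable_def
proof (intro ballI allI)
  fix a :: real and v assume a: "a \<in> {0..1}"
  have "continuous_on ({0..1::real} \<times> {0..1::real}) (\<gamma> \<circ> snd)"
    using assms(1) unfolding path_def
    by (intro continuous_on_compose continuous_on_snd continuous_on_id) (auto intro: continuous_on_subset)
  moreover have "(\<gamma> \<circ> snd) ` ({0..1::real} \<times> {0..1}) \<subseteq> X"
    using assms(2) by (auto simp: path_image_def)
  ultimately have "liftable ({0..1::real} \<times> {0..1::real}) (\<gamma> \<circ> snd)" by (rule liftable_square)
  then obtain \<sigma> where \<sigma>: "flat ({0..1::real} \<times> {0..1}) (\<gamma> \<circ> snd) \<sigma>" "\<sigma> (0, a) = v"
    unfolding liftable_def using a by (metis (no_types) SigmaI atLeastAtMost_iff order_refl zero_le_one)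
  have "flat {0..1} ((\<gamma> \<circ> snd) \<circ> Pair (0::real)) (\<sigma> \<circ> Pair 0)"
    by (rule flat_compose[OF \<sigma>(1)]) (auto intro!: continuous_intros)
  then show "\<exists>\<sigma>. flat {0..1} \<gamma> \<sigma> \<and> \<sigma> a = v"
    using \<sigma>(2) by (intro exI[of _ "\<sigma> \<circ> Pair 0"]) (auto simp: o_def)
qed

text \<open>Left as a relation to avoid side conditions; along a path in \<open>X\<close> it is the
  graph of a bijection of the fibre, by \<open>transport_exists\<close> and
  \<open>transport_unique\<close>.\<close>

definition transport :: "(real \<Rightarrow> 'a) \<Rightarrow> 'f \<Rightarrow> 'f \<Rightarrow> bool" where
  "transport \<gamma> v w \<longleftrightarrow> (\<exists>\<sigma>. flat {0..1} \<gamma> \<sigma> \<and> \<sigma> 0 = v \<and> \<sigma> 1 = w)"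

lemma transport_exists:
  assumes "path \<gamma>" "path_image \<gamma> \<subseteq> X"
  shows "\<exists>w. transport \<gamma> v w" "\<exists>v. transport \<gamma> v w"
  using liftable_path[OF assms] unfolding liftable_def transport_def by fastforce+

lemma transport_unique:
  assumes "path \<gamma>" "path_image \<gamma> \<subseteq> X" "transport \<gamma> v w" "transport \<gamma> v' w'"
  shows "v = v' \<longleftrightarrow> w = w'"
proof -
  obtain \<sigma> \<tau> where *: "flat {0..1} \<gamma> \<sigma>" "\<sigma> 0 = v" "\<sigma> 1 = w" "flat {0..1} \<gamma> \<tau>" "\<tau> 0 = v'" "\<tau> 1 = w'"
    using assms unfolding transport_def by blast
  show ?thesis
    using flat_unique[OF _ _ _ *(1,4), of 0 1] flat_unique[OF _ _ _ *(1,4), of 1 0] assms(1,2) *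
    by (auto simp: path_def path_image_def)
qed

lemma transport_in_U:
  assumes "path \<gamma>" "i \<in> I" "path_image \<gamma> \<subseteq> U i" "s i (\<gamma> 0) v = s i (\<gamma> 1) w"
  shows "transport \<gamma> v w"
proof -
  have U: "\<gamma> z \<in> U i" if "z \<in> {0..1}" for z using assms(3) that by (auto simp: path_image_def)
  let ?\<tau> = "\<lambda>z. inv (s i (\<gamma> z)) (s i (\<gamma> 0) v)"
  have "flat {0..1} \<gamma> ?\<tau>"
    by (rule flat_const_on[where i = i and c = "s i (\<gamma> 0) v"])
      (use assms(1,2) U bij_s in \<open>auto simp: path_def surj_f_inv_f bij_is_surj\<close>)
  moreover have "?\<tau> 0 = v" using U[of 0] assms(2) by (auto intro!: inv_f_f bij_is_inj bij_s)
  moreover have "?\<tau> 1 = w" using U[of 1] assms(2) unfolding assms(4) by (auto intro!: inv_f_f bij_is_inj bij_s)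
  ultimately show ?thesis unfolding transport_def by blast
qed

lemma transport_join:
  assumes "transport p u v" "transport q v w" "pathfinish p = pathstart q"
  shows "transport (p +++ q) u w"
proof -
  obtain \<sigma> \<tau> where \<sigma>: "flat {0..1} p \<sigma>" "\<sigma> 0 = u" "\<sigma> 1 = v" and \<tau>: "flat {0..1} q \<tau>" "\<tau> 0 = v" "\<tau> 1 = w"
    using assms unfolding transport_def by blast
  have 1: "flat {0..1/2} (p \<circ> (\<lambda>x. 2 * x)) (\<sigma> \<circ> (\<lambda>x. 2 * x))"
    by (rule flat_compose[OF \<sigma>(1)]) (auto intro!: continuous_intros)
  have 2: "flat {1/2..1} (q \<circ> (\<lambda>x. 2 * x - 1)) (\<tau> \<circ> (\<lambda>x. 2 * x - 1))"
    by (rule flat_compose[OF \<tau>(1)]) (auto intro!: continuous_intros)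
  have 1: "flat {0..1/2} (p +++ q) (\<sigma> \<circ> (\<lambda>x. 2 * x))"
    by (rule flat_cong[OF 1]) (auto simp: joinpaths_def)
  have 2: "flat {1/2..1} (p +++ q) (\<tau> \<circ> (\<lambda>x. 2 * x - 1))"
  proof (rule flat_cong[OF 2])
    fix z :: real assume z: "z \<in> {1/2..1}"
    show "(q \<circ> (\<lambda>x. 2 * x - 1)) z = (p +++ q) z"
    proof (cases "z = 1/2")
      case True
      then have "2 * z = 1" by simp
      then show ?thesis using assms(3) by (auto simp: joinpaths_def pathfinish_def pathstart_def)
    qed (use z in \<open>auto simp: joinpaths_def\<close>)
  qed auto
  have un: "{0..1/2} \<union> {1/2..1} = {0..1::real}" by auto
  let ?\<rho> = "\<lambda>z. if z \<in> {0..1/2} then (\<sigma> \<circ> (\<lambda>x. 2 * x)) z else (\<tau> \<circ> (\<lambda>x. 2 * x - 1)) z"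
  have "flat ({0..1/2} \<union> {1/2..1}) (p +++ q) ?\<rho>"
  proof (rule flat_Un[OF _ _ 1 2])
    fix z :: real assume "z \<in> {0..1/2} \<inter> {1/2..1}"
    then have z: "z = 1/2" by auto
    show "(\<sigma> \<circ> (\<lambda>x. 2 * x)) z = (\<tau> \<circ> (\<lambda>x. 2 * x - 1)) z" unfolding z using \<sigma> \<tau> by simp
  qed auto
  then show ?thesis
    unfolding transport_def un using \<sigma> \<tau> by (intro exI[of _ ?\<rho>]) auto
qed

text \<open>Used with right multiplication of matrices: if the identity is transported to
  \<open>T\<close>, then \<open>A\<close> is transported to \<open>T ** A\<close>, so one matrix
  describes the whole transport.\<close>

lemma transport_map:
  assumes "\<And>i x v. s i x (g v) = g (s i x v)" "transport \<gamma> v w"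
  shows "transport \<gamma> (g v) (g w)"
proof -
  obtain \<sigma> where \<sigma>: "flat {0..1} \<gamma> \<sigma>" "\<sigma> 0 = v" "\<sigma> 1 = w"
    using assms(2) unfolding transport_def by blast
  have "flat {0..1} \<gamma> (g \<circ> \<sigma>)"
    using \<sigma>(1) unfolding flat_def o_def assms(1) by (smt (verit) eventually_mono)
  then show ?thesis unfolding transport_def using \<sigma> by (intro exI[of _ "g \<circ> \<sigma>"]) auto
qed

text \<open>The path \<open>r\<close> is the track of the base point under the homotopy.\<close>

lemma transport_homotopic_loops:
  assumes "homotopic_loops X p q"
  obtains r where "path r" "path_image r \<subseteq> X"
    "\<And>v w v' w'. transport p v w \<Longrightarrow> transport r v v' \<Longrightarrow> transport r w w' \<Longrightarrow> transport q v' w'"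
proof -
  obtain H :: "real \<times> real \<Rightarrow> 'a" where H0: "continuous_on ({0..1} \<times> {0..1}) H" "H \<in> ({0..1} \<times> {0..1}) \<rightarrow> X"
    "\<forall>x\<in>{0..1}. H (0, x) = p x" "\<forall>x\<in>{0..1}. H (1, x) = q x"
    "\<forall>t\<in>{0..1}. pathfinish (H \<circ> Pair t) = pathstart (H \<circ> Pair t)"
    using assms unfolding homotopic_loops by blast
  then have H: "continuous_on ({0..1} \<times> {0..1}) H" "H ` ({0..1} \<times> {0..1}) \<subseteq> X"
    "\<And>x. x \<in> {0..1} \<Longrightarrow> H (0, x) = p x" "\<And>x. x \<in> {0..1} \<Longrightarrow> H (1, x) = q x"
    "\<And>t. t \<in> {0..1} \<Longrightarrow> H (t, 1) = H (t, 0)"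
    by (auto simp: pathfinish_def pathstart_def)
  define r where "r = (\<lambda>t. H (t, 0))"
  have r: "path r" "path_image r \<subseteq> X"
    using H(1,2) unfolding r_def path_def path_image_def
    by (auto intro!: continuous_on_compose2[OF H(1)] continuous_intros)
  show ?thesis
  proof (rule that[OF r])
    fix v w v' w' assume tr: "transport p v w" "transport r v v'" "transport r w w'"
    \<comment> \<open>A section over the whole square; restricted to the four edges it realises the
      four transports, and uniqueness identifies its values at the corners.\<close>
    obtain \<sigma> where \<sigma>: "flat ({0..1} \<times> {0..1}) H \<sigma>" "\<sigma> (0, 0) = v"
      using liftable_square[OF H(1,2), unfolded liftable_def, rule_format, of "(0, 0)" v] by auto
    have flat: "flat {0..1} (H \<circ> \<phi>) (\<sigma> \<circ> \<phi>)" if "continuous_on {0..1} \<phi>" "\<phi> ` {0..1} \<subseteq> {0..1} \<times> {0..1}" for \<phi> :: "real \<Rightarrow> _"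
      by (rule flat_compose[OF \<sigma>(1) that])
    have "flat {0..1} p (\<sigma> \<circ> Pair 0)"
      by (rule flat_cong[OF flat[of "Pair 0"]]) (auto simp: H intro!: continuous_intros)
    then have "transport p v (\<sigma> (0, 1))" unfolding transport_def using \<sigma>(2) by fastforce
    moreover have "path p" "path_image p \<subseteq> X"
      using assms homotopic_loops_imp_path homotopic_loops_imp_subset by blast+
    ultimately have w: "\<sigma> (0, 1) = w" using transport_unique tr(1) by blast
    have "flat {0..1} r (\<sigma> \<circ> (\<lambda>t. (t, 0)))"
      by (rule flat_cong[OF flat[of "\<lambda>t. (t, 0)"]]) (auto simp: r_def intro!: continuous_intros)
    then have "transport r v (\<sigma> (1, 0))" unfolding transport_def using \<sigma>(2) by fastforce
    then have v': "\<sigma> (1, 0) = v'" using transport_unique[OF r] tr(2) by blast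
    \<comment> \<open>Every stage of the homotopy is a loop, so the end points run along the same
      track \<open>r\<close> as the starting points.\<close>
    have "flat {0..1} r (\<sigma> \<circ> (\<lambda>t. (t, 1)))"
      by (rule flat_cong[OF flat[of "\<lambda>t. (t, 1)"]]) (auto simp: r_def H intro!: continuous_intros)
    then have "transport r w (\<sigma> (1, 1))" unfolding transport_def using w by fastforce
    then have w': "\<sigma> (1, 1) = w'" using transport_unique[OF r] tr(3) by blast
    have "flat {0..1} q (\<sigma> \<circ> Pair 1)"
      by (rule flat_cong[OF flat[of "Pair 1"]]) (auto simp: H intro!: continuous_intros)
    then show "transport q v' w'" unfolding transport_def using v' w' by fastforce
  qed
qed

end

section \<open>Points of the surface in the charts\<close>

lemma side_point_nth [simp]:
  "side_point k s $ k = 0" "side_point k s $ (k + 1) = 1 - s" "side_point k s $ (k + 2) = s"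
  by (simp_all add: side_point_def axis_def)

lemma vec3_eq_iff: "p = q \<longleftrightarrow> p $ k = q $ k \<and> p $ (k + 1) = q $ (k + 1) \<and> p $ (k + 2) = q $ (k + 2)"
  for p q :: "'b^3"
  unfolding vec_eq_iff by (rule all3_shift)

lemma side_point_corner: "side_point k 0 = axis (k + 1) 1" "side_point k 1 = axis (k + 2) 1"
  by (simp_all add: side_point_def)

lemma simplex3_iff: "p \<in> simplex3 \<longleftrightarrow>
    0 \<le> p $ k \<and> 0 \<le> p $ (k + 1) \<and> 0 \<le> p $ (k + 2) \<and> p $ k + p $ (k + 1) + p $ (k + 2) = 1"
  unfolding simplex3_def sum3_shift[of _ k] by (subst all3_shift[of _ k]) auto

lemma open_simplex3_iff: "p \<in> open_simplex3 \<longleftrightarrow>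
    0 < p $ k \<and> 0 < p $ (k + 1) \<and> 0 < p $ (k + 2) \<and> p $ k + p $ (k + 1) + p $ (k + 2) = 1"
  unfolding open_simplex3_def mem_Collect_eq simplex3_iff[of _ k] by (subst all3_shift[of _ k]) auto

lemma side_point_in_simplex3 [simp]: "side_point k s \<in> simplex3 \<longleftrightarrow> s \<in> {0..1}"
  by (auto simp: simplex3_iff[of _ k])

lemma side_point_notin_open [simp]: "side_point k s \<notin> open_simplex3"
  by (auto simp: open_simplex3_iff[of _ k])

lemma side_point_eqI: "p \<in> simplex3 \<Longrightarrow> p $ k = 0 \<Longrightarrow> p = side_point k (p $ (k + 2))"
  by (auto simp: simplex3_iff[of _ k] vec3_eq_iff[of _ _ k])

lemma simplex3_cases:
  assumes "p \<in> simplex3"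
  obtains "p \<in> open_simplex3" | k s where "s \<in> {0..1}" "p = side_point k s"
proof (cases "p \<in> open_simplex3")
  case False
  then obtain k where "p $ k = 0"
    using assms unfolding open_simplex3_def simplex3_def by (auto simp: not_less) (meson antisym)
  then have "p = side_point k (p $ (k + 2))" using side_point_eqI assms by blast
  moreover have "p $ (k + 2) \<in> {0..1}" using assms \<open>p $ k = 0\<close> by (auto simp: simplex3_iff[of _ k])
  ultimately show ?thesis using that(2) by blast
qed (use that in blast)

lemma convex_simplex3: "convex simplex3"
  unfolding convex_def simplex3_def
  by (auto simp: sum.distrib simp flip: sum_distrib_left)

lemma convex_open_simplex3: "convex open_simplex3"
  unfolding convex_def
proof (intro ballI allI impI)
  fix x y :: "real^3" and u v :: real
  assume *: "x \<in> open_simplex3" "y \<in> open_simplex3" "0 \<le> u" "0 \<le> v" "u + v = 1"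
  then have "u *\<^sub>R x + v *\<^sub>R y \<in> simplex3"
    using convex_simplex3 unfolding convex_def open_simplex3_def by blast
  moreover have "0 < u * x $ i + v * y $ i" for i
  proof -
    have "0 < x $ i" "0 < y $ i" using * by (auto simp: open_simplex3_def)
    then show ?thesis using *(3-5)
      by (cases "u = 0") (auto intro!: add_pos_nonneg)
  qed
  ultimately show "u *\<^sub>R x + v *\<^sub>R y \<in> open_simplex3" by (simp add: open_simplex3_def)
qed

lemma compact_simplex3: "compact simplex3"
proof -
  have "closed simplex3"
    unfolding simplex3_def
    by (intro closed_Collect_conj closed_Collect_all closed_Collect_le closed_Collect_eq continuous_intros)
  moreover have "simplex3 \<subseteq> cbox 0 1"
  proof
    fix p :: "real^3" assume "p \<in> simplex3"
    then have "0 \<le> p $ i \<and> p $ i \<le> 1" for i using simplex3_iff[of p i] by linarith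
    then show "p \<in> cbox 0 1" by (simp add: mem_box_cart)
  qed
  then have "bounded simplex3" using bounded_cbox bounded_subset by blast
  ultimately show ?thesis using compact_eq_bounded_closed by blast
qed

text \<open>The triangle spanned by side \<open>k\<close> and the centre, with the open side but
  without the corners. The three regions are disjoint, convex and relatively open; two of them glued
  along an arc will form a disc.\<close>

definition region :: "3 \<Rightarrow> (real^3) set" where
  "region k = {p \<in> simplex3. p $ k < p $ (k + 1) \<and> p $ k < p $ (k + 2)}"

lemma region_disjoint: "p \<in> region k \<Longrightarrow> p \<in> region j \<Longrightarrow> k = j"
  using index3_cases[of j k] by (auto simp: region_def)

lemma convex_region: "convex (region k)"
proof -
  have "region k = simplex3 \<inter> {p. (axis (k + 1) 1 - axis k 1) \<bullet> p > 0} \<inter> {p. (axis (k + 2) 1 - axis k 1) \<bullet> p > 0}"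
    by (auto simp: region_def inner_diff_left inner_axis_axis inner_axis')
  then show ?thesis
    by (simp only:) (intro convex_Int convex_simplex3 convex_halfspace_gt)
qed

lemma openin_region: "openin (top_of_set simplex3) (region k)"
proof -
  have op: "open {p :: real^3. p $ k < p $ (k + 1)}" "open {p :: real^3. p $ k < p $ (k + 2)}"
    by (intro open_Collect_less continuous_intros)+
  have "region k = simplex3 \<inter> ({p. p $ k < p $ (k + 1)} \<inter> {p. p $ k < p $ (k + 2)})"
    by (auto simp: region_def)
  then show ?thesis using openin_open_Int[OF open_Int[OF op], of simplex3] by simp
qed

lemma openin_open_simplex3: "openin (top_of_set simplex3) open_simplex3"
proof -
  have "open (\<Inter>i::3. {p :: real^3. 0 < p $ i})"
    by (intro open_INT ballI open_Collect_less continuous_intros) auto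
  then have "openin (top_of_set simplex3) (simplex3 \<inter> (\<Inter>i. {p. 0 < p $ i}))"
    by (rule openin_open_Int)
  moreover have "simplex3 \<inter> (\<Inter>i. {p. 0 < p $ i}) = open_simplex3"
    by (auto simp: open_simplex3_def)
  ultimately show ?thesis by simp
qed

lemma side_point_in_region: "0 < s \<Longrightarrow> s < 1 \<Longrightarrow> side_point k s \<in> region k"
  by (simp add: region_def)

lemma region_cases:
  assumes "p \<in> region k"
  obtains "p \<in> open_simplex3" | s where "0 < s" "s < 1" "p = side_point k s"
proof (cases "p $ k = 0")
  case True
  then have "p = side_point k (p $ (k + 2))" using side_point_eqI assms by (auto simp: region_def)
  moreover have "0 < p $ (k + 2)" "p $ (k + 2) < 1"
    using assms True by (auto simp: region_def simplex3_iff[of _ k])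
  ultimately show ?thesis using that(2) by blast
next
  case False
  then have "p \<in> open_simplex3"
    using assms by (auto simp: region_def simplex3_iff[of _ k] open_simplex3_iff[of _ k])
  then show ?thesis using that(1) by blast
qed

section \<open>The surface as a quotient of its triangles\<close>

locale triangulated =
  fixes \<Sigma> :: "'a::metric_space tsurface"
  assumes triangulated: "triangulated_surface \<Sigma>"
begin

abbreviation X :: "'a set" where "X \<equiv> surface_interior (surf \<Sigma>)"

lemma compact_surf: "compact (surf \<Sigma>)"
  using triangulated by (simp add: triangulated_surface_def compact_surface_def)

lemma openin_X: "openin (top_of_set (surf \<Sigma>)) X"
proof (subst openin_subopen, intro ballI)
  fix x assume "x \<in> X"
  then obtain U where U: "openin (top_of_set (surf \<Sigma>)) U" "x \<in> U" "U homeomorphic (ball 0 1 :: complex set)"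
    by (auto simp: surface_interior_def)
  moreover have "U \<subseteq> X" using U openin_imp_subset[OF U(1)] by (auto simp: surface_interior_def)
  ultimately show "\<exists>U. openin (top_of_set (surf \<Sigma>)) U \<and> x \<in> U \<and> U \<subseteq> X" by blast
qed

lemma closed_boundary: "closed (surface_boundary (surf \<Sigma>))"
proof -
  have "closedin (top_of_set (surf \<Sigma>)) (surf \<Sigma> - X)" by (rule closedin_diff[OF closedin_subtopology_refl[THEN iffD2] openin_X]) simp
  then show ?thesis unfolding surface_boundary_def
    using compact_surf compact_imp_closed closedin_closed_trans by blast
qed

lemma marked_notin_X: "x \<in> marked \<Sigma> \<Longrightarrow> x \<notin> X"
  using triangulated by (auto simp: triangulated_surface_def marked_points_def surface_boundary_def)

lemma bseg_notin_X: "e \<in> bsegs \<Sigma> \<Longrightarrow> x \<in> e \<Longrightarrow> x \<notin> X"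
proof -
  assume "e \<in> bsegs \<Sigma>" and x: "x \<in> e"
  then obtain C where "C \<in> components (surface_boundary (surf \<Sigma>) - marked \<Sigma>)" "e = closure C"
    by (auto simp: bsegs_def boundary_segments_def)
  then have "e \<subseteq> surface_boundary (surf \<Sigma>)"
    by (metis Diff_subset closed_boundary closure_minimal in_components_subset order_trans)
  with x show "x \<notin> X" by (auto simp: surface_boundary_def)
qed

lemma triangulation: "triangulation (surf \<Sigma>) (marked \<Sigma>) (arcs \<Sigma>)"
  using triangulated by (simp add: triangulated_surface_def)

lemma arc_facts:
  assumes "e \<in> arcs \<Sigma>"
  shows "e - marked \<Sigma> \<subseteq> X" "e \<notin> bsegs \<Sigma>"
proof -
  obtain g where g: "is_arc (surf \<Sigma>) (marked \<Sigma>) g" "path_image g = e"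
    using triangulation[unfolded triangulation_def, THEN conjunct2, THEN conjunct1] assms by blast
  have gX: "g ` {0<..<1} \<subseteq> X" "g 0 \<in> marked \<Sigma>" "g 1 \<in> marked \<Sigma>"
    using g(1) unfolding is_arc_def pathstart_def pathfinish_def by blast+
  have "g s \<in> X \<or> g s \<in> marked \<Sigma>" if "s \<in> {0..1}" for s
  proof -
    have "s = 0 \<or> s = 1 \<or> s \<in> {0<..<1}" using that by auto
    then show ?thesis using gX by blast
  qed
  then show "e - marked \<Sigma> \<subseteq> X" using g(2) unfolding path_image_def by blast
  have "(1/2::real) \<in> {0<..<1}" "(1/2::real) \<in> {0..1}" by auto
  then have "g (1/2) \<in> X" "g (1/2) \<in> e" using g(2) gX(1) unfolding path_image_def by blast+
  then show "e \<notin> bsegs \<Sigma>" using bseg_notin_X by blast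
qed

lemma arcs_meet: "e \<in> arcs \<Sigma> \<Longrightarrow> e' \<in> arcs \<Sigma> \<Longrightarrow> x \<in> e \<Longrightarrow> x \<in> e' \<Longrightarrow> x \<in> X \<Longrightarrow> e = e'"
  using triangulation[unfolded triangulation_def, THEN conjunct2, THEN conjunct2, THEN conjunct1] marked_notin_X by blast

lemma finite_arcs: "finite (arcs \<Sigma>)"
  using triangulation by (simp add: triangulation_def)

lemma triangle_charts: "triangle_charts \<Sigma>"
  using triangulated by (simp add: triangulated_surface_def)

lemma finite_triangles: "finite (triangles \<Sigma>)"
  using triangle_charts by (simp add: triangle_charts_def)

lemma chart_facts:
  assumes "t \<in> triangles \<Sigma>"
  shows "continuous_on simplex3 (chart \<Sigma> t)" "inj_on (chart \<Sigma> t) open_simplex3"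
    "chart \<Sigma> t ` open_simplex3 = t" "chart \<Sigma> t (axis c 1) \<in> marked \<Sigma>"
    "edge \<Sigma> t k \<in> arcs \<Sigma> \<union> bsegs \<Sigma>" "inj_on (\<lambda>s. chart \<Sigma> t (side_point k s)) {0<..<1}"
    "s \<in> {0<..<1} \<Longrightarrow> chart \<Sigma> t (side_point k s) \<notin> marked \<Sigma>"
proof -
  note c = triangle_charts[unfolded triangle_charts_def, THEN conjunct2, THEN conjunct1, rule_format, OF assms]
  show "continuous_on simplex3 (chart \<Sigma> t)" by (rule c[THEN conjunct1])
  show "inj_on (chart \<Sigma> t) open_simplex3" by (rule c[THEN conjunct2, THEN conjunct1])
  show "chart \<Sigma> t ` open_simplex3 = t" by (rule c[THEN conjunct2, THEN conjunct2, THEN conjunct1])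
  show "chart \<Sigma> t (axis c 1) \<in> marked \<Sigma>"
    by (rule c[THEN conjunct2, THEN conjunct2, THEN conjunct2, THEN conjunct1, rule_format])
  note d = c[THEN conjunct2, THEN conjunct2, THEN conjunct2, THEN conjunct2, rule_format, of k]
  show "edge \<Sigma> t k \<in> arcs \<Sigma> \<union> bsegs \<Sigma>" by (rule d[THEN conjunct1])
  show "inj_on (\<lambda>s. chart \<Sigma> t (side_point k s)) {0<..<1}" by (rule d[THEN conjunct2, THEN conjunct1])
  show "s \<in> {0<..<1} \<Longrightarrow> chart \<Sigma> t (side_point k s) \<notin> marked \<Sigma>"
    by (rule d[THEN conjunct2, THEN conjunct2, rule_format])
qed

lemma triangle_subset: "t \<in> triangles \<Sigma> \<Longrightarrow> t \<subseteq> X - \<Union> (arcs \<Sigma>)"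
  by (simp add: triangles_def in_components_subset)

lemma triangle_disjoint: "t \<in> triangles \<Sigma> \<Longrightarrow> u \<in> triangles \<Sigma> \<Longrightarrow> x \<in> t \<Longrightarrow> x \<in> u \<Longrightarrow> t = u"
  unfolding triangles_def using components_nonoverlap by blast

definition arc_side :: "'a set \<Rightarrow> 3 \<Rightarrow> bool" where
  "arc_side t k \<longleftrightarrow> t \<in> triangles \<Sigma> \<and> edge \<Sigma> t k \<in> arcs \<Sigma>"

text \<open>An arc occurs as exactly two sides, possibly of one triangle; this makes
  \<open>partner\<close> well defined, an involution and free of fixed points.\<close>

lemma arc_side_partner:
  assumes "arc_side t k"
  obtains t' k' where "partner \<Sigma> t k = (t', k')" "arc_side t' k'" "(t', k') \<noteq> (t, k)"
    "edge \<Sigma> t' k' = edge \<Sigma> t k" "partner \<Sigma> t' k' = (t, k)"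
    "\<And>u j. u \<in> triangles \<Sigma> \<Longrightarrow> edge \<Sigma> u j = edge \<Sigma> t k \<Longrightarrow> (u, j) = (t, k) \<or> (u, j) = (t', k')"
proof -
  let ?A = "{(u, j). u \<in> triangles \<Sigma> \<and> edge \<Sigma> u j = edge \<Sigma> t k}"
  have "card ?A = 2" using triangle_charts assms by (auto simp: triangle_charts_def arc_side_def)
  then obtain a b where ab: "?A = {a, b}" "a \<noteq> b" by (auto simp: card_2_iff)
  have "(t, k) \<in> ?A" using assms by (auto simp: arc_side_def)
  then have "?A = {(t, k), (if a = (t, k) then b else a)}" "(if a = (t, k) then b else a) \<noteq> (t, k)"
    using ab by auto
  then obtain q where q: "?A = {(t, k), q}" "q \<noteq> (t, k)" by blast
  obtain t' k' where [simp]: "q = (t', k')" by (cases q)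
  have q': "t' \<in> triangles \<Sigma>" "edge \<Sigma> t' k' = edge \<Sigma> t k" using q by auto
  have all: "(u, j) = (t, k) \<or> (u, j) = (t', k')" if "u \<in> triangles \<Sigma>" "edge \<Sigma> u j = edge \<Sigma> t k" for u j
  proof -
    have "(u, j) \<in> ?A" using that by auto
    then show ?thesis unfolding q(1) by auto
  qed
  have 1: "partner \<Sigma> t k = (t', k')" unfolding partner_def
  proof (rule the_equality)
    fix r assume "fst r \<in> triangles \<Sigma> \<and> r \<noteq> (t, k) \<and> edge \<Sigma> (fst r) (snd r) = edge \<Sigma> t k"
    then show "r = (t', k')" using all[of "fst r" "snd r"] by simp
  qed (use q q' in simp)
  have 2: "partner \<Sigma> t' k' = (t, k)" unfolding partner_def
  proof (rule the_equality)
    fix r assume "fst r \<in> triangles \<Sigma> \<and> r \<noteq> (t', k') \<and> edge \<Sigma> (fst r) (snd r) = edge \<Sigma> t' k'"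
    then show "r = (t, k)" using all[of "fst r" "snd r"] q' by simp
  qed (use q q' assms in \<open>auto simp: arc_side_def\<close>)
  show ?thesis
    by (rule that[OF 1 _ _ q'(2) 2 all]) (use q q' assms in \<open>auto simp: arc_side_def\<close>)
qed

lemma coherent_partner:
  assumes "arc_side t k" "partner \<Sigma> t k = (t', k')"
  shows "coherent \<Sigma> t' k' = coherent \<Sigma> t k"
proof -
  have "partner \<Sigma> t' k' = (t, k)" using assms by (metis arc_side_partner prod.inject)
  moreover have "(\<forall>s\<in>{0..1}. P s = Q (1 - s)) \<longleftrightarrow> (\<forall>s\<in>{0..1}. Q s = P (1 - s))" for P Q :: "real \<Rightarrow> 'a"
  proof (intro iffI ballI)
    fix s :: real assume *: "\<forall>s\<in>{0..1}. P s = Q (1 - s)" "s \<in> {0..1}"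
    show "Q s = P (1 - s)" using *(1)[rule_format, of "1 - s"] *(2) by simp
  next
    fix s :: real assume *: "\<forall>s\<in>{0..1}. Q s = P (1 - s)" "s \<in> {0..1}"
    show "P s = Q (1 - s)" using *(1)[rule_format, of "1 - s"] *(2) by simp
  qed
  ultimately show ?thesis using assms(2) by (simp add: coherent_def)
qed

text \<open>The parameter of the same point of the arc seen from the partner side: sides of
  coherently oriented neighbours run in opposite directions.\<close>

definition glue :: "'a set \<Rightarrow> 3 \<Rightarrow> real \<Rightarrow> real" where
  "glue t k s = (if coherent \<Sigma> t k then 1 - s else s)"

lemma chart_glue:
  assumes "arc_side t k" "partner \<Sigma> t k = (t', k')" "s \<in> {0..1}"
  shows "chart \<Sigma> t (side_point k s) = chart \<Sigma> t' (side_point k' (glue t k s))"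
proof (cases "coherent \<Sigma> t k")
  case True
  then show ?thesis using assms(2,3) by (auto simp: coherent_def glue_def)
next
  case False
  have *: "t' \<in> triangles \<Sigma>" "(t, k) \<noteq> (t', k')" "edge \<Sigma> t k = edge \<Sigma> t' k'" "t \<in> triangles \<Sigma>"
    using arc_side_partner[OF assms(1)] assms(1,2) by (auto simp: arc_side_def elim: arc_side_partner)
  then have "(\<forall>s\<in>{0..1}. chart \<Sigma> t (side_point k s) = chart \<Sigma> t' (side_point k' s)) \<or>
      (\<forall>s\<in>{0..1}. chart \<Sigma> t (side_point k s) = chart \<Sigma> t' (side_point k' (1 - s)))"
    using triangle_charts unfolding triangle_charts_def by blast
  then show ?thesis using False assms(2,3) by (auto simp: coherent_def glue_def)
qed

text \<open>The open triangle together with those open sides that are arcs; corners and boundary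
  segments are cut off because they lie outside \<open>X\<close>.\<close>

definition cell :: "'a set \<Rightarrow> (real^3) set" where
  "cell t = {p \<in> simplex3. chart \<Sigma> t p \<in> X}"

lemma chart_in_edge: "s \<in> {0..1} \<Longrightarrow> chart \<Sigma> t (side_point k s) \<in> edge \<Sigma> t k"
  by (auto simp: edge_def)

lemma open_in_cell:
  assumes "t \<in> triangles \<Sigma>" "p \<in> open_simplex3"
  shows "p \<in> cell t" "chart \<Sigma> t p \<in> t"
proof -
  show "chart \<Sigma> t p \<in> t" using chart_facts(3)[OF assms(1)] assms(2) by blast
  then show "p \<in> cell t" using triangle_subset[OF assms(1)] assms(2)
    by (auto simp: cell_def open_simplex3_def)
qed

lemma side_in_cell:
  assumes "arc_side t k" "0 < s" "s < 1"
  shows "side_point k s \<in> cell t"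
proof -
  have "chart \<Sigma> t (side_point k s) \<in> edge \<Sigma> t k - marked \<Sigma>"
    using assms chart_in_edge[of s] chart_facts(7)[of t s k] by (auto simp: arc_side_def)
  then show ?thesis
    using arc_facts(1)[of "edge \<Sigma> t k"] assms by (auto simp: arc_side_def cell_def)
qed

lemma cell_cases:
  assumes "t \<in> triangles \<Sigma>" "p \<in> cell t"
  obtains "p \<in> open_simplex3" | k s where "0 < s" "s < 1" "p = side_point k s" "arc_side t k"
proof -
  have p: "p \<in> simplex3" "chart \<Sigma> t p \<in> X" using assms(2) by (auto simp: cell_def)
  from p(1) show ?thesis
  proof (cases rule: simplex3_cases)
    case (2 k s)
    have "s \<noteq> 0" "s \<noteq> 1"
      using p(2) 2 side_point_corner[of k] marked_notin_X[OF chart_facts(4)[OF assms(1), of "k + 1"]]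
        marked_notin_X[OF chart_facts(4)[OF assms(1), of "k + 2"]] by auto
    moreover have "edge \<Sigma> t k \<notin> bsegs \<Sigma>"
      using bseg_notin_X chart_in_edge p(2) 2 by blast
    then have "arc_side t k" using chart_facts(5)[OF assms(1)] assms(1) by (auto simp: arc_side_def)
    ultimately show ?thesis using that(2) 2 by (auto simp: order.strict_iff_order)
  qed (use that in blast)
qed

lemma cell_subset: "cell t \<subseteq> simplex3" "chart \<Sigma> t ` cell t \<subseteq> X"
  by (auto simp: cell_def)

lemma region_cell:
  assumes "arc_side t k"
  shows "region k \<subseteq> cell t"
proof
  fix p assume "p \<in> region k"
  then show "p \<in> cell t"
  proof (cases rule: region_cases)
    case 1
    then show ?thesis using assms open_in_cell(1) by (simp add: arc_side_def)
  next
    case 2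
    then show ?thesis using side_in_cell[OF assms] by simp
  qed
qed

lemma point_in_chart:
  assumes "x \<in> X"
  obtains t p where "t \<in> triangles \<Sigma>" "p \<in> cell t" "chart \<Sigma> t p = x"
proof (cases "x \<in> \<Union> (arcs \<Sigma>)")
  case True
  then obtain e where e: "e \<in> arcs \<Sigma>" "x \<in> e" by blast
  have "card {(t, k). t \<in> triangles \<Sigma> \<and> edge \<Sigma> t k = e} = 2"
    using triangle_charts e by (auto simp: triangle_charts_def)
  then have "{(t, k). t \<in> triangles \<Sigma> \<and> edge \<Sigma> t k = e} \<noteq> {}" by (metis card.empty zero_neq_numeral)
  then obtain t k where t: "t \<in> triangles \<Sigma>" "edge \<Sigma> t k = e" by blast
  then obtain s where "s \<in> {0..1}" "x = chart \<Sigma> t (side_point k s)"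
    using e by (auto simp: edge_def)
  then have "side_point k s \<in> cell t" "chart \<Sigma> t (side_point k s) = x" using assms by (simp_all add: cell_def)
  then show ?thesis using that t(1) by blast
next
  case False
  then have "x \<in> \<Union> (triangles \<Sigma>)" using assms by (simp add: triangles_def)
  then obtain t where "t \<in> triangles \<Sigma>" "x \<in> chart \<Sigma> t ` open_simplex3"
    using chart_facts(3) by blast
  then show ?thesis using that open_in_cell(1) by blast
qed

text \<open>On the cells the charts identify exactly what is glued: the open triangles are disjoint
  from each other and from the arcs, two arcs do not meet in \<open>X\<close>, and one arc has just
  two sides.\<close>

lemma chart_eq_cases:
  assumes "t \<in> triangles \<Sigma>" "u \<in> triangles \<Sigma>" "p \<in> cell t" "q \<in> cell u" "chart \<Sigma> t p = chart \<Sigma> u q"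
  obtains "t = u" "p = q"
  | k s j where "0 < s" "s < 1" "arc_side t k" "partner \<Sigma> t k = (u, j)" "p = side_point k s" "q = side_point j (glue t k s)"
proof -
  have notin: "chart \<Sigma> t (side_point k s) \<notin> u" if "arc_side t k" "0 < s" "s < 1" "u \<in> triangles \<Sigma>" for t u k s
    using that triangle_subset[OF that(4)] chart_in_edge[of s t k] by (auto simp: arc_side_def)
  show ?thesis
  proof (cases rule: cell_cases[OF assms(1,3)])
    case p: 1
    from assms(2,4) have "q \<in> open_simplex3"
    proof (cases rule: cell_cases)
      case (2 j r)
      then show ?thesis using notin[of u j r t] assms open_in_cell(2)[OF assms(1) p] by simp
    qed
    then have "t = u"
      using triangle_disjoint[OF assms(1,2) open_in_cell(2)[OF assms(1) p]] open_in_cell(2)[OF assms(2)] assms(5) by simp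
    with \<open>q \<in> open_simplex3\<close> p show ?thesis
      using chart_facts(2)[OF assms(1)] assms(5) that(1) by (auto simp: inj_on_def)
  next
    case p: (2 k s)
    have "q \<notin> open_simplex3"
      using notin[OF p(4,1,2) assms(2)] open_in_cell(2)[OF assms(2), of q] assms(5) p(3) by auto
    then obtain j r where q: "0 < r" "r < 1" "q = side_point j r" "arc_side u j"
      by (rule_tac cell_cases[OF assms(2,4)]) auto
    have "edge \<Sigma> t k = edge \<Sigma> u j"
      using arcs_meet[of "edge \<Sigma> t k" "edge \<Sigma> u j" "chart \<Sigma> t p"] p q assms chart_in_edge[of s t k] chart_in_edge[of r u j]
      by (auto simp: arc_side_def cell_def)
    obtain t' k' where t': "partner \<Sigma> t k = (t', k')" "arc_side t' k'" and
      "(u, j) = (t, k) \<or> (u, j) = (t', k')"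
      by (rule_tac arc_side_partner[OF p(4)]) (use assms(2) \<open>edge \<Sigma> t k = edge \<Sigma> u j\<close> in metis)
    then consider "(u, j) = (t, k)" | "(u, j) = (t', k')" by blast
    then show ?thesis
    proof cases
      case 1
      then have "r = s"
        using chart_facts(6)[OF assms(1), of k] p q assms(5) by (auto simp: inj_on_def)
      then show ?thesis using that(1) 1 p q by auto
    next
      case 2
      have g: "0 < glue t k s" "glue t k s < 1" using p by (auto simp: glue_def)
      have "chart \<Sigma> u (side_point j r) = chart \<Sigma> u (side_point j (glue t k s))"
        using chart_glue[OF p(4) t'(1), of s] p q 2 assms(5) by auto
      then have "r = glue t k s"
        using chart_facts(6)[OF assms(2), of j] p q g by (auto simp: inj_on_def)
      then show ?thesis using that(2)[of s k j] p q 2 t' by auto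
    qed
  qed
qed

text \<open>The surface is the quotient of the triangles under the gluing of their sides.\<close>

lemma openin_X_via_charts:
  assumes "N \<subseteq> X" "\<And>t. t \<in> triangles \<Sigma> \<Longrightarrow> openin (top_of_set simplex3) {p \<in> simplex3. chart \<Sigma> t p \<in> N}"
  shows "openin (top_of_set X) N"
proof -
  \<comment> \<open>Openness is proved through the complement, which is covered by finitely many
    continuous images of compact sets and therefore closed.\<close>
  define C where "C = (\<Union>t\<in>triangles \<Sigma>. chart \<Sigma> t ` {p \<in> simplex3. chart \<Sigma> t p \<notin> N})"
  have "compact (chart \<Sigma> t ` {p \<in> simplex3. chart \<Sigma> t p \<notin> N})" if t: "t \<in> triangles \<Sigma>" for t
  proof (rule compact_continuous_image)
    have "{p \<in> simplex3. chart \<Sigma> t p \<notin> N} = simplex3 - {p \<in> simplex3. chart \<Sigma> t p \<in> N}" by auto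
    then have "closedin (top_of_set simplex3) {p \<in> simplex3. chart \<Sigma> t p \<notin> N}"
      using assms(2)[OF t] by auto
    then show "compact {p \<in> simplex3. chart \<Sigma> t p \<notin> N}"
      using closedin_compact compact_simplex3 by blast
  qed (use chart_facts(1)[OF t] in \<open>auto intro: continuous_on_subset\<close>)
  then have "closed C" unfolding C_def using finite_triangles by (intro closed_UN) (auto intro: compact_imp_closed)
  moreover have "N = X \<inter> - C"
  proof
    show "X \<inter> - C \<subseteq> N"
    proof
      fix x assume x: "x \<in> X \<inter> - C"
      then obtain t p where "t \<in> triangles \<Sigma>" "p \<in> cell t" "chart \<Sigma> t p = x"
        using point_in_chart by blast
      then show "x \<in> N" using x by (auto simp: C_def cell_def)
    qed
  qed (use assms(1) in \<open>auto simp: C_def\<close>)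
  ultimately show ?thesis using openin_open_Int[of "- C" X] by (simp add: open_Compl)
qed

definition edge_nbhd :: "'a set \<Rightarrow> 'a set" where
  "edge_nbhd e = (\<Union>(t, k)\<in>{(t, k). arc_side t k \<and> edge \<Sigma> t k = e}. chart \<Sigma> t ` region k)"

lemma edge_nbhd_subset: "edge_nbhd e \<subseteq> X"
  using region_cell cell_subset by (fastforce simp: edge_nbhd_def)

lemma chart_in_edge_nbhd: "arc_side t k \<Longrightarrow> p \<in> region k \<Longrightarrow> chart \<Sigma> t p \<in> edge_nbhd (edge \<Sigma> t k)"
  by (auto simp: edge_nbhd_def)

lemma chart_in_side_region:
  assumes "t \<in> triangles \<Sigma>" "p \<in> cell t" "arc_side u j" "chart \<Sigma> t p \<in> chart \<Sigma> u ` region j"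
  shows "\<exists>k. arc_side t k \<and> edge \<Sigma> t k = edge \<Sigma> u j \<and> p \<in> region k \<and> (p \<in> open_simplex3 \<longrightarrow> (t, k) = (u, j))"
proof -
  obtain q where q: "q \<in> region j" "chart \<Sigma> t p = chart \<Sigma> u q" using assms(4) by blast
  then have "q \<in> cell u" "u \<in> triangles \<Sigma>" using region_cell assms(3) by (auto simp: arc_side_def)
  from assms(1) this(2) assms(2) this(1) q(2) show ?thesis
  proof (cases rule: chart_eq_cases)
    case 1
    then show ?thesis using assms(3) q by blast
  next
    case (2 k s i)
    have g: "0 < glue t k s" "glue t k s < 1" using 2 by (auto simp: glue_def)
    have "i = j" using q(1) 2 side_point_in_region[OF g, of i] region_disjoint by blast
    moreover have "edge \<Sigma> t k = edge \<Sigma> u i" using arc_side_partner[OF 2(3)] 2(4) by (metis prod.inject)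
    ultimately show ?thesis using 2 side_point_in_region[of s k] by auto
  qed
qed

lemma chart_in_edge_nbhdE:
  assumes "t \<in> triangles \<Sigma>" "p \<in> cell t" "chart \<Sigma> t p \<in> edge_nbhd e"
  obtains k where "arc_side t k" "edge \<Sigma> t k = e" "p \<in> region k"
proof -
  obtain u j where "arc_side u j" "edge \<Sigma> u j = e" "chart \<Sigma> t p \<in> chart \<Sigma> u ` region j"
    using assms(3) by (auto simp: edge_nbhd_def)
  then show ?thesis using chart_in_side_region[OF assms(1,2)] that by blast
qed

lemma openin_edge_nbhd: "openin (top_of_set X) (edge_nbhd e)"
proof (rule openin_X_via_charts[OF edge_nbhd_subset])
  fix t assume t: "t \<in> triangles \<Sigma>"
  have "{p \<in> simplex3. chart \<Sigma> t p \<in> edge_nbhd e} = (\<Union>k\<in>{k. arc_side t k \<and> edge \<Sigma> t k = e}. region k)" (is "?L = ?R")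
  proof
    show "?L \<subseteq> ?R"
    proof
      fix p assume p: "p \<in> ?L"
      then have "p \<in> cell t" using edge_nbhd_subset by (auto simp: cell_def)
      then show "p \<in> ?R" using p chart_in_edge_nbhdE[OF t, of p e] by blast
    qed
  qed (auto simp: chart_in_edge_nbhd region_def)
  then show "openin (top_of_set simplex3) {p \<in> simplex3. chart \<Sigma> t p \<in> edge_nbhd e}"
    using openin_region by auto
qed

lemma openin_chart_image:
  assumes "t \<in> triangles \<Sigma>" "openin (top_of_set simplex3) A" "A \<subseteq> open_simplex3"
  shows "openin (top_of_set X) (chart \<Sigma> t ` A)"
proof (rule openin_X_via_charts)
  show "chart \<Sigma> t ` A \<subseteq> X" using open_in_cell(1)[OF assms(1)] assms(3) by (auto simp: cell_def)
  fix u assume u: "u \<in> triangles \<Sigma>"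
  have "{p \<in> simplex3. chart \<Sigma> u p \<in> chart \<Sigma> t ` A} = (if u = t then A else {})" (is "?L = ?R")
  proof
    show "?L \<subseteq> ?R"
    proof
      fix p assume "p \<in> ?L"
      then obtain q where q: "q \<in> A" "p \<in> simplex3" "chart \<Sigma> u p = chart \<Sigma> t q" by blast
      have qt: "q \<in> cell t" using q assms open_in_cell by blast
      then have "p \<in> cell u" using q by (auto simp: cell_def)
      from assms(1) u qt this q(3)[symmetric] show "p \<in> ?R"
        by (cases rule: chart_eq_cases) (use q assms(3) in auto)
    qed
    show "?R \<subseteq> ?L" using assms(3) by (auto simp: open_simplex3_def)
  qed
  then show "openin (top_of_set simplex3) {p \<in> simplex3. chart \<Sigma> u p \<in> chart \<Sigma> t ` A}"
    using assms(2) by auto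
qed

lemma openin_triangle: "t \<in> triangles \<Sigma> \<Longrightarrow> openin (top_of_set X) t"
  using openin_chart_image[OF _ openin_open_simplex3 order_refl] chart_facts(3) by fastforce

text \<open>A proper convex combination lies on side \<open>k\<close> only if both points do, and it
  then stays strictly inside that side. Convexity makes any two paths in a cell with common ends
  homotopic.\<close>

lemma convex_cell:
  assumes t: "t \<in> triangles \<Sigma>"
  shows "convex (cell t)"
  unfolding convex_def
proof (intro ballI allI impI)
  fix x y :: "real^3" and u v :: real
  assume *: "x \<in> cell t" "y \<in> cell t" "0 \<le> u" "0 \<le> v" "u + v = 1"
  let ?z = "u *\<^sub>R x + v *\<^sub>R y"
  have z: "?z \<in> simplex3" using convexD[OF convex_simplex3, of x y u v] * cell_subset(1) by blast
  show "?z \<in> cell t"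
  proof (cases "u = 0 \<or> v = 0")
    case True
    then show ?thesis using * by auto
  next
    case False
    then have uv: "0 < u" "0 < v" using * by auto
    from z show ?thesis
    proof (cases rule: simplex3_cases)
      case (2 k s)
      have xy: "x \<in> simplex3" "y \<in> simplex3" using * cell_subset(1) by auto
      have "u * x $ k + v * y $ k = 0" using 2(2) by (metis side_point_nth(1) vector_add_component vector_scaleR_component real_scaleR_def)
      moreover have "0 \<le> u * x $ k" "0 \<le> v * y $ k" using uv xy by (auto simp: simplex3_def)
      ultimately have "x $ k = 0" "y $ k = 0" using uv by (auto simp: add_nonneg_eq_0_iff)
      have side: "arc_side t k \<and> 0 < w $ (k + 2) \<and> w $ (k + 2) < 1" if "w \<in> cell t" "w $ k = 0" for w
        using t that(1)
      proof (cases rule: cell_cases)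
        case 1
        then show ?thesis using that(2) by (auto simp: open_simplex3_iff[of _ k])
      next
        case (2 j r)
        then have "k = j" using that(2) index3_cases[of k j] by auto
        then show ?thesis using 2 by auto
      qed
      have s: "s = u * x $ (k + 2) + v * y $ (k + 2)"
        using 2(2) by (metis side_point_nth(3) vector_add_component vector_scaleR_component real_scaleR_def)
      have "0 < s" using s side \<open>x $ k = 0\<close> \<open>y $ k = 0\<close> * uv by (simp add: add_pos_pos)
      moreover have "u * x $ (k + 2) < u * 1" "v * y $ (k + 2) < v * 1"
        using side \<open>x $ k = 0\<close> \<open>y $ k = 0\<close> * uv by (intro mult_strict_left_mono; simp)+
      then have "s < 1" using s * by linarith
      ultimately show ?thesis using side_in_cell side 2 \<open>x $ k = 0\<close> * by metis
    qed (use open_in_cell t in blast)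
  qed
qed

end

section \<open>Homotopies\<close>

text \<open>Homotopies between reparametrisations reduce to paths \<open>f\<close>, \<open>g\<close>
  in the unit interval, which is simply connected. The laws for constant and inverse paths and for
  subdivision are instances.\<close>

lemma homotopic_paths_compose_unit:
  fixes p :: "real \<Rightarrow> 'b::topological_space"
  assumes "path p" "path_image p \<subseteq> S" "path f" "path g" "path_image f \<subseteq> {0..1}" "path_image g \<subseteq> {0..1}"
    and "pathstart f = pathstart g" "pathfinish f = pathfinish g"
  shows "homotopic_paths S (p \<circ> f) (p \<circ> g)"
proof (rule homotopic_paths_continuous_image[of "{0..1}"])
  have "simply_connected {0..1::real}" by (intro convex_imp_simply_connected) auto
  then show "homotopic_paths {0..1} f g"
    using assms unfolding simply_connected_eq_homotopic_paths by metis
qed (use assms in \<open>auto simp: path_def path_image_def\<close>)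

lemma homotopic_paths_rconst:
  fixes p :: "real \<Rightarrow> 'b::topological_space"
  assumes "path p" "path_image p \<subseteq> S"
  shows "homotopic_paths S (p +++ (\<lambda>_. pathfinish p)) p"
proof -
  have "p \<circ> ((\<lambda>x. x) +++ (\<lambda>_. 1)) = p +++ (\<lambda>_. pathfinish p)"
    unfolding path_compose_join by (simp add: o_def pathfinish_def)
  moreover have "path ((\<lambda>x. x) +++ (\<lambda>_. 1::real))"
    by (rule path_join_imp) (auto simp: path_def pathfinish_def pathstart_def intro!: continuous_intros)
  moreover have "path_image ((\<lambda>x. x) +++ (\<lambda>_. 1::real)) \<subseteq> {0..1}"
    by (rule order_trans[OF path_image_join_subset]) (auto simp: path_image_def)
  ultimately show ?thesis
    using homotopic_paths_compose_unit[OF assms, of "(\<lambda>x. x) +++ (\<lambda>_. 1)" "\<lambda>x. x"]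
    by (simp add: o_def path_image_def pathstart_def pathfinish_def joinpaths_def path_def)
qed

lemma homotopic_paths_lconst:
  fixes p :: "real \<Rightarrow> 'b::topological_space"
  assumes "path p" "path_image p \<subseteq> S" "x = pathstart p"
  shows "homotopic_paths S ((\<lambda>_. x) +++ p) p"
proof -
  have "p \<circ> ((\<lambda>_. 0) +++ (\<lambda>x. x)) = (\<lambda>_. x) +++ p"
    unfolding path_compose_join by (simp add: o_def pathstart_def assms(3))
  moreover have "path ((\<lambda>_. 0) +++ (\<lambda>x. x :: real))"
    by (rule path_join_imp) (auto simp: path_def pathfinish_def pathstart_def intro!: continuous_intros)
  moreover have "path_image ((\<lambda>_. 0) +++ (\<lambda>x. x :: real)) \<subseteq> {0..1}"
    by (rule order_trans[OF path_image_join_subset]) (auto simp: path_image_def)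
  ultimately show ?thesis
    using homotopic_paths_compose_unit[OF assms(1,2), of "(\<lambda>_. 0) +++ (\<lambda>x. x)" "\<lambda>x. x"]
    by (simp add: o_def path_image_def pathstart_def pathfinish_def joinpaths_def path_def)
qed

lemma homotopic_paths_rinverse:
  fixes p :: "real \<Rightarrow> 'b::topological_space"
  assumes "path p" "path_image p \<subseteq> S"
  shows "homotopic_paths S (p +++ reversepath p) (\<lambda>_. pathstart p)"
proof -
  have "p \<circ> ((\<lambda>x. x) +++ (\<lambda>x. 1 - x)) = p +++ reversepath p"
    unfolding path_compose_join by (simp add: o_def reversepath_def)
  moreover have "path ((\<lambda>x. x) +++ (\<lambda>x. 1 - x :: real))"
    by (rule path_join_imp) (auto simp: path_def pathfinish_def pathstart_def intro!: continuous_intros)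
  moreover have "path_image ((\<lambda>x. x) +++ (\<lambda>x. 1 - x :: real)) \<subseteq> {0..1}"
    by (rule order_trans[OF path_image_join_subset]) (auto simp: path_image_def)
  ultimately show ?thesis
    using homotopic_paths_compose_unit[OF assms, of "(\<lambda>x. x) +++ (\<lambda>x. 1 - x)" "\<lambda>_. 0"]
    by (simp add: o_def path_image_def pathstart_def pathfinish_def joinpaths_def path_def)
qed

lemma homotopic_join_left:
  "homotopic_paths S p p' \<Longrightarrow> path q \<Longrightarrow> path_image q \<subseteq> S \<Longrightarrow> pathfinish p = pathstart q \<Longrightarrow>
    homotopic_paths S (p +++ q) (p' +++ q)"
  by (intro homotopic_paths_join) (simp_all add: homotopic_paths_refl)

lemma homotopic_join_right:
  "homotopic_paths S q q' \<Longrightarrow> path p \<Longrightarrow> path_image p \<subseteq> S \<Longrightarrow> pathfinish p = pathstart q \<Longrightarrow>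
    homotopic_paths S (p +++ q) (p +++ q')"
  by (intro homotopic_paths_join) (simp_all add: homotopic_paths_refl)

lemma homotopic_loops_conjugate_path:
  fixes p q :: "real \<Rightarrow> 'b::topological_space"
  assumes "path p" "path q" "path_image p \<subseteq> S" "path_image q \<subseteq> S"
    and "pathfinish p = pathstart q" "pathfinish q = pathstart q"
  shows "homotopic_loops S (p +++ (q +++ reversepath p)) q"
proof -
  define l where "l = p +++ (q +++ reversepath p)"
  have l: "path l" "path_image l \<subseteq> S"
    using assms by (auto simp: l_def path_image_join)
  have range: "0 \<le> s / 2 + x * (1 - 3 * s / 4) \<and> s / 2 + x * (1 - 3 * s / 4) \<le> 1" if "s \<in> {0..1}" "x \<in> {0..1}" for s x :: real
  proof -
    have "x * (1 - 3 * s / 4) \<le> 1 * (1 - 3 * s / 4)" using that by (intro mult_right_mono) auto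
    moreover have "0 \<le> x * (1 - 3 * s / 4)" using that by (intro mult_nonneg_nonneg) auto
    moreover define y where "y = x * (1 - 3 * s / 4)"
    ultimately show ?thesis using that unfolding y_def[symmetric] by (auto simp: field_simps)
  qed
  show ?thesis unfolding homotopic_loops l_def[symmetric]
  proof (intro exI conjI ballI)
    \<comment> \<open>The three pieces of \<open>l\<close> occupy [0, 1/2], [1/2, 3/4] and [3/4, 1].
      At time \<open>s\<close> the window from \<open>s / 2\<close> to \<open>1 - s / 4\<close> is
      traversed; it shrinks from the whole interval to the piece \<open>q\<close>, and both of its
      ends are mapped to \<open>p s\<close>.\<close>
    let ?H = "\<lambda>z. l (fst z / 2 + snd z * (1 - 3 * fst z / 4))"
    show "continuous_on ({0..1} \<times> {0..1}) ?H"
      by (rule continuous_on_compose2[OF l(1)[unfolded path_def], of _ "\<lambda>z. fst z / 2 + snd z * (1 - 3 * fst z / 4)"])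
        (use range in \<open>auto intro!: continuous_intros\<close>)
    show "?H \<in> {0..1} \<times> {0..1} \<rightarrow> S"
      using l(2) range by (fastforce simp: path_image_def)
    show "?H (0, x) = l x" if "x \<in> {0..1}" for x by simp
    show "?H (1, x) = q x" if "x \<in> {0..1}" for x
      using that assms(5) by (cases "x = 0") (auto simp: l_def joinpaths_def pathfinish_def pathstart_def field_simps)
    show "pathfinish (?H \<circ> Pair s) = pathstart (?H \<circ> Pair s)" if "s \<in> {0..1}" for s
      using that assms(5) by (cases "s = 1") (auto simp: l_def joinpaths_def pathfinish_def pathstart_def reversepath_def field_simps assms(6)[unfolded pathfinish_def pathstart_def])
  qed
qed

text \<open>The base point moves along the loop: a window of half the total length slides along
  \<open>p\<close> traversed twice.\<close>

lemma homotopic_loops_rotate: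
  fixes p :: "real \<Rightarrow> 'b::topological_space"
  assumes "path p" "path_image p \<subseteq> S" "pathfinish p = pathstart p" "a \<in> {0..1}"
  shows "homotopic_loops S p (\<lambda>x. (p +++ p) ((a + x) / 2))"
  unfolding homotopic_loops
proof (intro exI conjI ballI)
  let ?H = "\<lambda>z. (p +++ p) ((fst z * a + snd z) / 2)"
  have pp: "path (p +++ p)" "path_image (p +++ p) \<subseteq> S" using assms by (auto simp: path_image_join)
  have range: "0 \<le> (s * a + x) / 2 \<and> (s * a + x) / 2 \<le> 1" if "s \<in> {0..1}" "x \<in> {0..1}" for s x
    using that assms(4) mult_le_one[of s a] by auto
  show "continuous_on ({0..1} \<times> {0..1}) ?H"
    by (rule continuous_on_compose2[OF pp(1)[unfolded path_def], of _ "\<lambda>z. (fst z * a + snd z) / 2"])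
      (use range in \<open>auto intro!: continuous_intros\<close>)
  show "?H \<in> {0..1} \<times> {0..1} \<rightarrow> S"
    using pp(2) range by (fastforce simp: path_image_def)
  show "?H (0, x) = p x" if "x \<in> {0..1}" for x using that by (simp add: joinpaths_def)
  show "?H (1, x) = (p +++ p) ((a + x) / 2)" for x by simp
  show "pathfinish (?H \<circ> Pair s) = pathstart (?H \<circ> Pair s)" if s: "s \<in> {0..1}" for s
  proof -
    have "s * a \<in> {0..1}" using s assms(4) mult_le_one[of s a] by auto
    moreover have "(p +++ p) ((c + 1) / 2) = (p +++ p) ((c + 0) / 2)" if "c \<in> {0..1}" for c
    proof (cases "c = 0")
      case False
      then have "\<not> (c + 1) / 2 \<le> 1 / 2" "c / 2 \<le> 1 / 2" "2 * ((c + 1) / 2) - 1 = c" using that by (auto simp: field_simps)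
      then show ?thesis by (simp add: joinpaths_def)
    qed (use assms(3) in \<open>simp add: joinpaths_def pathfinish_def pathstart_def\<close>)
    ultimately show ?thesis by (simp only: pathfinish_def pathstart_def o_def fst_conv snd_conv)
  qed
qed

lemma homotopic_paths_subpath_join:
  fixes g :: "real \<Rightarrow> 'b::topological_space"
  assumes "path g" "path_image g \<subseteq> S" "0 \<le> a" "a \<le> b" "b \<le> c" "c \<le> 1"
  shows "homotopic_paths S ((g \<circ> linepath a b) +++ (g \<circ> linepath b c)) (g \<circ> linepath a c)"
proof -
  have seg: "path_image (linepath u v) \<subseteq> {0..1::real}" if "u \<in> {0..1}" "v \<in> {0..1}" for u v
    using that closed_segment_subset[of u "{0..1}" v] by auto
  show ?thesis unfolding path_compose_join[symmetric]
    by (rule homotopic_paths_compose_unit[OF assms(1,2)])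
      (use assms(3-6) seg in \<open>auto simp: path_image_join\<close>)
qed

lemma homeomorphic_convex_homotopic_paths:
  fixes D :: "'b::real_normed_vector set"
  assumes "homeomorphism D U f g" "convex D"
    and "path p" "path q" "path_image p \<subseteq> U" "path_image q \<subseteq> U" "pathstart p = pathstart q" "pathfinish p = pathfinish q"
  shows "homotopic_paths U p q"
proof -
  have g: "continuous_on U g" "g ` U \<subseteq> D" and f: "continuous_on D f" "f \<in> D \<rightarrow> U" and fg: "\<And>x. x \<in> U \<Longrightarrow> f (g x) = x"
    using assms(1) by (auto simp: homeomorphism_def)
  have "path (g \<circ> r) \<and> path_image (g \<circ> r) \<subseteq> D" if "path r" "path_image r \<subseteq> U" for r
    using that g path_continuous_image continuous_on_subset by (metis (no_types, lifting) image_mono order_trans path_image_compose)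
  then have "homotopic_paths D (g \<circ> p) (g \<circ> q)"
    using convex_imp_simply_connected[OF assms(2)] assms(3-8)
    unfolding simply_connected_eq_homotopic_paths by (simp add: pathstart_compose pathfinish_compose)
  then have h: "homotopic_paths U (f \<circ> (g \<circ> p)) (f \<circ> (g \<circ> q))"
    by (rule homotopic_paths_continuous_image[OF _ f])
  have "homotopic_paths U r (f \<circ> (g \<circ> r))" if "path r" "path_image r \<subseteq> U" for r
    by (rule homotopic_paths_eq[OF that]) (use that(2) fg in \<open>force simp: path_image_def\<close>)
  then show ?thesis
    using h assms(3-6) homotopic_paths_trans homotopic_paths_sym by metis
qed

section \<open>Discs around triangles and arcs\<close>

context triangulated
begin

lemma convex_cell_homotopic_paths:
  assumes "t \<in> triangles \<Sigma>" "path p" "path q" "path_image p \<subseteq> cell t" "path_image q \<subseteq> cell t"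
    and "pathstart p = pathstart q" "pathfinish p = pathfinish q"
  shows "homotopic_paths X (chart \<Sigma> t \<circ> p) (chart \<Sigma> t \<circ> q)"
proof (rule homotopic_paths_continuous_image[of "cell t"])
  show "homotopic_paths (cell t) p q"
    using convex_imp_simply_connected[OF convex_cell[OF assms(1)]] assms(2-)
    unfolding simply_connected_eq_homotopic_paths by simp
  show "continuous_on (cell t) (chart \<Sigma> t)"
    using chart_facts(1)[OF assms(1)] cell_subset(1) continuous_on_subset by blast
qed (auto simp: cell_def)

lemma path_chart_compose:
  assumes "t \<in> triangles \<Sigma>" "path p" "path_image p \<subseteq> cell t"
  shows "path (chart \<Sigma> t \<circ> p)" "path_image (chart \<Sigma> t \<circ> p) \<subseteq> X"
proof -
  show "path (chart \<Sigma> t \<circ> p)"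
    using assms chart_facts(1)[OF assms(1)] cell_subset(1)[of t]
    by (intro path_continuous_image) (auto intro: continuous_on_subset)
  show "path_image (chart \<Sigma> t \<circ> p) \<subseteq> X"
    using assms(3) by (auto simp: path_image_compose cell_def)
qed

lemma triangle_homeomorphism:
  assumes "t \<in> triangles \<Sigma>"
  obtains g where "homeomorphism open_simplex3 t (chart \<Sigma> t) g"
proof (rule homeomorphism_injective_open_map[of open_simplex3 "chart \<Sigma> t" t])
  show "continuous_on open_simplex3 (chart \<Sigma> t)"
    using chart_facts(1)[OF assms] by (rule continuous_on_subset) (auto simp: open_simplex3_def)
  fix U assume U: "openin (top_of_set open_simplex3) U"
  then have "openin (top_of_set X) (chart \<Sigma> t ` U)"
    by (intro openin_chart_image assms openin_trans[OF U openin_open_simplex3] openin_imp_subset)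
  moreover have "chart \<Sigma> t ` U \<subseteq> t"
    using openin_imp_subset[OF U] chart_facts(3)[OF assms] by blast
  ultimately show "openin (top_of_set t) (chart \<Sigma> t ` U)"
    using openin_subset_trans triangle_subset[OF assms] by blast
qed (use chart_facts[OF assms] that in auto)

text \<open>Coordinates on the neighbourhood of an arc: \<open>fst\<close> runs along the arc and \<open>snd\<close> is positive on
  the side of \<open>t\<close> and negative on the other side.\<close>

definition diamond :: "(real \<times> real) set" where
  "diamond = {z. \<bar>fst z\<bar> + 3 * \<bar>snd z\<bar> < 1}"

lemma convex_diamond: "convex diamond"
  unfolding convex_def
proof (intro ballI allI impI)
  fix x y :: "real \<times> real" and u v :: real
  assume *: "x \<in> diamond" "y \<in> diamond" "0 \<le> u" "0 \<le> v" "u + v = 1"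
  let ?n = "\<lambda>z :: real \<times> real. \<bar>fst z\<bar> + 3 * \<bar>snd z\<bar>"
  have "?n (u *\<^sub>R x + v *\<^sub>R y) \<le> u * ?n x + v * ?n y"
    using *(3,4) abs_triangle_ineq[of "u * fst x" "v * fst y"] abs_triangle_ineq[of "u * snd x" "v * snd y"]
    by (simp add: abs_mult algebra_simps)
  also have "\<dots> < 1"
  proof (cases "u = 0")
    case False
    then have "u * ?n x < u * 1" using * by (intro mult_strict_left_mono) (auto simp: diamond_def)
    moreover have "v * ?n y \<le> v * 1" using * by (intro mult_left_mono) (auto simp: diamond_def)
    ultimately show ?thesis using *(5) by linarith
  qed (use * in \<open>auto simp: diamond_def\<close>)
  finally show "u *\<^sub>R x + v *\<^sub>R y \<in> diamond" by (simp add: diamond_def)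
qed

text \<open>Here \<open>v\<close> is the coordinate at side \<open>k\<close> and \<open>u\<close>
  the difference of the other two. That \<open>v\<close> is the smallest coordinate becomes
  \<open>3 * v < 1 - \<bar>u\<bar>\<close>, which explains the factor 3 in
  \<open>diamond\<close>.\<close>

definition diamond_point :: "3 \<Rightarrow> real \<Rightarrow> real \<Rightarrow> real^3" where
  "diamond_point k u v = (\<chi> i. if i = k then v else if i = k + 1 then (1 - v - u) / 2 else (1 - v + u) / 2)"

lemma diamond_point_nth [simp]:
  "diamond_point k u v $ k = v" "diamond_point k u v $ (k + 1) = (1 - v - u) / 2"
  "diamond_point k u v $ (k + 2) = (1 - v + u) / 2"
  by (simp_all add: diamond_point_def)

lemma diamond_point_in_region: "diamond_point k u v \<in> region k \<longleftrightarrow> (u, v) \<in> diamond \<and> 0 \<le> v"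
proof -
  have "diamond_point k u v \<in> region k \<longleftrightarrow> 0 \<le> v \<and> v < (1 - v - u) / 2 \<and> v < (1 - v + u) / 2"
    unfolding region_def simplex3_iff[of _ k] mem_Collect_eq diamond_point_nth by (auto simp: field_simps)
  also have "\<dots> \<longleftrightarrow> \<bar>u\<bar> + 3 * \<bar>v\<bar> < 1 \<and> 0 \<le> v" by (auto simp: field_simps abs_if split: if_splits)
  finally show ?thesis by (simp add: diamond_def)
qed

lemma region_diamond_point:
  assumes "p \<in> region k"
  shows "p = diamond_point k (p $ (k + 2) - p $ (k + 1)) (p $ k)"
  using assms unfolding vec3_eq_iff[of _ _ k] region_def simplex3_iff[of _ k] by (auto; linarith)

lemma diamond_point_0: "diamond_point k u 0 = side_point k ((1 + u) / 2)"
  unfolding vec3_eq_iff[of _ _ k] diamond_point_nth side_point_nth by (auto simp: field_simps)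

lemma continuous_diamond_point [continuous_intros]:
  "continuous_on A f \<Longrightarrow> continuous_on A g \<Longrightarrow> continuous_on A (\<lambda>x. diamond_point k (f x) (g x))"
  unfolding diamond_point_def
proof (intro continuous_on_vec_lambda)
  fix i assume "continuous_on A f" "continuous_on A g"
  then show "continuous_on A (\<lambda>x. if i = k then g x else if i = k + 1 then (1 - g x - f x) / 2 else (1 - g x + f x) / 2)"
    by (cases "i = k"; cases "i = k + 1") (auto intro!: continuous_intros)
qed

text \<open>The two regions along an arc are the upper and lower halves of the diamond, glued on the
  axis. Both may belong to one triangle, so injectivity is argued by sides and not by triangles. The
  result makes paths in the neighbourhood of an arc homotopic as soon as they share their
  ends.\<close>

lemma edge_nbhd_homeomorphism:
  assumes side: "arc_side t k"
  obtains f g where "homeomorphism diamond (edge_nbhd (edge \<Sigma> t k)) f g"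
proof -
  obtain t' k' where pt: "partner \<Sigma> t k = (t', k')" "arc_side t' k'" "(t', k') \<noteq> (t, k)" "edge \<Sigma> t' k' = edge \<Sigma> t k"
    and sides: "\<And>u j. u \<in> triangles \<Sigma> \<Longrightarrow> edge \<Sigma> u j = edge \<Sigma> t k \<Longrightarrow> (u, j) = (t, k) \<or> (u, j) = (t', k')"
    by (rule arc_side_partner[OF side]) blast
  have tri: "t \<in> triangles \<Sigma>" "t' \<in> triangles \<Sigma>" using side pt(2) by (auto simp: arc_side_def)
  \<comment> \<open>The gluing in the coordinate along the arc: a reflection if the two sides run in
    opposite directions, the identity otherwise.\<close>
  define \<sigma> :: real where "\<sigma> = (if coherent \<Sigma> t k then -1 else 1)"
  have \<sigma>: "\<sigma> * \<sigma> = 1" "\<bar>\<sigma> * u\<bar> = \<bar>u\<bar>" for u by (auto simp: \<sigma>_def)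
  define f where "f = (\<lambda>z. if 0 \<le> snd z then chart \<Sigma> t (diamond_point k (fst z) (snd z))
    else chart \<Sigma> t' (diamond_point k' (\<sigma> * fst z) (- snd z)))"
  \<comment> \<open>On the axis both formulas give the same point by \<open>chart_glue\<close>, so
    either may be used there; this gives continuity across the arc.\<close>
  have f0: "f z = chart \<Sigma> t' (diamond_point k' (\<sigma> * fst z) (- snd z))" if "z \<in> diamond" "snd z \<le> 0" for z
  proof (cases "snd z = 0")
    case True
    have "chart \<Sigma> t (side_point k ((1 + fst z) / 2)) = chart \<Sigma> t' (side_point k' (glue t k ((1 + fst z) / 2)))"
      by (rule chart_glue[OF side pt(1)]) (use that True in \<open>auto simp: diamond_def\<close>)
    moreover have "glue t k ((1 + fst z) / 2) = (1 + \<sigma> * fst z) / 2" by (auto simp: glue_def \<sigma>_def field_simps)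
    ultimately show ?thesis using True by (simp add: f_def diamond_point_0)
  qed (use that in \<open>auto simp: f_def\<close>)
  have memP: "diamond_point k (fst z) (snd z) \<in> region k" if "z \<in> diamond" "0 \<le> snd z" for z
    using that by (simp add: diamond_point_in_region)
  have memN: "diamond_point k' (\<sigma> * fst z) (- snd z) \<in> region k'" if "z \<in> diamond" "snd z \<le> 0" for z
    using that \<sigma> by (simp add: diamond_point_in_region diamond_def)
  \<comment> \<open>\<open>A\<close> and \<open>B\<close> are the inverse coordinate maps on the two
    regions. Being continuous, they describe the chart preimages of the image of an open set and
    thereby prove \<open>f\<close> open.\<close>
  define A where "A = (\<lambda>p :: real^3. (p $ (k + 2) - p $ (k + 1), p $ k))"
  define B where "B = (\<lambda>p :: real^3. (\<sigma> * (p $ (k' + 2) - p $ (k' + 1)), - (p $ k')))"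
  have A: "A p \<in> diamond" "f (A p) = chart \<Sigma> t p" if "p \<in> region k" for p
  proof -
    have p: "p = diamond_point k (fst (A p)) (snd (A p))" using region_diamond_point[OF that] by (simp add: A_def)
    moreover have "0 \<le> snd (A p)" using that by (simp add: A_def region_def simplex3_def)
    ultimately show "f (A p) = chart \<Sigma> t p" by (simp add: f_def)
    show "A p \<in> diamond" using that p diamond_point_in_region[of k "fst (A p)" "snd (A p)"] by simp
  qed
  have B: "B p \<in> diamond" "f (B p) = chart \<Sigma> t' p" if "p \<in> region k'" for p
  proof -
    have p: "p = diamond_point k' (\<sigma> * fst (B p)) (- snd (B p))"
      using region_diamond_point[OF that] \<sigma>(1) by (simp add: B_def flip: mult.assoc)
    have s: "snd (B p) \<le> 0" using that by (simp add: B_def region_def simplex3_def)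
    have "(\<sigma> * fst (B p), - snd (B p)) \<in> diamond" using that p diamond_point_in_region by metis
    then show d: "B p \<in> diamond" by (simp add: diamond_def \<sigma>)
    show "f (B p) = chart \<Sigma> t' p" using f0[OF d s] p by simp
  qed
  have cont: "continuous_on C (\<lambda>z. chart \<Sigma> u (h z))"
    if "continuous_on C h" "h ` C \<subseteq> simplex3" "u \<in> triangles \<Sigma>" for C :: "(real \<times> real) set" and h u
    using that chart_facts(1)[OF that(3)] continuous_on_compose2 by blast
  have contf: "continuous_on diamond f"
  proof -
    have 1: "continuous_on {z \<in> diamond. 0 \<le> snd z} f"
    proof (rule continuous_on_eq)
      show "continuous_on {z \<in> diamond. 0 \<le> snd z} (\<lambda>z. chart \<Sigma> t (diamond_point k (fst z) (snd z)))"
        by (rule cont) (use memP tri in \<open>auto simp: region_def intro!: continuous_intros\<close>)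
    qed (auto simp: f_def)
    have 2: "continuous_on {z \<in> diamond. snd z \<le> 0} f"
    proof (rule continuous_on_eq)
      show "continuous_on {z \<in> diamond. snd z \<le> 0} (\<lambda>z. chart \<Sigma> t' (diamond_point k' (\<sigma> * fst z) (- snd z)))"
        by (rule cont) (use memN tri in \<open>auto simp: region_def intro!: continuous_intros\<close>)
    qed (use f0 in auto)
    have "closedin (top_of_set diamond) {z \<in> diamond. 0 \<le> snd z}" "closedin (top_of_set diamond) {z \<in> diamond. snd z \<le> 0}"
      using continuous_closedin_preimage[of diamond snd "{0..}"] continuous_closedin_preimage[of diamond snd "{..0}"]
      by (auto simp: vimage_def Int_def continuous_on_snd)
    moreover have "{z \<in> diamond. 0 \<le> snd z} \<union> {z \<in> diamond. snd z \<le> 0} = diamond" by auto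
    ultimately show ?thesis
      using continuous_on_Un_local[OF _ _ 1 2] by simp
  qed
  have img: "f ` diamond = edge_nbhd (edge \<Sigma> t k)"
  proof
    show "f ` diamond \<subseteq> edge_nbhd (edge \<Sigma> t k)"
    proof safe
      fix a b assume z: "(a, b) \<in> diamond"
      show "f (a, b) \<in> edge_nbhd (edge \<Sigma> t k)"
        using memP[OF z] memN[OF z] chart_in_edge_nbhd[OF side] chart_in_edge_nbhd[OF pt(2)] pt(4)
        by (cases "0 \<le> b") (auto simp: f_def)
    qed
    show "edge_nbhd (edge \<Sigma> t k) \<subseteq> f ` diamond"
    proof
      fix x assume "x \<in> edge_nbhd (edge \<Sigma> t k)"
      then obtain u j p where u: "arc_side u j" "edge \<Sigma> u j = edge \<Sigma> t k" "p \<in> region j" "x = chart \<Sigma> u p"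
        by (auto simp: edge_nbhd_def)
      then have "(u, j) = (t, k) \<or> (u, j) = (t', k')" using sides by (auto simp: arc_side_def)
      then show "x \<in> f ` diamond" using A[of p] B[of p] u by (metis image_eqI prod.inject)
    qed
  qed
  have reg: "(u, j) = (u', j') \<and> p = q"
    if "arc_side u j" "arc_side u' j'" "p \<in> region j" "q \<in> region j'" "chart \<Sigma> u p = chart \<Sigma> u' q"
      "q \<in> open_simplex3 \<or> (u, j) = (u', j')" for u j u' j' p q
  proof -
    have "p \<in> cell u" "q \<in> cell u'" "u \<in> triangles \<Sigma>" "u' \<in> triangles \<Sigma>"
      using that region_cell by (auto simp: arc_side_def)
    from this(3,4,1,2) that(5) show ?thesis
    proof (cases rule: chart_eq_cases)
      case 1
      then show ?thesis using region_disjoint that by blast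
    next
      case (2 i s l)
      have g: "0 < glue u i s" "glue u i s < 1" using 2 by (auto simp: glue_def)
      have "i = j" using region_disjoint[OF _ that(3)] side_point_in_region[of s i] 2 by simp
      have "l = j'" using region_disjoint[OF _ that(4)] side_point_in_region[OF g, of l] 2 by simp
      have "partner \<Sigma> u j \<noteq> (u, j)" using arc_side_partner[OF that(1)] by metis
      then show ?thesis using that(6) 2 \<open>i = j\<close> \<open>l = j'\<close> by auto
    qed
  qed
  have inj: "inj_on f diamond"
  proof -
    have main: "z = w" if "z \<in> diamond" "w \<in> diamond" "f z = f w" "0 \<le> snd z" for z w
    proof (cases "0 \<le> snd w")
      case True
      then have "diamond_point k (fst z) (snd z) = diamond_point k (fst w) (snd w)"
        using reg[OF side side memP[OF that(1,4)] memP[OF that(2) True]] that(3,4) by (simp add: f_def)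
      then have "diamond_point k (fst z) (snd z) $ i = diamond_point k (fst w) (snd w) $ i" for i by simp
      from this[of k] this[of "k + 2"] show ?thesis by (auto simp: prod_eq_iff)
    next
      case False
      have m: "diamond_point k' (\<sigma> * fst w) (- snd w) \<in> region k'" using memN that False by simp
      then have "diamond_point k' (\<sigma> * fst w) (- snd w) \<in> open_simplex3"
        by (cases rule: region_cases) (use False in \<open>auto simp: vec3_eq_iff[of _ _ k']\<close>)
      then show ?thesis
        using reg[OF side pt(2) memP[OF that(1,4)] m] that(3,4) False pt(3) by (simp add: f_def)
    qed
    have main': "z = w" if "z \<in> diamond" "w \<in> diamond" "f z = f w" "snd z < 0" "snd w < 0" for z w
    proof -
      have "diamond_point k' (\<sigma> * fst z) (- snd z) = diamond_point k' (\<sigma> * fst w) (- snd w)"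
        using reg[OF pt(2) pt(2) memN[OF that(1)] memN[OF that(2)]] that(3-5) by (simp add: f_def)
      then have "diamond_point k' (\<sigma> * fst z) (- snd z) $ i = diamond_point k' (\<sigma> * fst w) (- snd w) $ i" for i by simp
      from this[of k'] this[of "k' + 2"] show ?thesis by (auto simp: prod_eq_iff \<sigma>_def split: if_splits)
    qed
    show ?thesis
    proof (rule inj_onI)
      fix z w assume *: "z \<in> diamond" "w \<in> diamond" "f z = f w"
      consider "0 \<le> snd z" | "0 \<le> snd w" | "snd z < 0" "snd w < 0" by linarith
      then show "z = w" using main[OF *] main[OF *(2,1) *(3)[symmetric]] main'[OF *] by cases auto
    qed
  qed
  have opn: "openin (top_of_set (edge_nbhd (edge \<Sigma> t k))) (f ` W)" if W: "openin (top_of_set diamond) W" for W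
  proof -
    have Wd: "W \<subseteq> diamond" using openin_imp_subset[OF W] .
    have sub: "f ` W \<subseteq> edge_nbhd (edge \<Sigma> t k)" using img Wd by blast
    have "openin (top_of_set X) (f ` W)"
    proof (rule openin_X_via_charts)
      show "f ` W \<subseteq> X" using sub edge_nbhd_subset by blast
      fix u assume u: "u \<in> triangles \<Sigma>"
      let ?P = "(if u = t then region k \<inter> A -` W else {}) \<union> (if u = t' then region k' \<inter> B -` W else {})"
      have "openin (top_of_set simplex3) (region k \<inter> A -` W)"
        by (rule openin_trans[OF continuous_openin_preimage[OF _ _ W] openin_region])
          (use A in \<open>auto simp: A_def intro!: continuous_intros\<close>)
      moreover have "openin (top_of_set simplex3) (region k' \<inter> B -` W)"
        by (rule openin_trans[OF continuous_openin_preimage[OF _ _ W] openin_region])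
          (use B in \<open>auto simp: B_def intro!: continuous_intros\<close>)
      ultimately have P: "openin (top_of_set simplex3) ?P" by auto
      have "{p \<in> simplex3. chart \<Sigma> u p \<in> f ` W} = ?P"
      proof
        show "{p \<in> simplex3. chart \<Sigma> u p \<in> f ` W} \<subseteq> ?P"
        proof
          fix p assume p: "p \<in> {p \<in> simplex3. chart \<Sigma> u p \<in> f ` W}"
          then have "p \<in> cell u" "chart \<Sigma> u p \<in> edge_nbhd (edge \<Sigma> t k)"
            using sub edge_nbhd_subset by (auto simp: cell_def)
          then obtain j where j: "arc_side u j" "edge \<Sigma> u j = edge \<Sigma> t k" "p \<in> region j"
            using chart_in_edge_nbhdE[OF u] by blast
          obtain w where w: "w \<in> W" "chart \<Sigma> u p = f w" using p by auto
          have "(u, j) = (t, k) \<or> (u, j) = (t', k')" using sides[OF u j(2)] .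
          then show "p \<in> ?P"
          proof
            assume *: "(u, j) = (t, k)"
            then have "A p = w" using A[of p] w inj j Wd by (auto simp: inj_on_def)
            then show ?thesis using * j w by auto
          next
            assume *: "(u, j) = (t', k')"
            then have "B p = w" using B[of p] w inj j Wd by (auto simp: inj_on_def)
            then show ?thesis using * j w by auto
          qed
        qed
        show "?P \<subseteq> {p \<in> simplex3. chart \<Sigma> u p \<in> f ` W}"
        proof
          fix p assume "p \<in> ?P"
          then consider "u = t" "p \<in> region k" "A p \<in> W" | "u = t'" "p \<in> region k'" "B p \<in> W"
            by (auto split: if_splits)
          then show "p \<in> {p \<in> simplex3. chart \<Sigma> u p \<in> f ` W}"
          proof cases
            case 1
            then have "p \<in> simplex3" "chart \<Sigma> u p = f (A p)" using A(2) by (simp_all add: region_def)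
            then show ?thesis using 1(3) by blast
          next
            case 2
            then have "p \<in> simplex3" "chart \<Sigma> u p = f (B p)" using B(2) by (simp_all add: region_def)
            then show ?thesis using 2(3) by blast
          qed
        qed
      qed
      with P show "openin (top_of_set simplex3) {p \<in> simplex3. chart \<Sigma> u p \<in> f ` W}" by simp
    qed
    then show ?thesis by (rule openin_subset_trans[OF _ sub edge_nbhd_subset])
  qed
  show ?thesis
    using homeomorphism_injective_open_map[OF contf img inj opn] that by blast
qed

end

section \<open>Elementary paths as curves\<close>

lemma position_point_nth:
  "c \<noteq> k \<Longrightarrow> position_point c k $ k = 1/10"
  "position_point (k + 1) k $ (k + 1) = 7/10" "position_point (k + 2) k $ (k + 2) = 7/10"
  "position_point (k + 1) k $ (k + 2) = 2/10" "position_point (k + 2) k $ (k + 1) = 2/10"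
  by (auto simp: position_point_def)

lemma position_point_in_open: "c \<noteq> k \<Longrightarrow> position_point c k \<in> open_simplex3"
  using index3_cases[of c k] by (auto simp: open_simplex3_iff[of _ k] position_point_nth)

lemma position_point_in_region: "c \<noteq> k \<Longrightarrow> position_point c k \<in> region k"
  using index3_cases[of c k] by (auto simp: region_def simplex3_iff[of _ k] position_point_nth)

text \<open>The parameters 1/4 and 3/4 are exchanged by reversal of a side, so the crossing points
  chosen on partner sides fit together in both kinds of gluing.\<close>

lemma crossing_point_eq:
  assumes "c \<noteq> k"
  shows "crossing_point c k = side_point k (if c = k + 1 then 1/4 else 3/4)"
  using index3_cases[of c k] assms by (auto simp: vec3_eq_iff[of _ _ k] crossing_point_def)

lemma path_const [simp]:
  "path (\<lambda>_. x)" "path_image (\<lambda>_. x) = {x}" "pathstart (\<lambda>_. x) = x" "pathfinish (\<lambda>_. x) = x"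
  by (auto simp: path_def path_image_def pathstart_def pathfinish_def)

lemma linepath_in_convex: "convex S \<Longrightarrow> a \<in> S \<Longrightarrow> b \<in> S \<Longrightarrow> path_image (linepath a b) \<subseteq> S"
  by (simp add: closed_segment_subset)

lemma elementary_path_append:
  "elementary_path \<Sigma> p (ss @ ss') \<longleftrightarrow> elementary_path \<Sigma> p ss \<and> elementary_path \<Sigma> (endpoint \<Sigma> p ss) ss'"
proof (induction ss arbitrary: p)
  case Nil
  then show ?case by (cases ss') (auto simp: endpoint_def)
qed (auto simp: endpoint_def)

lemma endpoint_append: "endpoint \<Sigma> p (ss @ ss') = endpoint \<Sigma> (endpoint \<Sigma> p ss) ss'"
  by (simp add: endpoint_def)

lemma endpoint_Cons: "endpoint \<Sigma> p (s # ss) = endpoint \<Sigma> (move \<Sigma> p s) ss"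
  by (simp add: endpoint_def)

context triangulated
begin

definition pos_point :: "'a position \<Rightarrow> 'a" where
  "pos_point = (\<lambda>(t, c, k). chart \<Sigma> t (position_point c k))"

lemma move_Cross_cases:
  assumes "arc_side t k" "c \<noteq> k"
  obtains t' c' k' where "move \<Sigma> (t, c, k) Cross = (t', c', k')" "partner \<Sigma> t k = (t', k')" "arc_side t' k'"
    "c' \<noteq> k'" "c' = (if (c = k + 1) = coherent \<Sigma> t k then k' + 2 else k' + 1)"
    "chart \<Sigma> t (crossing_point c k) = chart \<Sigma> t' (crossing_point c' k')"
proof -
  obtain t' k' where p: "partner \<Sigma> t k = (t', k')" "arc_side t' k'"
    by (rule arc_side_partner[OF assms(1)]) blast
  define c' where "c' = (if (c = k + 1) = coherent \<Sigma> t k then k' + 2 else k' + 1)"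
  have n: "c' \<noteq> k'" by (simp add: c'_def)
  have "chart \<Sigma> t (crossing_point c k) = chart \<Sigma> t' (side_point k' (glue t k (if c = k + 1 then 1/4 else 3/4)))"
    unfolding crossing_point_eq[OF assms(2)] by (rule chart_glue[OF assms(1) p(1)]) auto
  also have "glue t k (if c = k + 1 then 1/4 else 3/4) = (if c' = k' + 1 then 1/4 else 3/4)"
    by (auto simp: glue_def c'_def)
  finally have "chart \<Sigma> t (crossing_point c k) = chart \<Sigma> t' (crossing_point c' k')"
    unfolding crossing_point_eq[OF n] .
  then show ?thesis using that[OF _ p n c'_def] p by (simp add: c'_def)
qed

lemma step_curve_facts:
  assumes "is_position \<Sigma> p" "s = Cross \<longrightarrow> edge \<Sigma> (fst p) (snd (snd p)) \<in> arcs \<Sigma>"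
  shows "path (step_curve \<Sigma> p s)" "path_image (step_curve \<Sigma> p s) \<subseteq> X"
    "pathstart (step_curve \<Sigma> p s) = pos_point p" "pathfinish (step_curve \<Sigma> p s) = pos_point (move \<Sigma> p s)"
    "is_position \<Sigma> (move \<Sigma> p s)"
proof -
  obtain t c k where p: "p = (t, c, k)" by (cases p)
  have t: "t \<in> triangles \<Sigma>" and c: "c \<noteq> k" using assms(1) by (auto simp: p is_position_def)
  have line: "path (chart \<Sigma> u \<circ> linepath a b) \<and> path_image (chart \<Sigma> u \<circ> linepath a b) \<subseteq> X"
    if "u \<in> triangles \<Sigma>" "a \<in> cell u" "b \<in> cell u" for u a b
    using path_chart_compose[OF that(1) path_linepath linepath_in_convex[OF convex_cell[OF that(1)] that(2,3)]] by simp
  have pp: "position_point a b \<in> cell u" if "u \<in> triangles \<Sigma>" "a \<noteq> b" for u a b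
    using open_in_cell(1)[OF that(1) position_point_in_open[OF that(2)]] .
  have "path (step_curve \<Sigma> p s) \<and> path_image (step_curve \<Sigma> p s) \<subseteq> X \<and>
    pathstart (step_curve \<Sigma> p s) = pos_point p \<and> pathfinish (step_curve \<Sigma> p s) = pos_point (move \<Sigma> p s) \<and>
    is_position \<Sigma> (move \<Sigma> p s)"
  proof (cases s)
    case Turn
    then show ?thesis using t c line[OF t pp[OF t] pp[OF t]] third_neq[OF c]
      by (simp add: p pathstart_compose pathfinish_compose pos_point_def is_position_def)
  next
    case Along
    then show ?thesis using t c line[OF t pp[OF t] pp[OF t]] third_neq[OF c]
      by (simp add: p pathstart_compose pathfinish_compose pos_point_def is_position_def)
  next
    case Cross
    then have side: "arc_side t k" using assms(2) t by (simp add: p arc_side_def)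
    obtain t' c' k' where m: "move \<Sigma> (t, c, k) Cross = (t', c', k')" "arc_side t' k'" "c' \<noteq> k'"
      "chart \<Sigma> t (crossing_point c k) = chart \<Sigma> t' (crossing_point c' k')"
      by (rule move_Cross_cases[OF side c]) blast
    have cr: "crossing_point c k \<in> cell t" "crossing_point c' k' \<in> cell t'"
      unfolding crossing_point_eq[OF c] crossing_point_eq[OF m(3)]
      using side_in_cell[OF side] side_in_cell[OF m(2)] by auto
    have t': "t' \<in> triangles \<Sigma>" using m(2) by (simp add: arc_side_def)
    show ?thesis
      using line[OF t pp[OF t c] cr(1)] line[OF t' cr(2) pp[OF t' m(3)]] m t'
      by (simp add: p Cross path_join pathstart_compose pathfinish_compose pos_point_def is_position_def
          subset_path_image_join del: move.simps)
  qed
  then show "path (step_curve \<Sigma> p s)" "path_image (step_curve \<Sigma> p s) \<subseteq> X"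
    "pathstart (step_curve \<Sigma> p s) = pos_point p" "pathfinish (step_curve \<Sigma> p s) = pos_point (move \<Sigma> p s)"
    "is_position \<Sigma> (move \<Sigma> p s)" by auto
qed

lemma path_curve_Nil: "path_curve \<Sigma> p [] = (\<lambda>_. pos_point p)"
  by (cases p) (simp add: pos_point_def)

lemma path_curve_Cons: "path_curve \<Sigma> p (s # ss) = step_curve \<Sigma> p s +++ path_curve \<Sigma> (move \<Sigma> p s) ss"
  by simp

lemma pos_point_in_X: "is_position \<Sigma> p \<Longrightarrow> pos_point p \<in> X"
  using open_in_cell(1) position_point_in_open cell_subset(2)
  by (fastforce simp: is_position_def pos_point_def split: prod.splits)

lemma path_curve_facts:
  assumes "elementary_path \<Sigma> p ss"
  shows "path (path_curve \<Sigma> p ss)" "path_image (path_curve \<Sigma> p ss) \<subseteq> X"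
    "pathstart (path_curve \<Sigma> p ss) = pos_point p" "pathfinish (path_curve \<Sigma> p ss) = pos_point (endpoint \<Sigma> p ss)"
    "is_position \<Sigma> (endpoint \<Sigma> p ss)"
proof -
  have "path (path_curve \<Sigma> p ss) \<and> path_image (path_curve \<Sigma> p ss) \<subseteq> X \<and>
    pathstart (path_curve \<Sigma> p ss) = pos_point p \<and> pathfinish (path_curve \<Sigma> p ss) = pos_point (endpoint \<Sigma> p ss) \<and>
    is_position \<Sigma> (endpoint \<Sigma> p ss)"
    using assms
  proof (induction ss arbitrary: p)
    case Nil
    then show ?case using pos_point_in_X
      unfolding path_curve_Nil by (auto simp: path_def path_image_def pathstart_def pathfinish_def endpoint_def)
  next
    case (Cons s ss)
    have e: "is_position \<Sigma> p" "s = Cross \<longrightarrow> edge \<Sigma> (fst p) (snd (snd p)) \<in> arcs \<Sigma>" "elementary_path \<Sigma> (move \<Sigma> p s) ss"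
      using Cons.prems by auto
    show ?case
      using Cons.IH[OF e(3)] step_curve_facts[OF e(1,2)] unfolding path_curve_Cons endpoint_Cons
      by (simp add: path_join subset_path_image_join)
  qed
  then show "path (path_curve \<Sigma> p ss)" "path_image (path_curve \<Sigma> p ss) \<subseteq> X"
    "pathstart (path_curve \<Sigma> p ss) = pos_point p" "pathfinish (path_curve \<Sigma> p ss) = pos_point (endpoint \<Sigma> p ss)"
    "is_position \<Sigma> (endpoint \<Sigma> p ss)" by auto
qed

text \<open>Only a homotopy, because the curve of a list of steps is nested to the right and ends
  with a constant path.\<close>

lemma path_curve_append:
  assumes "elementary_path \<Sigma> p (ss @ ss')"
  shows "homotopic_paths X (path_curve \<Sigma> p (ss @ ss')) (path_curve \<Sigma> p ss +++ path_curve \<Sigma> (endpoint \<Sigma> p ss) ss')"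
  using assms
proof (induction ss arbitrary: p)
  case Nil
  note f = path_curve_facts[OF Nil[simplified]]
  show ?case
    using homotopic_paths_lconst[OF f(1,2), of "pos_point p"] f(3)
    by (simp add: path_curve_Nil endpoint_def homotopic_paths_sym)
next
  case (Cons s ss)
  let ?q = "move \<Sigma> p s" and ?r = "endpoint \<Sigma> p (s # ss)"
  have e: "is_position \<Sigma> p" "s = Cross \<longrightarrow> edge \<Sigma> (fst p) (snd (snd p)) \<in> arcs \<Sigma>" "elementary_path \<Sigma> ?q (ss @ ss')"
    using Cons.prems by auto
  then have e': "elementary_path \<Sigma> ?q ss" "elementary_path \<Sigma> ?r ss'"
    by (auto simp: elementary_path_append endpoint_Cons)
  note f = step_curve_facts[OF e(1,2)] and g = path_curve_facts[OF e'(1)] and h = path_curve_facts[OF e'(2)]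
  have "homotopic_paths X (step_curve \<Sigma> p s +++ path_curve \<Sigma> ?q (ss @ ss'))
      (step_curve \<Sigma> p s +++ (path_curve \<Sigma> ?q ss +++ path_curve \<Sigma> ?r ss'))"
    by (rule homotopic_paths_join)
      (use Cons.IH[OF e(3)] f g path_curve_facts[OF e(3)] in \<open>auto simp: homotopic_paths_refl endpoint_Cons\<close>)
  also have "homotopic_paths X \<dots> ((step_curve \<Sigma> p s +++ path_curve \<Sigma> ?q ss) +++ path_curve \<Sigma> ?r ss')"
    using f g h by (intro homotopic_paths_assoc) (auto simp: endpoint_Cons)
  finally show ?case by simp
qed

section \<open>Drawing a curve as an elementary path\<close>

abbreviation base_point :: "real^3" where "base_point \<equiv> position_point 0 1"

text \<open>An arbitrary position in each triangle. Sending every end point there makes drawings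
  composable, whatever chart points represent their ends.\<close>

definition base_pos :: "'a set \<Rightarrow> 'a position" where "base_pos t = (t, 0, 1)"

definition crosses :: "step list \<Rightarrow> nat" where "crosses ss = length (filter (\<lambda>s. s = Cross) ss)"

lemma crosses_simps [simp]:
  "crosses [] = 0" "crosses (s # ss) = (if s = Cross then 1 else 0) + crosses ss" "crosses (ss @ ss') = crosses ss + crosses ss'"
  by (auto simp: crosses_def)

abbreviation seg :: "'a set \<Rightarrow> real^3 \<Rightarrow> real^3 \<Rightarrow> real \<Rightarrow> 'a" where
  "seg t p q \<equiv> chart \<Sigma> t \<circ> linepath p q"

text \<open>Up to homotopy and up to the segments joining its end points to the base positions, \<open>g\<close> is an
  elementary path with at most \<open>m\<close> crossings.\<close>

definition drawn :: "'a set \<Rightarrow> real^3 \<Rightarrow> 'a set \<Rightarrow> real^3 \<Rightarrow> (real \<Rightarrow> 'a) \<Rightarrow> nat \<Rightarrow> bool" where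
  "drawn t p u q g m \<longleftrightarrow> (\<exists>ss. elementary_path \<Sigma> (base_pos t) ss \<and> endpoint \<Sigma> (base_pos t) ss = base_pos u \<and>
     crosses ss \<le> m \<and>
     homotopic_paths X (g +++ seg u q base_point) (seg t p base_point +++ path_curve \<Sigma> (base_pos t) ss))"

lemma base_point_in_cell: "t \<in> triangles \<Sigma> \<Longrightarrow> base_point \<in> cell t"
  by (intro open_in_cell position_point_in_open) auto

lemma pos_point_base: "pos_point (base_pos t) = chart \<Sigma> t base_point"
  by (simp add: pos_point_def base_pos_def)

lemma seg_facts:
  assumes "t \<in> triangles \<Sigma>" "p \<in> cell t" "q \<in> cell t"
  shows "path (seg t p q)" "path_image (seg t p q) \<subseteq> X" "pathstart (seg t p q) = chart \<Sigma> t p" "pathfinish (seg t p q) = chart \<Sigma> t q"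
  using path_chart_compose[OF assms(1) path_linepath linepath_in_convex[OF convex_cell[OF assms(1)] assms(2,3)]]
  by (auto simp: pathstart_compose pathfinish_compose)

lemma drawn_homotopic:
  assumes "drawn t p u q g m" "homotopic_paths X g' g" "u \<in> triangles \<Sigma>" "q \<in> cell u" "pathfinish g = chart \<Sigma> u q"
  shows "drawn t p u q g' m"
proof -
  have "homotopic_paths X (g' +++ seg u q base_point) (g +++ seg u q base_point)"
    by (rule homotopic_paths_join)
      (use assms seg_facts[OF assms(3,4) base_point_in_cell[OF assms(3)]] homotopic_paths_imp_pathfinish[OF assms(2)] in \<open>auto simp: homotopic_paths_refl endpoint_Cons\<close>)
  then show ?thesis using assms(1) homotopic_paths_trans unfolding drawn_def by blast
qed

lemma drawn_mono: "drawn t p u q g m \<Longrightarrow> m \<le> n \<Longrightarrow> drawn t p u q g n"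
  unfolding drawn_def by force

text \<open>The segment to the middle base point ends one drawing and starts the other, so the two
  comparison homotopies fit together and the crossings add up.\<close>

lemma drawn_join:
  assumes "drawn t p u q g m" "drawn u q v r h n"
    and tri: "t \<in> triangles \<Sigma>" "u \<in> triangles \<Sigma>" "v \<in> triangles \<Sigma>" "p \<in> cell t" "q \<in> cell u" "r \<in> cell v"
    and g: "path g" "path_image g \<subseteq> X" "pathstart g = chart \<Sigma> t p" "pathfinish g = chart \<Sigma> u q"
    and h: "path h" "path_image h \<subseteq> X" "pathstart h = chart \<Sigma> u q" "pathfinish h = chart \<Sigma> v r"
  shows "drawn t p v r (g +++ h) (m + n)"
proof -
  obtain ss where ss: "elementary_path \<Sigma> (base_pos t) ss" "endpoint \<Sigma> (base_pos t) ss = base_pos u" "crosses ss \<le> m"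
    "homotopic_paths X (g +++ seg u q base_point) (seg t p base_point +++ path_curve \<Sigma> (base_pos t) ss)"
    using assms(1) unfolding drawn_def by blast
  obtain ss' where ss': "elementary_path \<Sigma> (base_pos u) ss'" "endpoint \<Sigma> (base_pos u) ss' = base_pos v" "crosses ss' \<le> n"
    "homotopic_paths X (h +++ seg v r base_point) (seg u q base_point +++ path_curve \<Sigma> (base_pos u) ss')"
    using assms(2) unfolding drawn_def by blast
  note f = path_curve_facts[OF ss(1)] and f' = path_curve_facts[OF ss'(1)]
  note sp = seg_facts[OF tri(1,4) base_point_in_cell[OF tri(1)]] and sq = seg_facts[OF tri(2,5) base_point_in_cell[OF tri(2)]]
    and sr = seg_facts[OF tri(3,6) base_point_in_cell[OF tri(3)]]
  note facts = g h sp sq sr f f' ss(2) ss'(2) pos_point_base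
  have el: "elementary_path \<Sigma> (base_pos t) (ss @ ss')" using ss ss' by (simp add: elementary_path_append)
  have "homotopic_paths X ((g +++ h) +++ seg v r base_point) (g +++ (h +++ seg v r base_point))"
    using facts by (intro homotopic_paths_sym[OF homotopic_paths_assoc]) auto
  also have "homotopic_paths X \<dots> (g +++ (seg u q base_point +++ path_curve \<Sigma> (base_pos u) ss'))"
    by (rule homotopic_paths_join)
      (use facts ss'(4) in \<open>auto simp: homotopic_paths_refl endpoint_Cons\<close>)
  also have "homotopic_paths X \<dots> ((g +++ seg u q base_point) +++ path_curve \<Sigma> (base_pos u) ss')"
    using facts by (intro homotopic_paths_assoc) auto
  also have "homotopic_paths X \<dots> ((seg t p base_point +++ path_curve \<Sigma> (base_pos t) ss) +++ path_curve \<Sigma> (base_pos u) ss')"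
    by (rule homotopic_paths_join)
      (use facts ss(4) in \<open>auto simp: homotopic_paths_refl endpoint_Cons\<close>)
  also have "homotopic_paths X \<dots> (seg t p base_point +++ (path_curve \<Sigma> (base_pos t) ss +++ path_curve \<Sigma> (base_pos u) ss'))"
    using facts by (intro homotopic_paths_sym[OF homotopic_paths_assoc]) auto
  also have "homotopic_paths X \<dots> (seg t p base_point +++ path_curve \<Sigma> (base_pos t) (ss @ ss'))"
    by (rule homotopic_paths_join)
      (use facts homotopic_paths_sym[OF path_curve_append[OF el]] in \<open>auto simp: homotopic_paths_refl endpoint_Cons\<close>)
  finally show ?thesis
    unfolding drawn_def using el ss ss' by (intro exI[of _ "ss @ ss'"]) (auto simp: endpoint_append)
qed

lemma drawn_in_cell:
  assumes t: "t \<in> triangles \<Sigma>" and r: "path r" "path_image r \<subseteq> cell t" "pathstart r = p" "pathfinish r = q"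
  shows "drawn t p t q (chart \<Sigma> t \<circ> r) 0"
  unfolding drawn_def
proof (intro exI[of _ "[]"] conjI)
  have b: "base_point \<in> cell t" using base_point_in_cell[OF t] .
  have pq: "p \<in> cell t" "q \<in> cell t" using r by auto
  have "homotopic_paths X (chart \<Sigma> t \<circ> (r +++ linepath q base_point)) (chart \<Sigma> t \<circ> (linepath p base_point +++ (\<lambda>_. base_point)))"
    by (rule convex_cell_homotopic_paths[OF t])
      (use r b pq linepath_in_convex[OF convex_cell[OF t]] in \<open>simp_all add: subset_path_image_join\<close>)
  then show "homotopic_paths X ((chart \<Sigma> t \<circ> r) +++ seg t q base_point) (seg t p base_point +++ path_curve \<Sigma> (base_pos t) [])"
    unfolding path_compose_join path_curve_Nil pos_point_base by (simp only: o_def[of _ "\<lambda>_. base_point"])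
qed (use t in \<open>auto simp: base_pos_def is_position_def endpoint_def\<close>)

end

lemma linepath_side_point: "linepath (side_point k s) (side_point k r) x = side_point k (linepath s r x)"
  unfolding vec3_eq_iff[of _ _ k] linepath_def vector_add_component vector_scaleR_component side_point_nth
  by (simp add: algebra_simps)

lemma third_numeral: "third 0 1 = 2" "third 0 2 = 1" "third 1 0 = 2" "third 1 2 = 0" "third 2 0 = 1" "third 2 1 = 0"
  by (simp_all add: third_def)

lemma exhaust_012: "(k::3) = 0 \<or> k = 1 \<or> k = 2"
  using index3_cases[of k 0] by simp

context triangulated
begin

text \<open>Alternating \<open>Turn\<close> and \<open>Along\<close> visits the six positions of a
  triangle cyclically. A prefix of the circuit leads from the base position to a given one, the
  remaining suffix leads back.\<close>

lemma inner_steps_base: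
  assumes "c \<noteq> k"
  shows "\<exists>ss. Cross \<notin> set ss \<and> endpoint \<Sigma> (t, 0, 1) ss = (t, c, k)"
    and "\<exists>ss. Cross \<notin> set ss \<and> endpoint \<Sigma> (t, c, k) ss = (t, 0, 1)"
proof -
  let ?w = "[Turn, Along, Turn, Along, Turn, Along]"
  have "(c, k) \<in> {(0,1), (0,2), (1,2), (1,0), (2,0), (2,1)}"
    using exhaust_012[of c] exhaust_012[of k] assms by auto
  then consider "(c, k) = (0,1)" | "(c, k) = (0,2)" | "(c, k) = (1,2)" | "(c, k) = (1,0)" | "(c, k) = (2,0)" | "(c, k) = (2,1)"
    by blast
  note cs = this
  have "endpoint \<Sigma> (t, 0, 1) (take 0 ?w) = (t, 0, 1)" "endpoint \<Sigma> (t, 0, 1) (take 1 ?w) = (t, 0, 2)"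
    "endpoint \<Sigma> (t, 0, 1) (take 2 ?w) = (t, 1, 2)" "endpoint \<Sigma> (t, 0, 1) (take 3 ?w) = (t, 1, 0)"
    "endpoint \<Sigma> (t, 0, 1) (take 4 ?w) = (t, 2, 0)" "endpoint \<Sigma> (t, 0, 1) (take 5 ?w) = (t, 2, 1)"
    by (simp_all add: endpoint_def third_numeral)
  then have "\<exists>n. endpoint \<Sigma> (t, 0, 1) (take n ?w) = (t, c, k)" by (cases rule: cs) (metis prod.inject)+
  moreover have "Cross \<notin> set (take n ?w)" for n by (auto dest: in_set_takeD)
  ultimately show "\<exists>ss. Cross \<notin> set ss \<and> endpoint \<Sigma> (t, 0, 1) ss = (t, c, k)" by blast
  have "endpoint \<Sigma> (t, 0, 1) (drop 6 ?w) = (t, 0, 1)" "endpoint \<Sigma> (t, 0, 2) (drop 1 ?w) = (t, 0, 1)"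
    "endpoint \<Sigma> (t, 1, 2) (drop 2 ?w) = (t, 0, 1)" "endpoint \<Sigma> (t, 1, 0) (drop 3 ?w) = (t, 0, 1)"
    "endpoint \<Sigma> (t, 2, 0) (drop 4 ?w) = (t, 0, 1)" "endpoint \<Sigma> (t, 2, 1) (drop 5 ?w) = (t, 0, 1)"
    by (simp_all add: endpoint_def third_numeral)
  then have "\<exists>n. endpoint \<Sigma> (t, c, k) (drop n ?w) = (t, 0, 1)" by (cases rule: cs) (metis prod.inject)+
  moreover have "Cross \<notin> set (drop n ?w)" for n by (auto dest: in_set_dropD)
  ultimately show "\<exists>ss. Cross \<notin> set ss \<and> endpoint \<Sigma> (t, c, k) ss = (t, 0, 1)" by blast
qed

text \<open>Steps without crossing lift to a path in the convex cell; so up to homotopy their curve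
  depends only on its ends.\<close>

lemma inner_curve:
  assumes "t \<in> triangles \<Sigma>" "c \<noteq> k" "Cross \<notin> set ss" "endpoint \<Sigma> (t, c, k) ss = (t, c', k')"
  shows "elementary_path \<Sigma> (t, c, k) ss \<and> crosses ss = 0 \<and> (\<exists>r. path r \<and> path_image r \<subseteq> cell t \<and>
    pathstart r = position_point c k \<and> pathfinish r = position_point c' k' \<and> path_curve \<Sigma> (t, c, k) ss = chart \<Sigma> t \<circ> r)"
  using assms(2-)
proof (induction ss arbitrary: c k)
  case Nil
  have "position_point c k \<in> cell t" using open_in_cell(1)[OF assms(1) position_point_in_open[OF Nil(1)]] .
  with Nil assms(1) show ?case
    by (auto simp: is_position_def endpoint_def o_def intro!: exI[of _ "\<lambda>_. position_point c k"])
next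
  case (Cons s ss)
  obtain d j where m: "move \<Sigma> (t, c, k) s = (t, d, j)" "d \<noteq> j"
    "step_curve \<Sigma> (t, c, k) s = chart \<Sigma> t \<circ> linepath (position_point c k) (position_point d j)"
    using Cons.prems third_neq[OF Cons.prems(1)] by (cases s) auto
  have "Cross \<notin> set ss" "endpoint \<Sigma> (t, d, j) ss = (t, c', k')"
    using Cons.prems m(1) by (auto simp: endpoint_Cons)
  note IH = Cons.IH[OF m(2) this]
  have e: "elementary_path \<Sigma> (t, d, j) ss" "crosses ss = 0" and "\<exists>r. path r \<and> path_image r \<subseteq> cell t \<and>
    pathstart r = position_point d j \<and> pathfinish r = position_point c' k' \<and> path_curve \<Sigma> (t, d, j) ss = chart \<Sigma> t \<circ> r"
    using IH by blast+
  then obtain r where r: "path r" "path_image r \<subseteq> cell t" "pathstart r = position_point d j"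
    "pathfinish r = position_point c' k'" "path_curve \<Sigma> (t, d, j) ss = chart \<Sigma> t \<circ> r" by blast
  let ?r = "linepath (position_point c k) (position_point d j) +++ r"
  have "path_image (linepath (position_point c k) (position_point d j)) \<subseteq> cell t"
    by (intro linepath_in_convex convex_cell open_in_cell(1) position_point_in_open assms(1) m(2) Cons.prems(1))
  then have "path ?r" "path_image ?r \<subseteq> cell t" "pathstart ?r = position_point c k" "pathfinish ?r = position_point c' k'"
    using r by (simp_all add: subset_path_image_join)
  moreover have "path_curve \<Sigma> (t, c, k) (s # ss) = chart \<Sigma> t \<circ> ?r"
    unfolding path_curve_Cons m(1,3) r(5) path_compose_join ..
  moreover have "elementary_path \<Sigma> (t, c, k) (s # ss) \<and> crosses (s # ss) = 0"
    using Cons.prems m(1) e assms(1) by (auto simp: is_position_def)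
  ultimately show ?case by blast
qed

text \<open>Even a constant path changes its triangle if its point on the arc is finally read in the
  chart of the partner, and this change costs one crossing. The point is slid along the arc to the
  fixed crossing point and back, in order to use \<open>Cross\<close>.\<close>

lemma drawn_glue:
  assumes side: "arc_side t k" and pt: "partner \<Sigma> t k = (t', k')" and s: "0 < s" "s < 1"
  shows "drawn t (side_point k s) t' (side_point k' (glue t k s)) (\<lambda>_. chart \<Sigma> t (side_point k s)) 1"
proof -
  have ck: "k + 1 \<noteq> k" by simp
  obtain c' where m: "move \<Sigma> (t, k + 1, k) Cross = (t', c', k')" "arc_side t' k'" "c' \<noteq> k'"
    "c' = (if coherent \<Sigma> t k then k' + 2 else k' + 1)"
    by (rule move_Cross_cases[OF side ck]) (use pt in auto)
  have tri: "t \<in> triangles \<Sigma>" "t' \<in> triangles \<Sigma>" using side m(2) by (auto simp: arc_side_def)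
  obtain ss1 where ss1: "Cross \<notin> set ss1" "endpoint \<Sigma> (base_pos t) ss1 = (t, k + 1, k)"
    using inner_steps_base(1)[OF ck] unfolding base_pos_def by blast
  obtain ss2 where ss2: "Cross \<notin> set ss2" "endpoint \<Sigma> (t', c', k') ss2 = base_pos t'"
    using inner_steps_base(2)[OF m(3)] unfolding base_pos_def by blast
  obtain r1 where e1: "elementary_path \<Sigma> (base_pos t) ss1" "crosses ss1 = 0"
    and r1: "path r1" "path_image r1 \<subseteq> cell t" "pathstart r1 = base_point" "pathfinish r1 = position_point (k + 1) k"
      "path_curve \<Sigma> (base_pos t) ss1 = chart \<Sigma> t \<circ> r1"
    using inner_curve[OF tri(1) _ ss1(1) ss1(2)[unfolded base_pos_def]] unfolding base_pos_def by auto
  obtain r2 where e2: "elementary_path \<Sigma> (t', c', k') ss2" "crosses ss2 = 0"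
    and r2: "path r2" "path_image r2 \<subseteq> cell t'" "pathstart r2 = position_point c' k'" "pathfinish r2 = base_point"
      "path_curve \<Sigma> (t', c', k') ss2 = chart \<Sigma> t' \<circ> r2"
    using inner_curve[OF tri(2) m(3) ss2(1) ss2(2)[unfolded base_pos_def]] unfolding base_pos_def by auto
  let ?ss = "ss1 @ Cross # ss2"
  have el: "elementary_path \<Sigma> (t, k + 1, k) (Cross # ss2)"
    using e2 m(1) side tri by (auto simp: is_position_def arc_side_def)
  have els: "elementary_path \<Sigma> (base_pos t) ?ss" using e1 el ss1 by (simp add: elementary_path_append)
  have fin: "endpoint \<Sigma> (base_pos t) ?ss = base_pos t'"
    using ss1 ss2 m(1) by (simp add: endpoint_append endpoint_Cons del: move.simps)
  define r :: real where "r = 1/4"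
  have r: "0 < r" "r < 1" by (simp_all add: r_def)
  have g: "0 < glue t k x \<and> glue t k x < 1" if "0 < x" "x < 1" for x using that by (auto simp: glue_def)
  let ?p = "side_point k s" and ?x = "side_point k r" and ?p' = "side_point k' (glue t k s)" and ?x' = "side_point k' (glue t k r)"
  have cr: "crossing_point (k + 1) k = ?x" "crossing_point c' k' = ?x'"
    unfolding crossing_point_eq[OF ck] crossing_point_eq[OF m(3)] r_def by (auto simp: m(4) glue_def)
  let ?pp = "position_point (k + 1) k" and ?pp' = "position_point c' k'"
  have pc: "path_curve \<Sigma> (t, k + 1, k) (Cross # ss2) = (seg t ?pp ?x +++ seg t' ?x' ?pp') +++ (chart \<Sigma> t' \<circ> r2)"
    unfolding path_curve_Cons m(1) r2(5) step_curve.simps(1) cr prod.case ..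
  have inc: "?p \<in> cell t" "?x \<in> cell t" "?p' \<in> cell t'" "?x' \<in> cell t'" "base_point \<in> cell t" "base_point \<in> cell t'"
      "?pp \<in> cell t" "?pp' \<in> cell t'"
    using side_in_cell[OF side] side_in_cell[OF m(2)] s r g base_point_in_cell tri
      open_in_cell(1) position_point_in_open m(3) by auto
  have eqx: "chart \<Sigma> t (side_point k x) = chart \<Sigma> t' (side_point k' (glue t k x))" if "x \<in> {0..1}" for x
    using chart_glue[OF side pt that] .
  have lin: "path_image (linepath a b) \<subseteq> cell t" if "a \<in> cell t" "b \<in> cell t" for a b
    using linepath_in_convex[OF convex_cell[OF tri(1)] that] .
  have lin': "path_image (linepath a b) \<subseteq> cell t'" if "a \<in> cell t'" "b \<in> cell t'" for a b
    using linepath_in_convex[OF convex_cell[OF tri(2)] that] .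
  note S = seg_facts[OF tri(1)] and S' = seg_facts[OF tri(2)]
  note R1 = path_chart_compose[OF tri(1) r1(1,2)] and R2 = path_chart_compose[OF tri(2) r2(1,2)]
  let ?a = "seg t ?p base_point" and ?C1 = "chart \<Sigma> t \<circ> r1" and ?C2 = "chart \<Sigma> t' \<circ> r2"
  let ?l1 = "seg t ?pp ?x" and ?l2 = "seg t' ?x' ?pp'"
  have ends: "pathstart ?a = chart \<Sigma> t ?p" "pathfinish ?a = chart \<Sigma> t base_point" "pathstart ?C1 = chart \<Sigma> t base_point"
    "pathfinish ?C1 = chart \<Sigma> t ?pp" "pathstart ?l1 = chart \<Sigma> t ?pp" "pathfinish ?l1 = chart \<Sigma> t' ?x'"
    "pathstart ?l2 = chart \<Sigma> t' ?x'" "pathfinish ?l2 = chart \<Sigma> t' ?pp'" "pathstart ?C2 = chart \<Sigma> t' ?pp'" "pathfinish ?C2 = chart \<Sigma> t' base_point"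
    using r1 r2 eqx[of r] r by (simp_all add: pathstart_compose pathfinish_compose)
  have paths: "path ?a" "path ?C1" "path ?C2" "path ?l1" "path ?l2"
    "path_image ?a \<subseteq> X" "path_image ?C1 \<subseteq> X" "path_image ?C2 \<subseteq> X" "path_image ?l1 \<subseteq> X" "path_image ?l2 \<subseteq> X"
    using S(1,2)[OF inc(1,5)] R1 R2 S(1,2)[OF inc(7,2)] S'(1,2)[OF inc(4,8)] by auto
  have pj: "path (p +++ q)" "path_image (p +++ q) \<subseteq> X" if "path p" "path q" "path_image p \<subseteq> X" "path_image q \<subseteq> X" "pathfinish p = pathstart q"
    for p q using that by (auto simp: subset_path_image_join)
  have "homotopic_paths X (?a +++ path_curve \<Sigma> (base_pos t) ?ss) (?a +++ (?C1 +++ ((?l1 +++ ?l2) +++ ?C2)))"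
    by (rule homotopic_join_right[OF path_curve_append[OF els, unfolded ss1(2) r1(5) pc]])
      (use paths ends path_curve_facts(3)[OF els] in \<open>simp_all add: pos_point_base\<close>)
  also have "homotopic_paths X \<dots> (?a +++ (?C1 +++ (?l1 +++ (?l2 +++ ?C2))))"
    by (intro homotopic_join_right homotopic_paths_sym[OF homotopic_paths_assoc])
      (use paths ends in \<open>simp_all\<close>)
  also have "homotopic_paths X \<dots> (?a +++ ((?C1 +++ ?l1) +++ (?l2 +++ ?C2)))"
    by (intro homotopic_join_right homotopic_paths_assoc)
      (use paths ends in \<open>simp_all add: subset_path_image_join\<close>)
  also have "homotopic_paths X \<dots> ((?a +++ (?C1 +++ ?l1)) +++ (?l2 +++ ?C2))"
    by (intro homotopic_paths_assoc)
      (use paths ends in \<open>simp_all add: subset_path_image_join\<close>)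
  also have "homotopic_paths X \<dots> (seg t ?p ?x +++ (?l2 +++ ?C2))"
  proof (rule homotopic_join_left)
    show "homotopic_paths X (?a +++ (?C1 +++ ?l1)) (seg t ?p ?x)"
      unfolding path_compose_join[symmetric]
      by (rule convex_cell_homotopic_paths[OF tri(1)]) (use r1 inc lin in \<open>simp_all add: subset_path_image_join\<close>)
  qed (use paths ends in \<open>simp_all add: subset_path_image_join\<close>)
  also have "homotopic_paths X \<dots> (seg t' ?p' ?x' +++ (?l2 +++ ?C2))"
  proof (rule homotopic_join_left)
    \<comment> \<open>The slide along the arc is the same path in both charts, since
      \<open>glue\<close> is affine.\<close>
    show "homotopic_paths X (seg t ?p ?x) (seg t' ?p' ?x')"
    proof (rule homotopic_paths_eq[OF S(1,2)[OF inc(1,2)]])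
      fix x :: real assume x: "x \<in> {0..1}"
      have "linepath s r x \<in> closed_segment s r" using x by (metis linepath_in_path)
      then have sr: "linepath s r x \<in> {0..1}" using s r closed_segment_subset[of s "{0..1}" r] by auto
      have "glue t k (linepath s r x) = linepath (glue t k s) (glue t k r) x"
        by (auto simp: glue_def linepath_def algebra_simps)
      then show "seg t ?p ?x x = seg t' ?p' ?x' x"
        using eqx[OF sr] by (simp add: linepath_side_point)
    qed
  qed (use paths ends S(4)[OF inc(1,2)] eqx[of r] r in \<open>simp_all add: subset_path_image_join\<close>)
  also have "homotopic_paths X \<dots> ((\<lambda>_. chart \<Sigma> t' ?p') +++ seg t' ?p' base_point)"
  proof -
    have "homotopic_paths X (chart \<Sigma> t' \<circ> (linepath ?p' ?x' +++ (linepath ?x' ?pp' +++ r2)))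
        (chart \<Sigma> t' \<circ> ((\<lambda>_. ?p') +++ linepath ?p' base_point))"
      by (rule convex_cell_homotopic_paths[OF tri(2)]) (use r2 inc lin' in \<open>simp_all add: subset_path_image_join\<close>)
    then show ?thesis unfolding path_compose_join by (simp only: o_def[of _ "\<lambda>_. ?p'"])
  qed
  finally have "homotopic_paths X ((\<lambda>_. chart \<Sigma> t ?p) +++ seg t' ?p' base_point) (?a +++ path_curve \<Sigma> (base_pos t) ?ss)"
    using eqx[of s] s by (simp add: homotopic_paths_sym)
  then show ?thesis unfolding drawn_def using els fin e1 e2 by (intro exI[of _ ?ss]) simp
qed

text \<open>In the disc around an arc the path may be replaced by straight pieces: one segment if
  both ends are read from the same side, otherwise two segments meeting at the midpoint of the arc.
  However often the path itself meets the arc, one crossing is enough.\<close>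

lemma drawn_in_edge_nbhd:
  assumes e: "path_image g \<subseteq> edge_nbhd e" "path g"
    and t: "t \<in> triangles \<Sigma>" "p \<in> cell t" "pathstart g = chart \<Sigma> t p"
    and u: "u \<in> triangles \<Sigma>" "q \<in> cell u" "pathfinish g = chart \<Sigma> u q"
  shows "drawn t p u q g 1"
proof -
  have "chart \<Sigma> t p \<in> edge_nbhd e" "chart \<Sigma> u q \<in> edge_nbhd e" using e t u by (metis pathstart_in_path_image pathfinish_in_path_image subsetD)+
  then obtain k j where k: "arc_side t k" "edge \<Sigma> t k = e" "p \<in> region k" and j: "arc_side u j" "edge \<Sigma> u j = e" "q \<in> region j"
    using chart_in_edge_nbhdE[OF t(1,2)] chart_in_edge_nbhdE[OF u(1,2)] by metis
  obtain f h where hom: "homeomorphism diamond (edge_nbhd e) f h"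
    using edge_nbhd_homeomorphism[OF k(1)] k(2) by metis
  have seg: "path (seg v a b) \<and> path_image (seg v a b) \<subseteq> edge_nbhd e" if "arc_side v i" "edge \<Sigma> v i = e" "a \<in> region i" "b \<in> region i" for v i a b
  proof -
    have r: "path_image (linepath a b) \<subseteq> region i" using linepath_in_convex[OF convex_region that(3,4)] .
    then have "path (seg v a b)" using that region_cell[OF that(1)]
      by (intro seg_facts(1)) (auto simp: arc_side_def)
    moreover have "path_image (seg v a b) \<subseteq> edge_nbhd e"
      using r chart_in_edge_nbhd[OF that(1)] that(2) by (auto simp: path_image_compose)
    ultimately show ?thesis ..
  qed
  have hp: "homotopic_paths X g g'" if "path g'" "path_image g' \<subseteq> edge_nbhd e" "pathstart g' = pathstart g" "pathfinish g' = pathfinish g" for g'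
    using homeomorphic_convex_homotopic_paths[OF hom convex_diamond e(2) that(1) e(1) that(2)] that(3,4)
      homotopic_paths_subset[OF _ edge_nbhd_subset] by metis
  obtain t' k' where pt: "partner \<Sigma> t k = (t', k')" "arc_side t' k'" "edge \<Sigma> t' k' = edge \<Sigma> t k" "(u, j) = (t, k) \<or> (u, j) = (t', k')"
    by (rule arc_side_partner[OF k(1)]) (use j k u(1) in auto)
  from pt(4) show ?thesis
  proof
    assume eq: "(u, j) = (t, k)"
    have q: "q \<in> region k" "q \<in> cell t" using j u eq by auto
    have "drawn t p t q (seg t p q) 0"
      by (rule drawn_in_cell[OF t(1)]) (use linepath_in_convex[OF convex_cell[OF t(1)] t(2) q(2)] in auto)
    then have "drawn t p t q g 0"
      by (rule drawn_homotopic) (use hp seg[OF k q(1)] t u q eq in \<open>auto simp: pathstart_compose pathfinish_compose\<close>)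
    then show ?thesis using eq drawn_mono[of t p t q g 0 1] by auto
  next
    assume eq: "(u, j) = (t', k')"
    \<comment> \<open>The midpoint of a side keeps its parameter under either gluing.\<close>
    let ?x = "side_point k (1/2)" and ?x' = "side_point k' (glue t k (1/2))"
    have h: "glue t k (1/2) = 1/2" by (auto simp: glue_def)
    have x: "?x \<in> region k" "?x' \<in> region k'" unfolding h by (auto intro!: side_point_in_region)
    have xc: "?x \<in> cell t" "?x' \<in> cell u" using x region_cell k(1) pt(2) eq by auto
    have xeq: "chart \<Sigma> t ?x = chart \<Sigma> u ?x'" using chart_glue[OF k(1) pt(1), of "1/2"] eq by auto
    have xin: "chart \<Sigma> t ?x \<in> edge_nbhd e" using chart_in_edge_nbhd[OF k(1) x(1)] k(2) by simp
    note s1 = seg[OF k x(1)] and s2 = seg[OF pt(2) _ x(2), of q]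
    have s2: "path (seg u ?x' q)" "path_image (seg u ?x' q) \<subseteq> edge_nbhd e" using s2 pt(3) k(2) j(3) eq by auto
    have 1: "drawn t p t ?x (seg t p ?x) 0"
      by (rule drawn_in_cell[OF t(1)]) (use linepath_in_convex[OF convex_cell[OF t(1)] t(2) xc(1)] in auto)
    have 2: "drawn t ?x u ?x' (\<lambda>_. chart \<Sigma> t ?x) 1"
      using drawn_glue[OF k(1) pt(1)] eq by auto
    have 3: "drawn u ?x' u q (seg u ?x' q) 0"
      by (rule drawn_in_cell[OF u(1)]) (use linepath_in_convex[OF convex_cell[OF u(1)] xc(2) u(2)] in auto)
    have 23: "drawn t ?x u q ((\<lambda>_. chart \<Sigma> t ?x) +++ seg u ?x' q) (1 + 0)"
      by (rule drawn_join[OF 2 3]) (use t u xc xeq seg_facts[OF u(1) xc(2) u(2)] cell_subset in auto)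
    have im: "path_image ((\<lambda>_. chart \<Sigma> t ?x) +++ seg u ?x' q) \<subseteq> X"
      using s2 xin edge_nbhd_subset[of e] by (intro subset_path_image_join) auto
    have 123: "drawn t p u q (seg t p ?x +++ ((\<lambda>_. chart \<Sigma> t ?x) +++ seg u ?x' q)) (0 + (1 + 0))"
      by (rule drawn_join[OF 1 23])
        (use t u xc xeq seg_facts[OF t(1,2) xc(1)] seg_facts[OF u(1) xc(2) u(2)] im in auto)
    have "drawn t p u q g (0 + (1 + 0))"
    proof (rule drawn_homotopic[OF 123 hp])
      show "path_image (seg t p ?x +++ ((\<lambda>_. chart \<Sigma> t ?x) +++ seg u ?x' q)) \<subseteq> edge_nbhd e"
        using s1 s2 xin by (intro subset_path_image_join) auto
    qed (use s1 s2 t u xeq in \<open>auto simp: pathstart_compose pathfinish_compose\<close>)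
    then show ?thesis by simp
  qed
qed

lemma drawn_in_triangle:
  assumes g: "path_image g \<subseteq> v" "path g" "v \<in> triangles \<Sigma>"
    and t: "t \<in> triangles \<Sigma>" "p \<in> cell t" "pathstart g = chart \<Sigma> t p"
    and u: "u \<in> triangles \<Sigma>" "q \<in> cell u" "pathfinish g = chart \<Sigma> u q"
  shows "drawn t p u q g 0"
proof -
  have rep: "t = v \<and> p \<in> open_simplex3" if "t \<in> triangles \<Sigma>" "p \<in> cell t" "chart \<Sigma> t p \<in> v" for t p
    using that(1,2)
  proof (cases rule: cell_cases)
    case 1
    then show ?thesis using open_in_cell(2)[OF that(1)] triangle_disjoint that(1,3) g(3) by blast
  next
    case (2 k s)
    then have "chart \<Sigma> t p \<in> \<Union> (arcs \<Sigma>)" using chart_in_edge[of s t k] by (auto simp: arc_side_def)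
    then show ?thesis using that(3) triangle_subset[OF g(3)] by blast
  qed
  have "chart \<Sigma> t p \<in> v" "chart \<Sigma> u q \<in> v" using g t u by (metis pathstart_in_path_image pathfinish_in_path_image subsetD)+
  then have eq: "t = v" "u = v" "p \<in> open_simplex3" "q \<in> open_simplex3" using rep t u by auto
  obtain h where hom: "homeomorphism open_simplex3 v (chart \<Sigma> v) h" using triangle_homeomorphism[OF g(3)] by blast
  have lin: "path_image (linepath p q) \<subseteq> open_simplex3" using linepath_in_convex[OF convex_open_simplex3 eq(3,4)] .
  then have seg: "path_image (seg v p q) \<subseteq> v" using open_in_cell(2)[OF g(3)] by (auto simp: path_image_compose)
  have "homotopic_paths v g (seg v p q)"
    by (rule homeomorphic_convex_homotopic_paths[OF hom convex_open_simplex3 g(2) _ g(1) seg])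
      (use seg_facts t u eq in \<open>auto simp: pathstart_compose pathfinish_compose\<close>)
  then have "homotopic_paths X g (seg v p q)" using homotopic_paths_subset triangle_subset[OF g(3)] by blast
  moreover have "drawn v p v q (seg v p q) 0"
    by (rule drawn_in_cell[OF g(3)]) (use lin open_in_cell(1)[OF g(3)] in auto)
  ultimately show ?thesis
    using drawn_homotopic[of v p v q "seg v p q" 0 g] seg_facts eq t u by auto
qed

end

lemma path_image_compose_linepath:
  fixes a b :: real
  shows "path_image (g \<circ> linepath a b) = g ` closed_segment a b"
  by (simp add: path_image_compose)

lemma path_compose_linepath:
  assumes "path g" "a \<in> {0..1}" "b \<in> {0..1}"
  shows "path (g \<circ> linepath a b)" "path_image (g \<circ> linepath a b) \<subseteq> path_image g"
proof -
  have seg: "closed_segment a b \<subseteq> {0..1}" using assms closed_segment_subset[of a "{0..1}" b] by auto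
  show "path (g \<circ> linepath a b)"
    by (rule path_continuous_image) (use assms(1) seg in \<open>auto simp: path_def intro: continuous_on_subset\<close>)
  show "path_image (g \<circ> linepath a b) \<subseteq> path_image g"
    unfolding path_image_compose_linepath using seg by (auto simp: path_image_def)
qed

context triangulated
begin

lemma drawn_subpath_join:
  assumes g: "path g" "path_image g \<subseteq> X" and abc: "0 \<le> a" "a \<le> b" "b \<le> c" "c \<le> 1"
    and t: "t \<in> triangles \<Sigma>" "p \<in> cell t" "chart \<Sigma> t p = g a"
    and u: "u \<in> triangles \<Sigma>" "q \<in> cell u" "chart \<Sigma> u q = g b"
    and v: "v \<in> triangles \<Sigma>" "r \<in> cell v" "chart \<Sigma> v r = g c"
    and "drawn t p u q (g \<circ> linepath a b) m" "drawn u q v r (g \<circ> linepath b c) n"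
  shows "drawn t p v r (g \<circ> linepath a c) (m + n)"
proof -
  have p: "path (g \<circ> linepath x y)" "path_image (g \<circ> linepath x y) \<subseteq> X"
    "pathstart (g \<circ> linepath x y) = g x" "pathfinish (g \<circ> linepath x y) = g y" if "x \<in> {a, b, c}" "y \<in> {a, b, c}" for x y
  proof -
    have "x \<in> {0..1}" "y \<in> {0..1}" using that abc by auto
    then show "path (g \<circ> linepath x y)" "path_image (g \<circ> linepath x y) \<subseteq> X"
      using path_compose_linepath[OF g(1)] g(2) by blast+
  qed (simp_all add: pathstart_compose pathfinish_compose)
  have "drawn t p v r ((g \<circ> linepath a b) +++ (g \<circ> linepath b c)) (m + n)"
    by (rule drawn_join[OF assms(16,17)]) (use t u v p in auto)
  then show ?thesis
    by (rule drawn_homotopic)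
      (use homotopic_paths_subpath_join[OF g abc] v p in \<open>auto simp: homotopic_paths_sym\<close>)
qed

lemma path_near_in_open:
  assumes "path g" "path_image g \<subseteq> X" "openin (top_of_set X) U" "x \<in> {0..1}" "g x \<in> U"
  obtains d where "d > 0" "\<And>y. y \<in> {0..1} \<Longrightarrow> \<bar>y - x\<bar> < d \<Longrightarrow> g y \<in> U"
proof -
  obtain W where W: "open W" "U = X \<inter> W" using assms(3) unfolding openin_open by blast
  have "continuous_on {0..1} g" using assms(1) by (simp add: path_def)
  then obtain A where A: "open A" "x \<in> A" "\<And>y. y \<in> {0..1} \<Longrightarrow> y \<in> A \<Longrightarrow> g y \<in> W"
    unfolding continuous_on_topological using assms(4,5) W by (metis IntD2)
  then obtain d where d: "d > 0" "ball x d \<subseteq> A" using open_contains_ball by blast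
  show ?thesis
  proof (rule that[OF d(1)])
    fix y assume y: "y \<in> {0..1}" "\<bar>y - x\<bar> < d"
    then have "y \<in> A" using d(2) by (auto simp: dist_real_def abs_minus_commute)
    then show "g y \<in> U" using A(3) y assms(2) W(2) by (auto simp: path_image_def)
  qed
qed

lemma in_triangle_or_edge_nbhd:
  assumes "x \<in> X"
  obtains t where "t \<in> triangles \<Sigma>" "x \<in> t" | e where "e \<in> arcs \<Sigma>" "x \<in> e" "x \<in> edge_nbhd e"
proof -
  obtain t p where t: "t \<in> triangles \<Sigma>" "p \<in> cell t" "chart \<Sigma> t p = x" using point_in_chart[OF assms] .
  from t(1,2) show ?thesis
  proof (cases rule: cell_cases)
    case 1
    then show ?thesis using that(1) open_in_cell(2) t by blast
  next
    case (2 k s)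
    have "x \<in> edge_nbhd (edge \<Sigma> t k)" using chart_in_edge_nbhd[OF 2(4) side_point_in_region[OF 2(1,2)]] t(3) 2(3) by simp
    moreover have "x \<in> edge \<Sigma> t k" using chart_in_edge[of s t k] 2 t(3) by auto
    ultimately show ?thesis using that(2) 2(4) by (auto simp: arc_side_def)
  qed
qed

text \<open>An arbitrary curve may meet the arcs infinitely often. Bisection into pieces that lie in
  one triangle or one arc neighbourhood still gives a finite drawing; hence the minimum in
  \<open>crossing_number\<close> is taken over a nonempty set.\<close>

lemma drawn_exists:
  assumes g: "path g" "path_image g \<subseteq> X"
    and t: "t \<in> triangles \<Sigma>" "p \<in> cell t" "chart \<Sigma> t p = g 0"
    and u: "u \<in> triangles \<Sigma>" "q \<in> cell u" "chart \<Sigma> u q = g 1"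
  shows "\<exists>m. drawn t p u q g m"
proof -
  let ?P = "\<lambda>a b. 0 \<le> a \<and> b \<le> 1 \<longrightarrow> (\<forall>t p u q. t \<in> triangles \<Sigma> \<and> p \<in> cell t \<and> chart \<Sigma> t p = g a \<and>
    u \<in> triangles \<Sigma> \<and> q \<in> cell u \<and> chart \<Sigma> u q = g b \<longrightarrow> (\<exists>m. drawn t p u q (g \<circ> linepath a b) m))"
  have "?P 0 1"
  proof (rule Bolzano[of 0 1 ?P])
    fix a b c :: real assume P: "?P a b" "?P b c" and le: "a \<le> b" "b \<le> c"
    show "?P a c"
    proof (intro impI allI)
      fix t p v r assume ac: "0 \<le> a \<and> c \<le> 1" and h: "t \<in> triangles \<Sigma> \<and> p \<in> cell t \<and> chart \<Sigma> t p = g a \<and>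
        v \<in> triangles \<Sigma> \<and> r \<in> cell v \<and> chart \<Sigma> v r = g c"
      have "g b \<in> X" using g(2) ac le by (auto simp: path_image_def)
      then obtain u q where u: "u \<in> triangles \<Sigma>" "q \<in> cell u" "chart \<Sigma> u q = g b" by (rule point_in_chart)
      obtain m where m: "drawn t p u q (g \<circ> linepath a b) m" using P(1)[rule_format, of t p u q] ac le h u by auto
      obtain n where n: "drawn u q v r (g \<circ> linepath b c) n" using P(2)[rule_format, of u q v r] ac le h u by auto
      have "drawn t p v r (g \<circ> linepath a c) (m + n)"
        by (rule drawn_subpath_join[OF g _ le _ _ _ _ u _ _ _ m n]) (use ac h in auto)
      then show "\<exists>m. drawn t p v r (g \<circ> linepath a c) m" ..
    qed
  next
    fix x :: real assume x: "0 \<le> x" "x \<le> 1"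
    then have "g x \<in> X" using g(2) by (auto simp: path_image_def)
    have main: "\<exists>d>0. \<forall>a b. a \<le> x \<and> x \<le> b \<and> b - a < d \<longrightarrow> ?P a b"
      if U: "openin (top_of_set X) U" "g x \<in> U" and dr: "\<And>h t p u q. path_image h \<subseteq> U \<Longrightarrow> path h \<Longrightarrow> t \<in> triangles \<Sigma> \<Longrightarrow>
        p \<in> cell t \<Longrightarrow> pathstart h = chart \<Sigma> t p \<Longrightarrow> u \<in> triangles \<Sigma> \<Longrightarrow> q \<in> cell u \<Longrightarrow> pathfinish h = chart \<Sigma> u q \<Longrightarrow>
        \<exists>m. drawn t p u q h m" for U
    proof -
      obtain d where d: "d > 0" "\<And>y. y \<in> {0..1} \<Longrightarrow> \<bar>y - x\<bar> < d \<Longrightarrow> g y \<in> U"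
        by (rule path_near_in_open[OF g U(1) _ U(2)]) (use x in auto)
      have "?P a b" if ab: "a \<le> x" "x \<le> b" "b - a < d" for a b
      proof (intro impI allI)
        fix t p v r assume ac: "0 \<le> a \<and> b \<le> 1" and h: "t \<in> triangles \<Sigma> \<and> p \<in> cell t \<and> chart \<Sigma> t p = g a \<and>
          v \<in> triangles \<Sigma> \<and> r \<in> cell v \<and> chart \<Sigma> v r = g b"
        have "closed_segment a b = {a..b}" using ab by (simp add: closed_segment_eq_real_ivl)
        then have "path_image (g \<circ> linepath a b) \<subseteq> U"
          unfolding path_image_compose_linepath using d(2) ab ac by fastforce
        moreover have "path (g \<circ> linepath a b)" using path_compose_linepath[OF g(1)] ab ac by auto
        ultimately show "\<exists>m. drawn t p v r (g \<circ> linepath a b) m"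
          using h by (intro dr) (auto simp: pathstart_compose pathfinish_compose)
      qed
      then show ?thesis using d(1) by blast
    qed
    from \<open>g x \<in> X\<close> show "\<exists>d>0. \<forall>a b. a \<le> x \<and> x \<le> b \<and> b - a < d \<longrightarrow> ?P a b"
    proof (cases rule: in_triangle_or_edge_nbhd)
      case (1 v)
      then show ?thesis
        by (intro main[OF openin_triangle]) (auto intro: drawn_in_triangle)
    next
      case (2 e)
      then show ?thesis
        by (intro main[OF openin_edge_nbhd]) (auto intro: drawn_in_edge_nbhd)
    qed
  qed auto
  moreover have "g \<circ> linepath 0 1 = g" by (auto simp: linepath_def)
  ultimately show ?thesis using t u by auto
qed

text \<open>Induction on the number of crossing times. A piece without them is connected and stays
  in one triangle; otherwise a short window around one of them lies in the disc of an arc and costs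
  one crossing, and both remaining pieces have fewer crossing times.\<close>

lemma drawn_count:
  assumes g: "path g" "path_image g \<subseteq> X"
  shows "0 \<le> a \<Longrightarrow> a \<le> b \<Longrightarrow> b \<le> 1 \<Longrightarrow> g a \<notin> \<Union> (arcs \<Sigma>) \<Longrightarrow> g b \<notin> \<Union> (arcs \<Sigma>) \<Longrightarrow>
    finite {s \<in> {a..b}. g s \<in> \<Union> (arcs \<Sigma>)} \<Longrightarrow> card {s \<in> {a..b}. g s \<in> \<Union> (arcs \<Sigma>)} = n \<Longrightarrow>
    t \<in> triangles \<Sigma> \<Longrightarrow> p \<in> cell t \<Longrightarrow> chart \<Sigma> t p = g a \<Longrightarrow>
    u \<in> triangles \<Sigma> \<Longrightarrow> q \<in> cell u \<Longrightarrow> chart \<Sigma> u q = g b \<Longrightarrow> drawn t p u q (g \<circ> linepath a b) n"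
proof (induction n arbitrary: a b t p u q rule: less_induct)
  case (less n)
  note prems = less.prems
  let ?F = "\<lambda>a b. {s \<in> {a..b}. g s \<in> \<Union> (arcs \<Sigma>)}"
  have sub: "path (g \<circ> linepath x y)" "path_image (g \<circ> linepath x y) = g ` {x..y}"
    "pathstart (g \<circ> linepath x y) = g x" "pathfinish (g \<circ> linepath x y) = g y" if "a \<le> x" "x \<le> y" "y \<le> b" for x y
  proof -
    show "path (g \<circ> linepath x y)" using path_compose_linepath[OF g(1)] that prems(1-3) by auto
    show "path_image (g \<circ> linepath x y) = g ` {x..y}"
      using that by (simp add: path_image_compose_linepath closed_segment_eq_real_ivl)
  qed (simp_all add: pathstart_compose pathfinish_compose)
  have inX: "g s \<in> X" if "s \<in> {a..b}" for s using that g(2) prems(1-3) by (auto simp: path_image_def)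
  show ?case
  proof (cases "?F a b = {}")
    case True
    have "connected (g ` {a..b})"
      using connected_path_image[OF sub(1)] sub(2) prems(2) by (metis order_refl)
    moreover have "g ` {a..b} \<subseteq> X - \<Union> (arcs \<Sigma>)" using inX True by auto
    moreover have "g ` {a..b} \<noteq> {}" using prems(2) by auto
    ultimately obtain v where v: "v \<in> triangles \<Sigma>" "g ` {a..b} \<subseteq> v"
      unfolding triangles_def by (metis exists_component_superset bot.extremum_uniqueI)
    have "drawn t p u q (g \<circ> linepath a b) 0"
      by (rule drawn_in_triangle[of _ v]) (use sub[of a b] v prems in auto)
    then show ?thesis by (rule drawn_mono) simp
  next
    case False
    then obtain s where s: "s \<in> {a..b}" "g s \<in> \<Union> (arcs \<Sigma>)" by blast
    then have s': "a < s" "s < b" using prems(4,5) by (auto simp: order.strict_iff_order)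
    from inX[OF s(1)] obtain e where e: "e \<in> arcs \<Sigma>" "g s \<in> edge_nbhd e"
    proof (cases rule: in_triangle_or_edge_nbhd)
      case (1 v)
      then show ?thesis using s(2) triangle_subset by blast
    qed (use that in blast)
    obtain d where d: "d > 0" "\<And>y. y \<in> {0..1} \<Longrightarrow> \<bar>y - s\<bar> < d \<Longrightarrow> g y \<in> edge_nbhd e"
      by (rule path_near_in_open[OF g openin_edge_nbhd _ e(2)]) (use s prems in auto)
    have "finite (?F a b - {s})" using prems(6) by auto
    then obtain d' where d': "d' > 0" "\<And>y. y \<in> ?F a b - {s} \<Longrightarrow> d' \<le> \<bar>y - s\<bar>"
      using finite_set_avoid[of "?F a b - {s}" s] by (auto simp: dist_real_def abs_minus_commute)
    \<comment> \<open>Half of this minimum keeps the window inside the arc neighbourhood, strictly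
      between \<open>a\<close> and \<open>b\<close> and away from all other crossing times, so that
      its ends lie off the arcs.\<close>
    define \<mu> where "\<mu> = min (min d d') (min (s - a) (b - s))"
    have "0 < \<mu>" "\<mu> \<le> d" "\<mu> \<le> d'" "\<mu> \<le> s - a" "\<mu> \<le> b - s" using d(1) d'(1) s' by (auto simp: \<mu>_def)
    moreover define \<delta> where "\<delta> = \<mu> / 2"
    ultimately    have \<delta>: "\<delta> > 0" "\<delta> < d" "\<delta> < d'" "a < s - \<delta>" "s + \<delta> < b" by auto
    let ?x = "s - \<delta>" and ?y = "s + \<delta>"
    have nF: "g z \<notin> \<Union> (arcs \<Sigma>)" if "z = ?x \<or> z = ?y" for z
    proof
      assume "g z \<in> \<Union> (arcs \<Sigma>)"
      then have "z \<in> ?F a b - {s}" using that \<delta> by auto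
      then show False using d'(2)[of z] \<delta> that by auto
    qed
    have disj: "?F a ?x \<inter> ?F ?y b = {}" using \<delta>(1) by auto
    have un: "?F a ?x \<union> ?F ?y b \<subseteq> ?F a b - {s}" using \<delta> by auto
    have fin: "finite (?F a ?x)" "finite (?F ?y b)" using finite_subset[OF un] prems(6) by auto
    have sF: "s \<in> ?F a b" using s by blast
    have "card (?F a ?x) + card (?F ?y b) \<le> card (?F a b - {s})"
      using card_mono[OF _ un] prems(6) card_Un_disjoint[OF fin disj] by auto
    also have "\<dots> + 1 = n" using card_Suc_Diff1[OF prems(6) sF] prems(7) by simp
    finally have cn: "card (?F a ?x) + card (?F ?y b) + 1 \<le> n"
      using card_Suc_Diff1[OF prems(6) sF] prems(7) by simp
    obtain v r where v: "v \<in> triangles \<Sigma>" "r \<in> cell v" "chart \<Sigma> v r = g ?x"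
      using point_in_chart[OF inX, of ?x] \<delta> by auto
    obtain w z where w: "w \<in> triangles \<Sigma>" "z \<in> cell w" "chart \<Sigma> w z = g ?y"
      using point_in_chart[OF inX, of ?y] \<delta> by auto
    have 1: "drawn t p v r (g \<circ> linepath a ?x) (card (?F a ?x))"
      by (rule less.IH[OF _ _ _ _ _ _ fin(1) refl]) (use cn prems \<delta> nF v in auto)
    have 3: "drawn w z u q (g \<circ> linepath ?y b) (card (?F ?y b))"
      by (rule less.IH[OF _ _ _ _ _ _ fin(2) refl]) (use cn prems \<delta> nF w in auto)
    have 2: "drawn v r w z (g \<circ> linepath ?x ?y) 1"
    proof (rule drawn_in_edge_nbhd[of _ e])
      show "path_image (g \<circ> linepath ?x ?y) \<subseteq> edge_nbhd e"
        using sub(2)[of ?x ?y] \<delta> d(2) prems(1,3) by (auto simp: abs_if)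
    qed (use sub[of ?x ?y] \<delta> v w in auto)
    have 23: "drawn v r u q (g \<circ> linepath ?x b) (1 + card (?F ?y b))"
      by (rule drawn_subpath_join[OF g _ _ _ _ v w _ _ _ 2 3]) (use prems \<delta> in auto)
    have "drawn t p u q (g \<circ> linepath a b) (card (?F a ?x) + (1 + card (?F ?y b)))"
      by (rule drawn_subpath_join[OF g _ _ _ _ _ _ _ v _ _ _ 1 23]) (use prems \<delta> in auto)
    then show ?thesis by (rule drawn_mono) (use cn in simp)
  qed
qed

text \<open>With equal ends the comparison segments conjugate the elementary path, and conjugation
  does not change the free homotopy class.\<close>

lemma drawn_loop:
  assumes "drawn t p t p g m" and t: "t \<in> triangles \<Sigma>" "p \<in> cell t"
    and g: "path g" "path_image g \<subseteq> X" "pathstart g = chart \<Sigma> t p" "pathfinish g = chart \<Sigma> t p"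
  obtains ss where "elementary_path \<Sigma> (base_pos t) ss" "endpoint \<Sigma> (base_pos t) ss = base_pos t" "crosses ss \<le> m"
    "homotopic_loops X g (path_curve \<Sigma> (base_pos t) ss)"
proof -
  let ?s = "seg t p base_point"
  obtain ss where ss: "elementary_path \<Sigma> (base_pos t) ss" "endpoint \<Sigma> (base_pos t) ss = base_pos t" "crosses ss \<le> m"
    "homotopic_paths X (g +++ ?s) (?s +++ path_curve \<Sigma> (base_pos t) ss)"
    using assms(1) unfolding drawn_def by blast
  let ?C = "path_curve \<Sigma> (base_pos t) ss"
  note C = path_curve_facts[OF ss(1)] and s = seg_facts[OF t base_point_in_cell[OF t(1)]]
  note f = C s g ss(2) pos_point_base
  have "homotopic_paths X (g +++ (\<lambda>_. pathfinish g)) g" by (rule homotopic_paths_rconst[OF g(1,2)])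
  then have "homotopic_paths X g (g +++ (\<lambda>_. pathstart ?s))" using f by (simp add: homotopic_paths_sym)
  also have "homotopic_paths X \<dots> (g +++ (?s +++ reversepath ?s))"
    by (rule homotopic_join_right[OF homotopic_paths_sym[OF homotopic_paths_rinverse]]) (use f in auto)
  also have "homotopic_paths X \<dots> ((g +++ ?s) +++ reversepath ?s)"
    by (rule homotopic_paths_assoc) (use f in auto)
  also have "homotopic_paths X \<dots> ((?s +++ ?C) +++ reversepath ?s)"
    by (rule homotopic_join_left[OF ss(4)]) (use f in auto)
  also have "homotopic_paths X \<dots> (?s +++ (?C +++ reversepath ?s))"
    by (rule homotopic_paths_sym[OF homotopic_paths_assoc]) (use f in auto)
  finally have "homotopic_loops X g (?s +++ (?C +++ reversepath ?s))"
    by (rule homotopic_paths_imp_homotopic_loops) (use f in auto)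
  moreover have "homotopic_loops X (?s +++ (?C +++ reversepath ?s)) ?C"
    by (rule homotopic_loops_conjugate_path) (use f in auto)
  ultimately show ?thesis using that ss homotopic_loops_trans by blast
qed

end

section \<open>Crossing numbers and existence of M-paths\<close>

lemma crossing_times_join:
  assumes "finite {s \<in> {0..1}. f s \<in> E}" "card {s \<in> {0..1}. f s \<in> E} \<le> m"
    and "finite {s \<in> {0..1}. g s \<in> E}" "card {s \<in> {0..1}. g s \<in> E} \<le> n"
  shows "finite {s \<in> {0..1}. (f +++ g) s \<in> E} \<and> card {s \<in> {0..1}. (f +++ g) s \<in> E} \<le> m + n"
proof -
  let ?A = "(\<lambda>s. s / 2) ` {s \<in> {0..1::real}. f s \<in> E}" and ?B = "(\<lambda>s. (s + 1) / 2) ` {s \<in> {0..1::real}. g s \<in> E}"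
  have sub: "{s \<in> {0..1}. (f +++ g) s \<in> E} \<subseteq> ?A \<union> ?B"
  proof
    fix s assume s: "s \<in> {s \<in> {0..1}. (f +++ g) s \<in> E}"
    show "s \<in> ?A \<union> ?B"
    proof (cases "s \<le> 1/2")
      case True
      then have "s = (2 * s) / 2" "2 * s \<in> {s \<in> {0..1}. f s \<in> E}" using s by (auto simp: joinpaths_def)
      then show ?thesis by blast
    next
      case False
      then have "s = ((2 * s - 1) + 1) / 2" "2 * s - 1 \<in> {s \<in> {0..1}. g s \<in> E}" using s by (auto simp: joinpaths_def)
      then show ?thesis by blast
    qed
  qed
  have fin: "finite (?A \<union> ?B)" using assms(1,3) by simp
  have "card (?A \<union> ?B) \<le> card ?A + card ?B" by (rule card_Un_le)
  also have "\<dots> \<le> m + n"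
    using card_image_le[OF assms(1), of "\<lambda>s. s / 2"] card_image_le[OF assms(3), of "\<lambda>s. (s + 1) / 2"] assms(2,4) by linarith
  finally show ?thesis using card_mono[OF fin sub] finite_subset[OF sub fin] by linarith
qed

context triangulated
begin

lemma crossing_times_open:
  assumes "t \<in> triangles \<Sigma>" "\<And>s. s \<in> {0..1} \<Longrightarrow> s \<noteq> a \<Longrightarrow> r s \<in> open_simplex3"
  shows "{s \<in> {0..1::real}. (chart \<Sigma> t \<circ> r) s \<in> \<Union> (arcs \<Sigma>)} \<subseteq> {a}"
proof
  fix s assume s: "s \<in> {s \<in> {0..1}. (chart \<Sigma> t \<circ> r) s \<in> \<Union> (arcs \<Sigma>)}"
  then show "s \<in> {a}"
    using open_in_cell(2)[OF assms(1) assms(2)] triangle_subset[OF assms(1)] by fastforce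
qed

lemma crossing_times_step_curve:
  assumes "is_position \<Sigma> p" "s = Cross \<longrightarrow> edge \<Sigma> (fst p) (snd (snd p)) \<in> arcs \<Sigma>"
  shows "finite {x \<in> {0..1}. step_curve \<Sigma> p s x \<in> \<Union> (arcs \<Sigma>)} \<and>
    card {x \<in> {0..1}. step_curve \<Sigma> p s x \<in> \<Union> (arcs \<Sigma>)} \<le> (if s = Cross then 1 else 0)"
proof -
  obtain t c k where p: "p = (t, c, k)" by (cases p)
  have t: "t \<in> triangles \<Sigma>" and c: "c \<noteq> k" using assms(1) by (auto simp: p is_position_def)
  have inner: "{x \<in> {0..1}. (chart \<Sigma> t \<circ> linepath (position_point c k) (position_point d j)) x \<in> \<Union> (arcs \<Sigma>)} = {}"
    if "d \<noteq> j" for d j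
  proof -
    have "linepath (position_point c k) (position_point d j) x \<in> open_simplex3" if "x \<in> {0..1}" for x
      using linepath_in_convex[OF convex_open_simplex3 position_point_in_open[OF c] position_point_in_open[OF \<open>d \<noteq> j\<close>]] that
      by (auto simp: path_image_def simp del: path_image_linepath)
    then show ?thesis
      using open_in_cell(2)[OF t] triangle_subset[OF t] by fastforce
  qed
  show ?thesis
  proof (cases s)
    case Turn
    show ?thesis unfolding p Turn step_curve.simps inner[OF third_neq(3)[OF c]] by simp
  next
    case Along
    show ?thesis unfolding p Along step_curve.simps inner[OF third_neq(1)[OF c]] by simp
  next
    case Cross
    then have side: "arc_side t k" using assms(2) t by (simp add: p arc_side_def)
    obtain t' c' k' where m: "move \<Sigma> (t, c, k) Cross = (t', c', k')" "arc_side t' k'" "c' \<noteq> k'"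
      by (rule move_Cross_cases[OF side c]) blast
    have t': "t' \<in> triangles \<Sigma>" using m(2) by (simp add: arc_side_def)
    have op: "linepath a b x \<in> open_simplex3" if "a \<in> open_simplex3" "a \<in> region j" "b \<in> region j" "x \<in> {0..1}" "x \<noteq> 1" for a b j x
    proof -
      have "linepath a b x \<in> region j"
        using linepath_in_convex[OF convex_region that(2,3)] that(4) by (auto simp: path_image_def simp del: path_image_linepath)
      moreover have "linepath a b x $ j = (1 - x) * a $ j + x * b $ j" by (simp add: linepath_def)
      then have "linepath a b x $ j > 0"
        using that by (auto simp: open_simplex3_def region_def simplex3_def intro!: add_pos_nonneg)
      ultimately show ?thesis by (cases rule: region_cases) auto
    qed
    have cr: "crossing_point a j \<in> region j" if "a \<noteq> j" for a j
      unfolding crossing_point_eq[OF that] by (intro side_point_in_region) auto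
    have pp: "position_point a j \<in> open_simplex3 \<and> position_point a j \<in> region j" if "a \<noteq> j" for a j
      using position_point_in_open[OF that] position_point_in_region[OF that] by blast
    let ?l1 = "chart \<Sigma> t \<circ> linepath (position_point c k) (crossing_point c k)"
    let ?l2 = "chart \<Sigma> t' \<circ> linepath (crossing_point c' k') (position_point c' k')"
    have 1: "{x \<in> {0..1}. ?l1 x \<in> \<Union> (arcs \<Sigma>)} \<subseteq> {1}"
      by (rule crossing_times_open[OF t]) (use op[of "position_point c k" k] pp[OF c] cr[OF c] in auto)
    have 2: "{x \<in> {0..1}. ?l2 x \<in> \<Union> (arcs \<Sigma>)} \<subseteq> {0}"
    proof (rule crossing_times_open[OF t'])
      fix x :: real assume x: "x \<in> {0..1}" "x \<noteq> 0"
      have "linepath (crossing_point c' k') (position_point c' k') x = linepath (position_point c' k') (crossing_point c' k') (1 - x)"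
        by (simp add: linepath_def add.commute)
      then show "linepath (crossing_point c' k') (position_point c' k') x \<in> open_simplex3"
        using op[of "position_point c' k'" k' "crossing_point c' k'" "1 - x"] pp[OF m(3)] cr[OF m(3)] x by auto
    qed
    have "{x \<in> {0..1}. (?l1 +++ ?l2) x \<in> \<Union> (arcs \<Sigma>)} \<subseteq> {1/2}"
    proof
      fix x assume x: "x \<in> {x \<in> {0..1}. (?l1 +++ ?l2) x \<in> \<Union> (arcs \<Sigma>)}"
      show "x \<in> {1/2}"
      proof (cases "x \<le> 1/2")
        case True
        then have "2 * x \<in> {x \<in> {0..1}. ?l1 x \<in> \<Union> (arcs \<Sigma>)}" using x by (auto simp: joinpaths_def)
        then have "2 * x = 1" using 1 by blast
        then show ?thesis by simp
      next
        case False
        then have "2 * x - 1 \<in> {x \<in> {0..1}. ?l2 x \<in> \<Union> (arcs \<Sigma>)}" using x by (auto simp: joinpaths_def)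
        then have "2 * x - 1 = 0" using 2 by blast
        then show ?thesis by simp
      qed
    qed
    then show ?thesis
      unfolding p Cross step_curve.simps(1) m(1) prod.case
      using finite_subset[of _ "{1/2::real}"] card_mono[of "{1/2::real}"] by (simp del: o_apply)
  qed
qed

text \<open>Makes the curve of an elementary path a competitor in \<open>crossing_number\<close>: it
  can meet the arcs only in the middle of its \<open>Cross\<close> steps.\<close>

lemma crossing_times_path_curve:
  "elementary_path \<Sigma> p ss \<Longrightarrow> finite {x \<in> {0..1}. path_curve \<Sigma> p ss x \<in> \<Union> (arcs \<Sigma>)} \<and>
    card {x \<in> {0..1}. path_curve \<Sigma> p ss x \<in> \<Union> (arcs \<Sigma>)} \<le> crosses ss"
proof (induction ss arbitrary: p)
  case Nil
  obtain t c k where p: "p = (t, c, k)" by (cases p)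
  then have "t \<in> triangles \<Sigma>" "c \<noteq> k" using Nil by (auto simp: is_position_def)
  then have "pos_point p \<notin> \<Union> (arcs \<Sigma>)"
    using open_in_cell(2) position_point_in_open triangle_subset by (fastforce simp: p pos_point_def)
  then have "{x \<in> {0..1}. path_curve \<Sigma> p [] x \<in> \<Union> (arcs \<Sigma>)} = {}" unfolding path_curve_Nil by blast
  then show ?case by (metis card.empty finite.emptyI le0)
next
  case (Cons s ss)
  have e: "is_position \<Sigma> p" "s = Cross \<longrightarrow> edge \<Sigma> (fst p) (snd (snd p)) \<in> arcs \<Sigma>" "elementary_path \<Sigma> (move \<Sigma> p s) ss"
    using Cons.prems by auto
  show ?case unfolding path_curve_Cons crosses_simps
    using crossing_times_join crossing_times_step_curve[OF e(1,2)] Cons.IH[OF e(3)] by blast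
qed

text \<open>A curve with the minimal number of crossings is rotated to start off the arcs and drawn
  with at most as many crossings. The drawing is itself a competitor, so it cannot have fewer, and
  the count demanded of an M-path is exact.\<close>

theorem M_path_exists:
  assumes b: "path \<beta>" "path_image \<beta> \<subseteq> X" "pathfinish \<beta> = pathstart \<beta>"
  obtains p ss where "M_path \<Sigma> \<beta> p ss"
proof -
  let ?C = "\<lambda>\<gamma>. {s \<in> {0..<1}. \<gamma> s \<in> \<Union> (arcs \<Sigma>)}"
  define N where "N = (\<lambda>n. \<exists>\<gamma>. homotopic_loops X \<beta> \<gamma> \<and> finite (?C \<gamma>) \<and> card (?C \<gamma>) = n)"
  have cn: "crossing_number \<Sigma> \<beta> = (LEAST n. N n)" by (simp add: crossing_number_def N_def)
  have upper: "\<exists>n\<le>crosses ss. N n" if "elementary_path \<Sigma> p ss" "homotopic_loops X \<beta> (path_curve \<Sigma> p ss)" for p ss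
  proof -
    let ?D = "{x \<in> {0..1}. path_curve \<Sigma> p ss x \<in> \<Union> (arcs \<Sigma>)}"
    have sub: "?C (path_curve \<Sigma> p ss) \<subseteq> ?D" by auto
    have D: "finite ?D" "card ?D \<le> crosses ss" using crossing_times_path_curve[OF that(1)] by auto
    have "finite (?C (path_curve \<Sigma> p ss))" using finite_subset[OF sub D(1)] .
    moreover have "card (?C (path_curve \<Sigma> p ss)) \<le> crosses ss" using card_mono[OF D(1) sub] D(2) by linarith
    ultimately show ?thesis unfolding N_def using that(2) by blast
  qed
  have draw: "\<exists>p ss. elementary_path \<Sigma> p ss \<and> endpoint \<Sigma> p ss = p \<and> crosses ss \<le> m \<and> homotopic_loops X \<gamma> (path_curve \<Sigma> p ss)"
    if "path \<gamma>" "path_image \<gamma> \<subseteq> X" "pathfinish \<gamma> = pathstart \<gamma>"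
      "\<And>t p. t \<in> triangles \<Sigma> \<Longrightarrow> p \<in> cell t \<Longrightarrow> chart \<Sigma> t p = pathstart \<gamma> \<Longrightarrow> drawn t p t p \<gamma> m" for \<gamma> m
  proof -
    have "pathstart \<gamma> \<in> X" using that(2) pathstart_in_path_image by blast
    then obtain t p where t: "t \<in> triangles \<Sigma>" "p \<in> cell t" "chart \<Sigma> t p = pathstart \<gamma>" by (rule point_in_chart)
    show ?thesis
      using drawn_loop[OF that(4)[OF t] t(1,2) that(1,2) t(3)[symmetric]] that(3) t(3) by metis
  qed
  have "pathstart \<beta> \<in> X" using b(2) pathstart_in_path_image by blast
  then obtain t p where t: "t \<in> triangles \<Sigma>" "p \<in> cell t" "chart \<Sigma> t p = pathstart \<beta>" by (rule point_in_chart)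
  obtain m where m: "drawn t p t p \<beta> m"
    using drawn_exists[OF b(1,2) t(1,2) _ t(1,2)] t(3) b(3) by (auto simp: pathstart_def pathfinish_def)
  obtain ss where "elementary_path \<Sigma> (base_pos t) ss" "homotopic_loops X \<beta> (path_curve \<Sigma> (base_pos t) ss)"
    using drawn_loop[OF m t(1,2) b(1,2) t(3)[symmetric]] b(3) t(3) by metis
  then have "\<exists>n. N n" using upper by blast
  then have "N (crossing_number \<Sigma> \<beta>)" unfolding cn by (auto intro: LeastI)
  then obtain \<gamma> where \<gamma>: "homotopic_loops X \<beta> \<gamma>" "finite (?C \<gamma>)" "card (?C \<gamma>) = crossing_number \<Sigma> \<beta>"
    unfolding N_def by blast
  have g: "path \<gamma>" "path_image \<gamma> \<subseteq> X" "pathfinish \<gamma> = pathstart \<gamma>"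
    using \<gamma>(1) homotopic_loops_imp_path homotopic_loops_imp_subset homotopic_loops_imp_loop by blast+
  \<comment> \<open>The minimal curve may start on an arc, whereas \<open>drawn_count\<close> needs
    ends off the arcs; only finitely many parameters are excluded.\<close>
  have "infinite {0..<1::real}" by (simp add: infinite_Ico)
  then have "\<not> {0..<1} \<subseteq> ?C \<gamma>" using finite_subset[OF _ \<gamma>(2)] by blast
  then obtain a where a: "a \<in> {0..<1}" "\<gamma> a \<notin> \<Union> (arcs \<Sigma>)" by blast
  define \<delta> where "\<delta> = (\<lambda>x. (\<gamma> +++ \<gamma>) ((a + x) / 2))"
  have \<delta>eq: "\<delta> x = (if a + x \<le> 1 then \<gamma> (a + x) else \<gamma> (a + x - 1))" if "x \<in> {0..1}" for x
  proof -
    have *: "2 * ((a + x) / 2) = a + x" by simp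
    show ?thesis unfolding \<delta>_def joinpaths_def * by simp
  qed
  have hom: "homotopic_loops X \<gamma> \<delta>" unfolding \<delta>_def by (rule homotopic_loops_rotate[OF g]) (use a in auto)
  have d: "path \<delta>" "path_image \<delta> \<subseteq> X" "pathfinish \<delta> = pathstart \<delta>"
    using hom homotopic_loops_imp_path homotopic_loops_imp_subset homotopic_loops_imp_loop by blast+
  have g01: "\<gamma> 1 = \<gamma> 0" using g(3) by (simp add: pathstart_def pathfinish_def)
  have d0: "\<delta> 0 \<notin> \<Union> (arcs \<Sigma>)" "\<delta> 1 \<notin> \<Union> (arcs \<Sigma>)" using \<delta>eq[of 0] \<delta>eq[of 1] a g01 by (auto split: if_splits)
  let ?D = "{s \<in> {0..1}. \<delta> s \<in> \<Union> (arcs \<Sigma>)}"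
  \<comment> \<open>Rotation of the parameter modulo 1. The parameter 1, at which injectivity could
    fail, is not a crossing time; hence the rotated curve has no more crossings than
    \<gamma>.\<close>
  define \<phi> where "\<phi> = (\<lambda>x. if a + x < 1 then a + x else a + x - 1)"
  have im: "\<phi> ` ?D \<subseteq> ?C \<gamma>"
  proof
    fix y assume "y \<in> \<phi> ` ?D"
    then obtain x where x: "x \<in> {0..1}" "\<delta> x \<in> \<Union> (arcs \<Sigma>)" "y = \<phi> x" by blast
    then have "x < 1" using d0 by (cases "x = 1") auto
    have "\<gamma> (\<phi> x) = \<delta> x" using \<delta>eq[OF x(1)] g01 by (cases "a + x = 1") (auto simp: \<phi>_def)
    moreover have "\<phi> x \<in> {0..<1}" using a x(1) \<open>x < 1\<close> by (auto simp: \<phi>_def)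
    ultimately show "y \<in> ?C \<gamma>" using x by auto
  qed
  have inj: "inj_on \<phi> ?D"
  proof (rule inj_onI)
    fix x y assume *: "x \<in> ?D" "y \<in> ?D" "\<phi> x = \<phi> y"
    then have "x \<noteq> 1" "y \<noteq> 1" using d0 by auto
    with * show "x = y" by (auto simp: \<phi>_def split: if_splits)
  qed
  have fD: "finite ?D" using inj_on_finite[OF inj im \<gamma>(2)] .
  have cD: "card ?D \<le> crossing_number \<Sigma> \<beta>" using card_inj_on_le[OF inj im \<gamma>(2)] \<gamma>(3) by simp
  have "\<exists>p ss. elementary_path \<Sigma> p ss \<and> endpoint \<Sigma> p ss = p \<and> crosses ss \<le> card ?D \<and> homotopic_loops X \<delta> (path_curve \<Sigma> p ss)"
  proof (rule draw[OF d])
    fix t p assume t: "t \<in> triangles \<Sigma>" "p \<in> cell t" "chart \<Sigma> t p = pathstart \<delta>"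
    have "drawn t p t p (\<delta> \<circ> linepath 0 1) (card ?D)"
      by (rule drawn_count[OF d(1,2) _ _ _ d0 fD refl t(1,2) _ t(1,2)])
        (use t(3) d(3) in \<open>auto simp: pathstart_def pathfinish_def\<close>)
    moreover have "\<delta> \<circ> linepath 0 1 = \<delta>" by (auto simp: linepath_def)
    ultimately show "drawn t p t p \<delta> (card ?D)" by simp
  qed
  then obtain p ss where ss: "elementary_path \<Sigma> p ss" "endpoint \<Sigma> p ss = p" "crosses ss \<le> card ?D"
    "homotopic_loops X \<delta> (path_curve \<Sigma> p ss)" by blast
  have h: "homotopic_loops X \<beta> (path_curve \<Sigma> p ss)"
    using homotopic_loops_trans[OF homotopic_loops_trans[OF \<gamma>(1) hom] ss(4)] .
  obtain n where "n \<le> crosses ss" "N n" using upper[OF ss(1) h] by blast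
  then have "crossing_number \<Sigma> \<beta> \<le> crosses ss" unfolding cn using Least_le[of N n] by linarith
  then have "crosses ss = crossing_number \<Sigma> \<beta>" using ss(3) cD by linarith
  then show ?thesis using that[of p ss] ss(1,2) h by (simp add: M_path_def crosses_def)
qed

end

section \<open>Local systems given by gluing maps\<close>

context triangulated
begin

text \<open>Fixes a transverse direction for each arc: a gluing map is applied when crossing from
  the chosen side, and its inverse in the other direction.\<close>

definition chosen_side :: "'a set \<Rightarrow> 'a set \<times> 3" where
  "chosen_side e = (SOME (t, k). arc_side t k \<and> edge \<Sigma> t k = e)"

lemma chosen_side:
  assumes "e \<in> arcs \<Sigma>" "chosen_side e = (t, k)"
  shows "arc_side t k" "edge \<Sigma> t k = e"
proof -
  have "card {(t, k). t \<in> triangles \<Sigma> \<and> edge \<Sigma> t k = e} = 2"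
    using triangle_charts assms by (auto simp: triangle_charts_def)
  then have "{(t, k). t \<in> triangles \<Sigma> \<and> edge \<Sigma> t k = e} \<noteq> {}" by (metis card.empty zero_neq_numeral)
  then have "\<exists>z. case z of (t, k) \<Rightarrow> arc_side t k \<and> edge \<Sigma> t k = e" using assms(1) by (auto simp: arc_side_def)
  from someI_ex[OF this] show "arc_side t k" "edge \<Sigma> t k = e"
    using assms(2) unfolding chosen_side_def by auto
qed

text \<open>The arc itself belongs to the front, so membership jumps just behind the arc; inside
  open triangles it is locally constant.\<close>

definition front :: "'a set \<Rightarrow> 'a set" where
  "front e = (case chosen_side e of (t, k) \<Rightarrow> chart \<Sigma> t ` region k)"

lemma front_iff:
  assumes "arc_side t k" "p \<in> region k" "p \<in> open_simplex3"
  shows "chart \<Sigma> t p \<in> front (edge \<Sigma> t k) \<longleftrightarrow> chosen_side (edge \<Sigma> t k) = (t, k)"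
proof
  obtain u j where uj: "chosen_side (edge \<Sigma> t k) = (u, j)" by (cases "chosen_side (edge \<Sigma> t k)")
  have side: "arc_side u j" using chosen_side[OF _ uj] assms(1) by (auto simp: arc_side_def)
  assume "chart \<Sigma> t p \<in> front (edge \<Sigma> t k)"
  then have "chart \<Sigma> t p \<in> chart \<Sigma> u ` region j" by (simp add: front_def uj)
  moreover have "t \<in> triangles \<Sigma>" "p \<in> cell t" using assms region_cell by (auto simp: arc_side_def)
  ultimately obtain l where "p \<in> region l" "(t, l) = (u, j)"
    using chart_in_side_region[OF _ _ side] assms(3) by blast
  then show "chosen_side (edge \<Sigma> t k) = (t, k)" using region_disjoint[OF assms(2)] uj by auto
qed (use assms in \<open>auto simp: front_def\<close>)

lemma front_locally_constant:
  assumes "t \<in> triangles \<Sigma>" "x \<in> t" "x \<in> edge_nbhd e"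
  shows "\<forall>\<^sub>F y in at x within X. y \<in> front e \<longleftrightarrow> x \<in> front e"
proof -
  obtain p where p: "p \<in> open_simplex3" "x = chart \<Sigma> t p" using chart_facts(3)[OF assms(1)] assms(2) by blast
  obtain k where k: "arc_side t k" "edge \<Sigma> t k = e" "p \<in> region k"
    using chart_in_edge_nbhdE[OF assms(1) open_in_cell(1)[OF assms(1) p(1)]] assms(3) p(2) by blast
  have "openin (top_of_set X) (chart \<Sigma> t ` (region k \<inter> open_simplex3))"
    by (intro openin_chart_image assms(1) openin_Int openin_region openin_open_simplex3) auto
  then obtain W where W: "open W" "chart \<Sigma> t ` (region k \<inter> open_simplex3) = X \<inter> W" unfolding openin_open by blast
  have "y \<in> front e \<longleftrightarrow> x \<in> front e" if y: "y \<in> W" "y \<in> X" for y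
  proof -
    obtain q where q: "q \<in> region k" "q \<in> open_simplex3" "y = chart \<Sigma> t q" using y W(2) by blast
    show ?thesis using front_iff[OF k(1) q(1,2)] front_iff[OF k(1,3) p(1)] k(2) p(2) q(3) by simp
  qed
  moreover have "x \<in> W" using W(2) p k(3) by blast
  ultimately show ?thesis unfolding eventually_at_topological using W(1) by blast
qed

lemma edge_nbhd_disjoint:
  assumes "x \<in> edge_nbhd e" "x \<in> edge_nbhd e'"
  shows "e = e'"
proof -
  have "x \<in> X" using assms(1) edge_nbhd_subset by blast
  then obtain t p where t: "t \<in> triangles \<Sigma>" "p \<in> cell t" "chart \<Sigma> t p = x" by (rule point_in_chart)
  obtain k where "edge \<Sigma> t k = e" "p \<in> region k" using chart_in_edge_nbhdE[OF t(1,2)] assms(1) t(3) by blast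
  moreover obtain j where "edge \<Sigma> t j = e'" "p \<in> region j" using chart_in_edge_nbhdE[OF t(1,2)] assms(2) t(3) by blast
  ultimately show ?thesis using region_disjoint by blast
qed

definition patches :: "('a set + 'a set) set" where
  "patches = Inl ` triangles \<Sigma> \<union> Inr ` arcs \<Sigma>"

fun patch :: "'a set + 'a set \<Rightarrow> 'a set" where
  "patch (Inl t) = t" | "patch (Inr e) = edge_nbhd e"

text \<open>In an arc patch the coordinate is \<open>G e v\<close> on the front and \<open>v\<close>
  behind. Constancy of the coordinate thus means that a flat value changes by \<open>G e\<close>
  when it leaves the front; in a triangle patch it does not change.\<close>

fun glue_map :: "('a set \<Rightarrow> 'f \<Rightarrow> 'f) \<Rightarrow> 'a set + 'a set \<Rightarrow> 'a \<Rightarrow> 'f \<Rightarrow> 'f" where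
  "glue_map G (Inl t) x v = v"
| "glue_map G (Inr e) x v = (if x \<in> front e then G e v else v)"

text \<open>The maps \<open>G e\<close> are independent of each other: arcs are disjoint in
  \<open>X\<close>, and two distinct patches overlap only if one is a triangle and the other an arc
  neighbourhood, where membership in the front is locally constant.\<close>

lemma local_system_glue_map:
  assumes bij: "\<And>e. e \<in> arcs \<Sigma> \<Longrightarrow> bij (G e)"
  shows "local_system X patches patch (glue_map G)"
proof
  show "openin (top_of_set X) (patch i)" if "i \<in> patches" for i
    using that openin_triangle openin_edge_nbhd by (auto simp: patches_def)
  show "\<exists>i\<in>patches. x \<in> patch i" if "x \<in> X" for x
    using that by (cases rule: in_triangle_or_edge_nbhd) (force simp: patches_def)+
  have id: "glue_map G (Inl t) x = id" for t x by auto
  have gl: "glue_map G (Inr e) x = (if x \<in> front e then G e else id)" for e x by auto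
  show "bij (glue_map G i x)" if "i \<in> patches" for i x
    using that bij by (auto simp: patches_def id gl)
  fix i j x assume i: "i \<in> patches" "x \<in> patch i" and j: "j \<in> patches" "x \<in> patch j"
  have inj: "G e v = G e w \<longleftrightarrow> v = w" if "e \<in> arcs \<Sigma>" for e v w using bij[OF that] by (metis bij_pointE)
  show "\<forall>\<^sub>F y in at x within X. \<forall>v w. glue_map G i y v = glue_map G i x w \<longrightarrow> glue_map G j y v = glue_map G j x w"
  proof (cases i)
    case t: (Inl t)
    show ?thesis
    proof (cases j)
      case (Inr e)
      then have "\<forall>\<^sub>F y in at x within X. y \<in> front e \<longleftrightarrow> x \<in> front e"
        using i j t by (intro front_locally_constant[of t]) (auto simp: patches_def)
      then show ?thesis by eventually_elim (auto simp: t Inr)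
    qed (simp add: t)
  next
    case e: (Inr e)
    show ?thesis
    proof (cases j)
      case (Inl t)
      then have "\<forall>\<^sub>F y in at x within X. y \<in> front e \<longleftrightarrow> x \<in> front e"
        using i j e by (intro front_locally_constant[of t]) (auto simp: patches_def)
      then show ?thesis by eventually_elim (use e i inj in \<open>auto simp: Inl patches_def\<close>)
    next
      case (Inr e')
      then have "e = e'" using edge_nbhd_disjoint i j e by auto
      then show ?thesis by (simp add: e Inr)
    qed
  qed
qed

definition side_map :: "('a set \<Rightarrow> 'f \<Rightarrow> 'f) \<Rightarrow> 'a set \<Rightarrow> 3 \<Rightarrow> 'f \<Rightarrow> 'f" where
  "side_map G t k = (if chosen_side (edge \<Sigma> t k) = (t, k) then G (edge \<Sigma> t k) else inv (G (edge \<Sigma> t k)))"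

fun path_map :: "('a set \<Rightarrow> 'f \<Rightarrow> 'f) \<Rightarrow> 'a position \<Rightarrow> step list \<Rightarrow> 'f \<Rightarrow> 'f" where
  "path_map G p [] v = v"
| "path_map G p (s # ss) v =
     path_map G (move \<Sigma> p s) ss (if s = Cross then side_map G (fst p) (snd (snd p)) v else v)"

text \<open>\<open>Turn\<close> and \<open>Along\<close> stay in one open triangle and transport
  trivially. A \<open>Cross\<close> step stays in one arc neighbourhood, whose front contains
  exactly one of its ends.\<close>

lemma transport_step_curve:
  assumes bij: "\<And>e. e \<in> arcs \<Sigma> \<Longrightarrow> bij (G e)"
    and p: "is_position \<Sigma> p" "s = Cross \<longrightarrow> edge \<Sigma> (fst p) (snd (snd p)) \<in> arcs \<Sigma>"
  shows "local_system.transport patches patch (glue_map G) (step_curve \<Sigma> p s) v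
    (if s = Cross then side_map G (fst p) (snd (snd p)) v else v)"
proof -
  interpret local_system X patches patch "glue_map G" using local_system_glue_map[OF bij] .
  obtain t c k where pe: "p = (t, c, k)" by (cases p)
  have t: "t \<in> triangles \<Sigma>" and c: "c \<noteq> k" using p(1) by (auto simp: pe is_position_def)
  note f = step_curve_facts[OF p]
  have inner: "transport (step_curve \<Sigma> p s) v v"
    if "step_curve \<Sigma> p s = chart \<Sigma> t \<circ> linepath (position_point c k) (position_point d j)" "d \<noteq> j" for d j
  proof (rule transport_in_U[OF f(1), of "Inl t"])
    show "path_image (step_curve \<Sigma> p s) \<subseteq> patch (Inl t)"
      using linepath_in_convex[OF convex_open_simplex3 position_point_in_open[OF c] position_point_in_open[OF that(2)]]
        chart_facts(3)[OF t] unfolding that(1) path_image_compose by auto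
  qed (use t in \<open>auto simp: patches_def\<close>)
  show ?thesis
  proof (cases s)
    case Turn
    then show ?thesis using inner[of c "third c k"] third_neq(3)[OF c] by (simp add: pe)
  next
    case Along
    then show ?thesis using inner[of "third c k" k] third_neq(1)[OF c] by (simp add: pe)
  next
    case Cross
    then have side: "arc_side t k" using p(2) t by (simp add: pe arc_side_def)
    let ?e = "edge \<Sigma> t k"
    have e: "?e \<in> arcs \<Sigma>" using side by (simp add: arc_side_def)
    obtain t' c' k' where m: "move \<Sigma> (t, c, k) Cross = (t', c', k')" "partner \<Sigma> t k = (t', k')" "arc_side t' k'" "c' \<noteq> k'"
      by (rule move_Cross_cases[OF side c]) blast
    have pt: "edge \<Sigma> t' k' = ?e" "(t', k') \<noteq> (t, k)"
      and sides: "\<And>u j. u \<in> triangles \<Sigma> \<Longrightarrow> edge \<Sigma> u j = ?e \<Longrightarrow> (u, j) = (t, k) \<or> (u, j) = (t', k')"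
      by (rule arc_side_partner[OF side]; use m(2) in auto)+
    have ch: "chosen_side ?e = (t, k) \<or> chosen_side ?e = (t', k')"
      using chosen_side[OF e] sides by (cases "chosen_side ?e") (auto simp: arc_side_def)
    have region: "position_point c k \<in> region k" "crossing_point c k \<in> region k"
      "position_point c' k' \<in> region k'" "crossing_point c' k' \<in> region k'"
      unfolding crossing_point_eq[OF c] crossing_point_eq[OF m(4)]
      by (simp_all add: position_point_in_region side_point_in_region c m(4))
    have im: "path_image (step_curve \<Sigma> p s) \<subseteq> edge_nbhd ?e"
    proof -
      have "path_image (chart \<Sigma> u \<circ> linepath a b) \<subseteq> edge_nbhd ?e" if "arc_side u j" "edge \<Sigma> u j = ?e" "a \<in> region j" "b \<in> region j" for u j a b
        using linepath_in_convex[OF convex_region that(3,4)] chart_in_edge_nbhd[OF that(1)] that(2)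
        unfolding path_image_compose by auto
      then show ?thesis unfolding pe Cross step_curve.simps m(1) prod.case
        using region side m(3) pt(1) by (intro subset_path_image_join) auto
    qed
    have "pathstart (step_curve \<Sigma> p s) = chart \<Sigma> t (position_point c k)"
      "pathfinish (step_curve \<Sigma> p s) = chart \<Sigma> t' (position_point c' k')"
      using f(3,4) m(1) by (simp_all add: pe Cross pos_point_def del: move.simps)
    then have front: "step_curve \<Sigma> p s 0 \<in> front ?e \<longleftrightarrow> chosen_side ?e = (t, k)"
      "step_curve \<Sigma> p s 1 \<in> front ?e \<longleftrightarrow> chosen_side ?e = (t', k')"
      using front_iff[OF side region(1) position_point_in_open[OF c]] front_iff[OF m(3) region(3) position_point_in_open[OF m(4)]] pt(1)
      by (simp_all add: pathstart_def pathfinish_def)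
    have "transport (step_curve \<Sigma> p s) v (side_map G t k v)"
      by (rule transport_in_U[OF f(1), of "Inr ?e"])
        (use im e ch pt(2) bij[OF e] in \<open>auto simp: front side_map_def patches_def bij_is_surj surj_f_inv_f\<close>)
    then show ?thesis by (simp add: pe Cross)
  qed
qed

lemma transport_path_curve:
  assumes bij: "\<And>e. e \<in> arcs \<Sigma> \<Longrightarrow> bij (G e)" and "elementary_path \<Sigma> p ss"
  shows "local_system.transport patches patch (glue_map G) (path_curve \<Sigma> p ss) v (path_map G p ss v)"
  using assms(2)
proof (induction ss arbitrary: p v)
  interpret local_system X patches patch "glue_map G" using local_system_glue_map[OF bij] .
  case Nil
  then have "pos_point p \<in> X" using pos_point_in_X by simp
  then obtain i where i: "i \<in> patches" "pos_point p \<in> patch i" using cover by blast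
  show ?case unfolding path_curve_Nil
    by (rule transport_in_U[OF _ i(1)]) (use i(2) in auto)
next
  interpret local_system X patches patch "glue_map G" using local_system_glue_map[OF bij] .
  case (Cons s ss)
  have e: "is_position \<Sigma> p" "s = Cross \<longrightarrow> edge \<Sigma> (fst p) (snd (snd p)) \<in> arcs \<Sigma>" "elementary_path \<Sigma> (move \<Sigma> p s) ss"
    using Cons.prems by auto
  show ?case
    unfolding path_curve_Cons path_map.simps
    by (rule transport_join[OF transport_step_curve[OF bij e(1,2)] Cons.IH[OF e(3)]])
      (use step_curve_facts(4)[OF e(1,2)] path_curve_facts(3)[OF e(3)] in simp_all)
qed

end

section \<open>Shear coordinates of a principal lamination\<close>

lemma in_set_zip_tl:
  assumes "x \<in> set (zip xs (tl xs))"
  obtains i where "Suc i < length xs" "x = (xs ! i, xs ! Suc i)"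
proof -
  obtain n where "xs ! n = fst x" "tl xs ! n = snd x" "n < length (tl xs)" using assms by (auto simp: in_set_zip)
  then show ?thesis by (intro that[of n]) (auto simp: nth_tl prod_eq_iff)
qed

lemma zip_append_tl:
  "A \<noteq> [] \<Longrightarrow> B \<noteq> [] \<Longrightarrow> zip (A @ B) (tl (A @ B)) = zip A (tl A) @ (last A, hd B) # zip B (tl B)"
proof (induction A)
  case (Cons a A)
  then show ?case by (cases A; cases B) auto
qed simp

lemma zip_rotate1: "xs \<noteq> [] \<Longrightarrow> zip xs (rotate1 xs) = zip xs (tl xs) @ [(last xs, hd xs)]"
proof -
  have *: "zip (x # xs) (xs @ [y]) = zip (x # xs) xs @ [(last (x # xs), y)]" for x y and xs :: "'b list"
    by (induction xs arbitrary: x) auto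
  show "xs \<noteq> [] \<Longrightarrow> ?thesis" using *[of "hd xs" "tl xs" "hd xs"] by (cases xs) simp_all
qed

lemma upto_first_eq_take:
  assumes "list_ex P xs"
  obtains m where "m < length xs" "P (xs ! m)" "upto_first P xs = take (Suc m) xs"
proof
  let ?m = "length (takeWhile (\<lambda>x. \<not> P x) xs)"
  have "\<exists>x\<in>set xs. P x" using assms by (simp add: list_ex_iff)
  then show m: "?m < length xs" by (metis length_takeWhile_le nat_less_le takeWhile_eq_all_conv takeWhile_eq_take take_all_iff)
  then show "P (xs ! ?m)" using nth_length_takeWhile by metis
  show "upto_first P xs = take (Suc ?m) xs"
    unfolding upto_first_def by (metis Suc_eq_plus1 takeWhile_eq_take dropWhile_eq_drop take_add)
qed

context triangulated
begin

abbreviation rotate :: "'a position \<Rightarrow> 'a position" where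
  "rotate p \<equiv> move \<Sigma> (move \<Sigma> p Turn) Cross"

definition arc_position :: "'a position \<Rightarrow> bool" where
  "arc_position p \<longleftrightarrow> (case p of (t, c, k) \<Rightarrow> arc_side t k \<and> c \<noteq> k)"

lemma arc_positionE:
  assumes "arc_position p"
  obtains t c k t' k' where "p = (t, c, k)" "arc_side t k" "c \<noteq> k" "partner \<Sigma> t k = (t', k')" "arc_side t' k'"
    "(t', k') \<noteq> (t, k)" "partner \<Sigma> t' k' = (t, k)" "coherent \<Sigma> t' k' = coherent \<Sigma> t k" "edge \<Sigma> t' k' = edge \<Sigma> t k"
proof -
  obtain t c k where p: "p = (t, c, k)" by (cases p)
  then have a: "arc_side t k" "c \<noteq> k" using assms by (auto simp: arc_position_def)
  show ?thesis
    by (rule arc_side_partner[OF a(1)]) (use that[OF p a] coherent_partner[OF a(1)] in blast)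
qed

lemma cross_arc_position:
  assumes "arc_position p"
  shows "arc_position (move \<Sigma> p Cross)" "move \<Sigma> (move \<Sigma> p Cross) Cross = p" "move \<Sigma> p Cross \<noteq> p"
    "move \<Sigma> (move \<Sigma> p Cross) Along = move \<Sigma> (move \<Sigma> p Along) Cross"
proof -
  have "arc_position (move \<Sigma> p Cross) \<and> move \<Sigma> (move \<Sigma> p Cross) Cross = p \<and> move \<Sigma> p Cross \<noteq> p \<and>
    move \<Sigma> (move \<Sigma> p Cross) Along = move \<Sigma> (move \<Sigma> p Along) Cross"
    using assms
  proof (cases rule: arc_positionE)
    case (1 t c k t' k')
    from position_cases[OF 1(3)] show ?thesis
      using 1 by (cases "coherent \<Sigma> t k") (auto simp: arc_position_def)
  qed
  then show "arc_position (move \<Sigma> p Cross)" "move \<Sigma> (move \<Sigma> p Cross) Cross = p" "move \<Sigma> p Cross \<noteq> p"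
    "move \<Sigma> (move \<Sigma> p Cross) Along = move \<Sigma> (move \<Sigma> p Along) Cross" by auto
qed

lemma is_position_turn: "is_position \<Sigma> p \<Longrightarrow> is_position \<Sigma> (move \<Sigma> p Turn)"
  by (auto simp: is_position_def third_neq split: prod.splits)

lemma turn_turn_position: "move \<Sigma> (move \<Sigma> p Turn) Turn = p"
  by (cases p) simp

lemma turn_neq: "is_position \<Sigma> p \<Longrightarrow> move \<Sigma> p Turn \<noteq> p"
  by (cases p) (auto simp: is_position_def third_neq)

lemma arc_position_is_position: "arc_position p \<Longrightarrow> is_position \<Sigma> p"
  by (auto simp: arc_position_def is_position_def arc_side_def)

text \<open>The position from which a ray starting at \<open>p\<close> leaves its triangle after
  \<open>i\<close> rotations; crossing there completes the next rotation.\<close>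

definition ray_exit :: "'a position \<Rightarrow> nat \<Rightarrow> 'a position" where
  "ray_exit p i = move \<Sigma> ((rotate ^^ i) p) Turn"

lemma funpow_rotate_Suc: "(rotate ^^ Suc i) p = move \<Sigma> (ray_exit p i) Cross"
  by (simp add: ray_exit_def)

lemma ray_exit_rotate: "ray_exit (rotate p) i = ray_exit p (Suc i)"
  unfolding ray_exit_def funpow_Suc_right by simp

text \<open>Turning around a marked point never comes back to the starting position: since \<open>Turn\<close> and
  \<open>Cross\<close> are involutions, one of them would have a fixed point half way.\<close>

lemma ray_exit_neq:
  "arc_position q \<Longrightarrow> (\<And>i. i < m \<Longrightarrow> arc_position (ray_exit q i)) \<Longrightarrow> ray_exit q m \<noteq> q"
proof (induction m arbitrary: q rule: less_induct)
  case (less m)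
  note q = less.prems
  show ?case
  proof
    assume e: "ray_exit q m = q"
    consider "m = 0" | "m = 1" | n where "m = Suc (Suc n)" by (metis One_nat_def nat.exhaust)
    then show False
    proof cases
      case 1
      then show False using e turn_neq[OF arc_position_is_position[OF q(1)]] by (simp add: ray_exit_def)
    next
      case 2
      have a: "arc_position (move \<Sigma> q Turn)" using q(2)[of 0] 2 by (simp add: ray_exit_def)
      have "move \<Sigma> (rotate q) Turn = q" using e 2 by (simp add: ray_exit_def)
      then have "rotate q = move \<Sigma> q Turn" using turn_turn_position[of "rotate q"] by metis
      then show False using cross_arc_position(3)[OF a] by metis
    next
      \<comment> \<open>Undoing the last \<open>Turn\<close> and \<open>Cross\<close> and performing
        the first ones gives the same equation for \<open>rotate q\<close> with \<open>m\<close>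
        lowered by 2.\<close>
      case (3 n)
      have a0: "arc_position (move \<Sigma> q Turn)" using q(2)[of 0] 3 by (simp add: ray_exit_def)
      have a1: "arc_position (ray_exit q (Suc n))" using q(2) 3 by simp
      have "(rotate ^^ m) q = move \<Sigma> q Turn"
        using e turn_turn_position[of "(rotate ^^ m) q"] unfolding ray_exit_def by metis
      then have "move \<Sigma> (ray_exit q (Suc n)) Cross = move \<Sigma> q Turn" using funpow_rotate_Suc[of "Suc n" q] 3 by simp
      then have "ray_exit q (Suc n) = rotate q" using cross_arc_position(2)[OF a1] by metis
      then have "ray_exit (rotate q) n = rotate q" by (simp only: ray_exit_rotate)
      moreover have "ray_exit (rotate q) n \<noteq> rotate q"
      proof (rule less.IH)
        show "arc_position (ray_exit (rotate q) i)" if "i < n" for i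
          unfolding ray_exit_rotate using q(2) that 3 by simp
      qed (use 3 cross_arc_position(1)[OF a0] in auto)
      ultimately show False by blast
    qed
  qed
qed

definition passage :: "'a position \<Rightarrow> 'a passage" where
  "passage = (\<lambda>(t, c, k). (t, k, third c k))"

definition bseg_position :: "'a position \<Rightarrow> bool" where
  "bseg_position = (\<lambda>(t, c, k). edge \<Sigma> t k \<in> bsegs \<Sigma>)"

lemma bseg_not_arc_position: "bseg_position p \<Longrightarrow> \<not> arc_position p"
  using arc_facts(2) by (auto simp: bseg_position_def arc_position_def arc_side_def)

text \<open>Solves the recursion of \<open>ray\<close> by iterates of \<open>rotate\<close>. It
  keeps the fact that the last exit is a boundary segment, on which the exclusion of periodic
  turning rests.\<close>

lemma ray_nth:
  "ray \<Sigma> p ps \<Longrightarrow> is_position \<Sigma> p \<Longrightarrow> ps \<noteq> [] \<and> (\<forall>i<length ps. ps ! i = passage ((rotate ^^ i) p)) \<and>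
    (\<forall>i. Suc i < length ps \<longrightarrow> arc_position (ray_exit p i)) \<and> bseg_position (ray_exit p (length ps - 1))"
proof (induction rule: ray.induct)
  case (ray_end t c k)
  then show ?case by (simp add: passage_def ray_exit_def bseg_position_def)
next
  case (ray_step t c k ps)
  let ?p = "(t, c, k)"
  have e: "arc_position (move \<Sigma> ?p Turn)"
    using ray_step is_position_turn[of ?p] by (auto simp: arc_position_def arc_side_def is_position_def)
  have IH: "ps \<noteq> []" "\<And>i. i < length ps \<Longrightarrow> ps ! i = passage ((rotate ^^ i) (rotate ?p))"
    "\<And>i. Suc i < length ps \<Longrightarrow> arc_position (ray_exit (rotate ?p) i)" "bseg_position (ray_exit (rotate ?p) (length ps - 1))"
    using ray_step.IH arc_position_is_position[OF cross_arc_position(1)[OF e]] by simp_all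
  show ?case
  proof (intro conjI allI impI)
    fix i assume "i < length ((t, k, third c k) # ps)"
    then show "((t, k, third c k) # ps) ! i = passage ((rotate ^^ i) ?p)"
      using IH(2)[of "i - 1"] by (cases i) (auto simp: passage_def funpow_Suc_right simp del: funpow.simps(2) move.simps)
  next
    fix i assume "Suc i < length ((t, k, third c k) # ps)"
    then show "arc_position (ray_exit ?p i)"
      using IH(3)[of "i - 1"] e by (cases i) (auto simp: ray_exit_rotate ray_exit_def[of _ 0] simp del: move.simps)
  next
    show "bseg_position (ray_exit ?p (length ((t, k, third c k) # ps) - 1))"
      using IH(1,4) unfolding ray_exit_rotate by (cases ps) simp_all
  qed simp
qed

text \<open>Periodic rotation would leave through arcs forever, but a ray ends at a boundary
  segment.\<close>

lemma ray_not_periodic: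
  assumes "ray \<Sigma> p ps" "is_position \<Sigma> p" "(rotate ^^ Suc n) p = p" "\<And>i. i \<le> n \<Longrightarrow> arc_position (ray_exit p i)"
  shows False
proof -
  define g where "g = rotate ^^ Suc n"
  have "(g ^^ j) p = p" for j
    by (induction j) (simp_all add: assms(3)[folded g_def])
  then have *: "(rotate ^^ (Suc n * j)) p = p" for j by (metis funpow_mult g_def)
  have "(rotate ^^ i) p = (rotate ^^ (i mod Suc n)) p" for i
  proof -
    have "(rotate ^^ i) p = (rotate ^^ (i mod Suc n + Suc n * (i div Suc n))) p"
      by (simp only: mod_mult_div_eq)
    then show ?thesis by (simp only: funpow_add o_apply *)
  qed
  then have "ray_exit p i = ray_exit p (i mod Suc n)" for i
    unfolding ray_exit_def by metis
  then have "arc_position (ray_exit p i)" for i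
    using assms(4)[of "i mod Suc n"] by (metis less_Suc_eq_le mod_less_divisor zero_less_Suc)
  then show False using ray_nth[OF assms(1,2)] bseg_not_arc_position by blast
qed

text \<open>Consecutive passages of a ray turn around the same marked point, which stays on the same
  side of the curve; so the crossing between them is neither of type S nor of type Z.\<close>

lemma sz_sign_turn:
  assumes "is_position \<Sigma> q" "arc_position (move \<Sigma> q Turn)"
  shows "sz_sign \<Sigma> (passage q, passage (rotate q)) = 0"
    "sz_sign \<Sigma> (flip_passage (passage (rotate q)), flip_passage (passage q)) = 0"
proof -
  obtain t d i where q: "q = (t, d, i)" by (cases q)
  define j where "j = third d i"
  have dj: "d \<noteq> j" "d \<noteq> i" using assms(1) third_neq(3)[of d i] by (auto simp: q j_def is_position_def)
  have i: "i = third d j" by (simp add: j_def)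
  have T: "move \<Sigma> q Turn = (t, d, j)" by (simp add: q j_def)
  obtain t' i' where pt: "partner \<Sigma> t j = (t', i')" "coherent \<Sigma> t' i' = coherent \<Sigma> t j"
    using assms(2) unfolding T by (cases rule: arc_positionE) auto
  have "sz_sign \<Sigma> (passage q, passage (rotate q)) = 0 \<and>
    sz_sign \<Sigma> (flip_passage (passage (rotate q)), flip_passage (passage q)) = 0"
    using position_cases[OF dj(1)]
    unfolding T by (cases "coherent \<Sigma> t j") (auto simp: q i pt passage_def flip_passage_def sz_sign_def Let_def)
  then show "sz_sign \<Sigma> (passage q, passage (rotate q)) = 0"
    "sz_sign \<Sigma> (flip_passage (passage (rotate q)), flip_passage (passage q)) = 0" by auto
qed

lemma arc_position_rotate:
  assumes "is_position \<Sigma> p" "\<And>j. j < i \<Longrightarrow> arc_position (ray_exit p j)"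
  shows "is_position \<Sigma> ((rotate ^^ i) p)"
proof (cases i)
  case (Suc j)
  then show ?thesis
    using cross_arc_position(1)[OF assms(2)[of j]] arc_position_is_position unfolding Suc funpow_rotate_Suc by simp
qed (use assms in simp)

lemma ray_crossings:
  assumes "ray \<Sigma> p ps" "is_position \<Sigma> p" "Suc i < length ps"
  shows "sz_sign \<Sigma> (ps ! i, ps ! Suc i) = 0" "sz_sign \<Sigma> (flip_passage (ps ! Suc i), flip_passage (ps ! i)) = 0"
proof -
  note r = ray_nth[OF assms(1,2)]
  have a: "arc_position (ray_exit p j)" if "j \<le> i" for j using r assms(3) that by auto
  have "is_position \<Sigma> ((rotate ^^ i) p)" by (rule arc_position_rotate[OF assms(2)]) (use a in auto)
  moreover have "arc_position (move \<Sigma> ((rotate ^^ i) p) Turn)" using a[of i] by (simp add: ray_exit_def)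
  moreover have "ps ! i = passage ((rotate ^^ i) p)" "ps ! Suc i = passage (rotate ((rotate ^^ i) p))" using r assms(3) by auto
  ultimately show "sz_sign \<Sigma> (ps ! i, ps ! Suc i) = 0" "sz_sign \<Sigma> (flip_passage (ps ! Suc i), flip_passage (ps ! i)) = 0"
    using sz_sign_turn by auto
qed

lemma positions_of_arc:
  assumes "arc_position p" "arc_position e" "edge \<Sigma> (fst e) (snd (snd e)) = edge \<Sigma> (fst p) (snd (snd p))"
  shows "e \<in> {p, move \<Sigma> p Along, move \<Sigma> p Cross, move \<Sigma> (move \<Sigma> p Cross) Along}"
  using assms(1)
proof (cases rule: arc_positionE)
  case (1 t c k t' k')
  obtain u d j where e: "e = (u, d, j)" by (cases e)
  have "(u, j) = (t, k) \<or> (u, j) = (t', k')"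
    by (rule arc_side_partner[OF 1(2)]) (use assms 1 e in \<open>auto simp: arc_position_def arc_side_def\<close>)
  moreover have "d \<noteq> j" using assms(2) by (simp add: e arc_position_def)
  ultimately show ?thesis
    using position_cases[OF 1(3)] position_cases[of d j] 1 e by (cases "coherent \<Sigma> t k") auto
qed

text \<open>All crossings except the one in the middle of \<tau> belong to turning ends and have
  sign 0. For a strand this follows from its form; for a closed curve it must be shown that the last
  passage joins the first one by that same middle crossing.\<close>

lemma associated_lamination_crossings:
  assumes "\<tau> \<in> arcs \<Sigma>" "associated_lamination \<Sigma> \<tau> l"
  obtains t c k xs ys where "arc_side t k" "edge \<Sigma> t k = \<tau>" "c \<noteq> k"
    "crossings l = xs @ ((t, third c k, k), passage (move \<Sigma> (move \<Sigma> (t, c, k) Cross) Along)) # ys"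
    "\<And>x. x \<in> set xs \<union> set ys \<Longrightarrow> sz_sign \<Sigma> x = 0"
proof -
  obtain t c k ps qs where t: "t \<in> triangles \<Sigma>" "edge \<Sigma> t k = \<tau>" "c \<noteq> k"
    and ps: "ray \<Sigma> (t, c, k) ps" and qs: "ray \<Sigma> (move \<Sigma> (move \<Sigma> (t, c, k) Cross) Along) qs"
    and l: "l = (if list_ex (exits_through \<Sigma> \<tau>) ps \<and> list_ex (exits_through \<Sigma> \<tau>) qs
             then Loop (upto_first (exits_through \<Sigma> \<tau>) qs) else Strand (rev (map flip_passage ps) @ qs))"
    using assms(2) unfolding associated_lamination_def by blast
  let ?p = "(t, c, k)"
  let ?q = "move \<Sigma> (move \<Sigma> ?p Cross) Along"
  have side: "arc_side t k" using t assms(1) by (simp add: arc_side_def)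
  have ap: "arc_position ?p" using side t by (simp add: arc_position_def)
  have along: "arc_position (move \<Sigma> p' Along)" if "arc_position p'" for p'
    using that third_neq(1) by (auto simp: arc_position_def split: prod.splits)
  have aq: "arc_position ?q" using along[OF cross_arc_position(1)[OF ap]] .
  have qe: "?q = move \<Sigma> (move \<Sigma> ?p Along) Cross" using cross_arc_position(4)[OF ap] .
  have Cq: "move \<Sigma> ?q Cross = move \<Sigma> ?p Along"
    unfolding qe using cross_arc_position(2)[OF along[OF ap]] .
  note rp = ray_nth[OF ps arc_position_is_position[OF ap]] and rq = ray_nth[OF qs arc_position_is_position[OF aq]]
  have exit: "arc_position (ray_exit r m) \<and> edge \<Sigma> (fst (ray_exit r m)) (snd (snd (ray_exit r m))) = \<tau> \<and> Suc m < length rs"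
    if "ray \<Sigma> r rs" "is_position \<Sigma> r" "m < length rs" "exits_through \<Sigma> \<tau> (rs ! m)" for r rs m
  proof -
    note rr = ray_nth[OF that(1,2)]
    have e: "edge \<Sigma> (fst (ray_exit r m)) (snd (snd (ray_exit r m))) = \<tau>"
      using that(4) rr that(3) by (auto simp: exits_through_def ray_exit_def passage_def split: prod.splits)
    then have "\<not> bseg_position (ray_exit r m)" using arc_facts(2)[OF assms(1)] by (auto simp: bseg_position_def split: prod.splits)
    then have "m \<noteq> length rs - 1" using rr by auto
    then show ?thesis using rr that(3) e by auto
  qed
  \<comment> \<open>A return to \<tau> happens at one of its four positions. The starting position
    is excluded by \<open>ray_exit_neq\<close>, and \<open>move \<Sigma> ?p Along\<close> would make
    the rotation periodic. At \<open>move \<Sigma> ?p Cross\<close> the ray would continue as the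
    other ray, whose own return to \<tau> would then have no possible position.\<close>
  have exit_p: "ray_exit ?q m = ?p"
    if "list_ex (exits_through \<Sigma> \<tau>) ps" "m < length qs" "exits_through \<Sigma> \<tau> (qs ! m)" for m
  proof -
    note em = exit[OF qs arc_position_is_position[OF aq] that(2,3)]
    have arcs_q: "arc_position (ray_exit ?q i)" if "i \<le> m" for i using rq em that by auto
    have "ray_exit ?q m \<in> {?p, move \<Sigma> ?p Along, move \<Sigma> ?p Cross, ?q}"
      by (rule positions_of_arc[OF ap]) (use em t(2) in auto)
    moreover have "ray_exit ?q m \<noteq> ?q" by (rule ray_exit_neq[OF aq]) (use arcs_q in auto)
    moreover have "ray_exit ?q m \<noteq> move \<Sigma> ?p Along"
    proof
      assume "ray_exit ?q m = move \<Sigma> ?p Along"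
      then have "(rotate ^^ Suc m) ?q = ?q" unfolding funpow_rotate_Suc qe by simp
      then show False using ray_not_periodic[OF qs arc_position_is_position[OF aq]] arcs_q by blast
    qed
    moreover have "ray_exit ?q m \<noteq> move \<Sigma> ?p Cross"
    proof
      assume "ray_exit ?q m = move \<Sigma> ?p Cross"
      then have qp: "(rotate ^^ Suc m) ?q = ?p" unfolding funpow_rotate_Suc using cross_arc_position(2)[OF ap] by simp
      obtain j where j: "j < length ps" "exits_through \<Sigma> \<tau> (ps ! j)"
        using \<open>list_ex (exits_through \<Sigma> \<tau>) ps\<close> by (auto simp: list_ex_length)
      note ej = exit[OF ps arc_position_is_position[OF ap] j]
      have arcs_p: "arc_position (ray_exit ?p i)" if "i \<le> j" for i using rp ej that by auto
      have shift: "ray_exit ?q (i + Suc m) = ray_exit ?p i" for i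
        unfolding ray_exit_def funpow_add o_apply qp ..
      have arcs_qp: "arc_position (ray_exit ?q i)" if "i \<le> j + Suc m" for i
        using arcs_q[of i] arcs_p[of "i - Suc m"] shift[of "i - Suc m"] that by (cases "i \<le> m") auto
      have "ray_exit ?p j \<in> {?p, move \<Sigma> ?p Along, move \<Sigma> ?p Cross, ?q}"
        by (rule positions_of_arc[OF ap]) (use ej t(2) in auto)
      moreover have "ray_exit ?p j \<noteq> ?p" by (rule ray_exit_neq[OF ap]) (use arcs_p in auto)
      moreover have "ray_exit ?p j \<noteq> move \<Sigma> ?p Cross"
      proof
        assume "ray_exit ?p j = move \<Sigma> ?p Cross"
        then have "(rotate ^^ Suc j) ?p = ?p" unfolding funpow_rotate_Suc using cross_arc_position(2)[OF ap] by simp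
        then show False using ray_not_periodic[OF ps arc_position_is_position[OF ap]] arcs_p by blast
      qed
      moreover have "ray_exit ?p j \<noteq> ?q"
        unfolding shift[symmetric] by (rule ray_exit_neq[OF aq]) (use arcs_qp in auto)
      moreover have "ray_exit ?p j \<noteq> move \<Sigma> ?p Along"
      proof
        assume eq: "ray_exit ?p j = move \<Sigma> ?p Along"
        have "(rotate ^^ Suc (j + Suc m)) ?q = ?q" unfolding funpow_rotate_Suc shift eq by (rule qe[symmetric])
        then show False using ray_not_periodic[OF qs arc_position_is_position[OF aq]] arcs_qp by blast
      qed
      ultimately show False by blast
    qed
    ultimately show ?thesis by blast
  qed
  have hdq: "hd qs = passage ?q" using rq by (simp add: hd_conv_nth)
  have zero_qs: "sz_sign \<Sigma> x = 0" if "x \<in> set (zip (take n qs) (tl (take n qs)))" for x n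
    using that by (rule in_set_zip_tl) (use ray_crossings(1)[OF qs arc_position_is_position[OF aq]] in auto)
  show ?thesis
  proof (cases "list_ex (exits_through \<Sigma> \<tau>) ps \<and> list_ex (exits_through \<Sigma> \<tau>) qs")
    case True
    then obtain m where m: "m < length qs" "exits_through \<Sigma> \<tau> (qs ! m)"
      "upto_first (exits_through \<Sigma> \<tau>) qs = take (Suc m) qs" using upto_first_eq_take by metis
    have T: "take (Suc m) qs \<noteq> []" "hd (take (Suc m) qs) = passage ?q" "last (take (Suc m) qs) = qs ! m"
      using m(1) rq hdq by (auto simp: last_conv_nth hd_conv_nth)
    \<comment> \<open>The returning end leaves at \<open>?p\<close>, so its last passage cuts the
      same corner as the first passage of the other ray, in reverse; closing up reproduces the
      middle crossing.\<close>
    have "(rotate ^^ m) ?q = move \<Sigma> ?p Turn"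
      using exit_p[OF _ m(1,2)] True turn_turn_position[of "(rotate ^^ m) ?q"] unfolding ray_exit_def by metis
    then have "qs ! m = (t, third c k, k)" using rq m(1) by (simp add: passage_def)
    then have "crossings l = zip (take (Suc m) qs) (tl (take (Suc m) qs)) @ ((t, third c k, k), passage ?q) # []"
      using True l m(3) zip_rotate1[OF T(1)] T(2,3) by simp
    then show ?thesis
      by (rule that[OF side t(2,3)]) (use zero_qs in auto)
  next
    case False
    let ?A = "rev (map flip_passage ps)"
    have A: "?A \<noteq> []" "last ?A = (t, third c k, k)"
      using rp by (auto simp: last_rev hd_map hd_conv_nth passage_def flip_passage_def)
    have zero_A: "sz_sign \<Sigma> x = 0" if "x \<in> set (zip ?A (tl ?A))" for x
      using that
    proof (rule in_set_zip_tl)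
      fix i assume i: "Suc i < length ?A" "x = (?A ! i, ?A ! Suc i)"
      define j where "j = length ps - Suc (Suc i)"
      have j: "Suc j < length ps" "length ps - Suc i = Suc j" using i(1) by (auto simp: j_def)
      have "x = (flip_passage (ps ! Suc j), flip_passage (ps ! j))"
        using i j by (auto simp: rev_nth j_def)
      then show "sz_sign \<Sigma> x = 0" using ray_crossings(2)[OF ps arc_position_is_position[OF ap] j(1)] by simp
    qed
    have l: "l = Strand (?A @ qs)" unfolding l by (rule if_not_P[OF False])
    have qs_ne: "qs \<noteq> []" using rq by blast
    have "crossings l = zip ?A (tl ?A) @ ((t, third c k, k), passage ?q) # zip qs (tl qs)"
      unfolding l crossings.simps zip_append_tl[OF A(1) qs_ne] A(2) hdq by (rule refl)
    then show ?thesis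
      by (rule that[OF side t(2,3)]) (use zero_A zero_qs[of _ "length qs"] in auto)
  qed
qed

end

locale laminated = triangulated \<Sigma> for \<Sigma> :: "'a::metric_space tsurface" +
  fixes L :: "'a set \<Rightarrow> 'a lamination_curve"
  assumes principal: "principal_lamination \<Sigma> L"
begin

text \<open>Only the middle crossing contributes. As the curve crosses \<tau> between its ends, the
  corners it turns around before and after lie on different sides of it, which is type S or
  Z.\<close>

lemma shear_values:
  assumes "arc_side u j"
  shows "shear \<Sigma> (L (edge \<Sigma> u j)) u j \<in> {1, -1}"
proof -
  have "edge \<Sigma> u j \<in> arcs \<Sigma>" using assms by (simp add: arc_side_def)
  moreover from this have "associated_lamination \<Sigma> (edge \<Sigma> u j) (L (edge \<Sigma> u j))"
    using principal by (simp add: principal_lamination_def)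
  ultimately obtain t c k xs ys where t: "arc_side t k" "edge \<Sigma> t k = edge \<Sigma> u j" "c \<noteq> k"
    and cr: "crossings (L (edge \<Sigma> u j)) = xs @ ((t, third c k, k), passage (move \<Sigma> (move \<Sigma> (t, c, k) Cross) Along)) # ys"
    and zero: "\<And>x. x \<in> set xs \<union> set ys \<Longrightarrow> sz_sign \<Sigma> x = 0"
    by (rule associated_lamination_crossings) blast
  define y where "y = passage (move \<Sigma> (move \<Sigma> (t, c, k) Cross) Along)"
  let ?x = "((t, third c k, k), y)"
  let ?f = "\<lambda>x. case fst x of (v, i, l) \<Rightarrow> if (v, l) = (u, j) then sz_sign \<Sigma> x
      else if (v, l) = partner \<Sigma> u j then (if coherent \<Sigma> u j then sz_sign \<Sigma> x else - sz_sign \<Sigma> x) else 0"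
  have f0: "?f x = 0" if "sz_sign \<Sigma> x = 0" for x using that by (simp split: prod.split)
  have sum0: "(\<Sum>x\<leftarrow>zs. ?f x) = 0" if "\<And>x. x \<in> set zs \<Longrightarrow> sz_sign \<Sigma> x = 0" for zs
    using that f0 by (induction zs) simp_all
  have "(\<Sum>x\<leftarrow>crossings (L (edge \<Sigma> u j)). ?f x) = ?f ?x"
    unfolding cr y_def[symmetric] map_append list.map sum_list_append sum_list.Cons
    using sum0[of xs] sum0[of ys] zero by simp
  then have shear: "shear \<Sigma> (L (edge \<Sigma> u j)) u j = ?f ?x" by (simp only: shear_def)
  obtain t' k' where pt: "partner \<Sigma> t k = (t', k')" "partner \<Sigma> t' k' = (t, k)" "(u, j) = (t, k) \<or> (u, j) = (t', k')"
    by (rule arc_side_partner[OF t(1)]) (use t(2) assms in \<open>auto simp: arc_side_def\<close>)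
  have "sz_sign \<Sigma> ?x \<in> {1, -1}"
    using position_cases[OF t(3)] pt(1) unfolding y_def
    by (cases "coherent \<Sigma> t k") (auto simp: sz_sign_def passage_def Let_def)
  moreover have "?f ?x \<in> {sz_sign \<Sigma> ?x, - sz_sign \<Sigma> ?x}"
    using pt(3)
  proof
    assume "(u, j) = (t', k')"
    then have "partner \<Sigma> u j = (t, k)" using pt(2) by simp
    then show ?thesis by simp
  qed simp
  moreover have "b \<in> {1, -1}" if "a \<in> {1, -1}" "b \<in> {a, -a}" for a b :: int using that by auto
  ultimately show ?thesis unfolding shear by blast
qed

end

section \<open>Matrices\<close>

lemma mat2_nth [simp]:
  "mat2 a b c d $ 1 $ 1 = a" "mat2 a b c d $ 1 $ 2 = b" "mat2 a b c d $ 2 $ 1 = c" "mat2 a b c d $ 2 $ 2 = d"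
  by (simp_all add: mat2_def)

lemma matrix2_eq_iff: "A = B \<longleftrightarrow> A $ 1 $ 1 = B $ 1 $ 1 \<and> A $ 1 $ 2 = B $ 1 $ 2 \<and> A $ 2 $ 1 = B $ 2 $ 1 \<and> A $ 2 $ 2 = B $ 2 $ 2"
  for A B :: "'b^2^2"
  by (auto simp: vec_eq_iff forall_2)

lemma mat2_mult [simp]:
  "mat2 a b c d ** mat2 a' b' c' d' = mat2 (a * a' + b * c') (a * b' + b * d') (c * a' + d * c') (c * b' + d * d')"
  by (simp add: matrix2_eq_iff matrix_matrix_mult_def sum_2)

lemma mat_1_eq_mat2: "mat 1 = mat2 1 0 0 1"
  by (simp add: matrix2_eq_iff mat_def)

lemma mat2_uminus [simp]: "- mat2 a b c d = mat2 (- a) (- b) (- c) (- d :: 'b::comm_ring_1)"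
  by (simp add: matrix2_eq_iff)

lemma det_mat2 [simp]: "det (mat2 a b c d :: 'b::comm_ring_1^2^2) = a * d - b * c"
  by (simp add: det_2)

lemma trace_2: "trace A = A $ 1 $ 1 + A $ 2 $ 2" for A :: "'b::comm_ring_1^2^2"
  by (simp add: trace_def sum_2)

lemma matrix_mult_minus: "(- A) ** B = - (A ** B)" "A ** (- B) = - (A ** B)" for A B :: "'b::comm_ring_1^'n^'n"
  by (simp_all add: vec_eq_iff matrix_matrix_mult_def sum_negf)

lemma trace_minus: "trace (- A) = - trace A" for A :: "'b::comm_ring_1^'n^'n"
  by (simp add: trace_def sum_negf)

lemma trace_square_2: "trace (A ** A) = (trace A)\<^sup>2 - 2 * det A" for A :: "'b::comm_ring_1^2^2"
  by (simp add: trace_2 matrix_matrix_mult_def sum_2 det_2 power2_eq_square algebra_simps)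

text \<open>The adjugate multiplied by the determinant: an inverse without division, valid as soon
  as the determinant is its own inverse.\<close>

definition inverse2 :: "'b::comm_ring_1^2^2 \<Rightarrow> 'b^2^2" where
  "inverse2 A = mat2 (det A * A $ 2 $ 2) (- (det A * A $ 1 $ 2)) (- (det A * A $ 2 $ 1)) (det A * A $ 1 $ 1)"

lemma inverse2:
  assumes "det A * det A = 1"
  shows "inverse2 A ** A = mat 1" "A ** inverse2 A = mat 1"
proof -
  have "det A * (A $ 1 $ 1 * A $ 2 $ 2) - det A * (A $ 1 $ 2 * A $ 2 $ 1) = 1"
    using assms by (simp add: det_2 algebra_simps)
  then show "inverse2 A ** A = mat 1" "A ** inverse2 A = mat 1"
    by (simp_all add: inverse2_def matrix2_eq_iff matrix_matrix_mult_def sum_2 mat_def algebra_simps)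
qed

lemma det_inverse2:
  assumes "det A * det A = 1"
  shows "det (inverse2 A) = det (A :: 'b::comm_ring_1^2^2)"
proof -
  have "det (inverse2 A) * det A = 1" using inverse2(1)[OF assms] by (metis det_I det_mul)
  then have "det (inverse2 A) * (det A * det A) = det A" by (simp flip: mult.assoc)
  then show ?thesis using assms by simp
qed

definition eq_upto_sign :: "'b::uminus \<Rightarrow> 'b \<Rightarrow> bool" (infix "=\<^sub>\<plusminus>" 50) where
  "A =\<^sub>\<plusminus> B \<longleftrightarrow> A = B \<or> A = - B"

lemma eq_upto_sign_refl [simp]: "A =\<^sub>\<plusminus> A"
  by (simp add: eq_upto_sign_def)

lemma eq_upto_sign_sym: "A =\<^sub>\<plusminus> B \<Longrightarrow> B =\<^sub>\<plusminus> A" for A :: "'b::group_add"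
  by (auto simp: eq_upto_sign_def)

lemma eq_upto_sign_trans [trans]: "A =\<^sub>\<plusminus> B \<Longrightarrow> B =\<^sub>\<plusminus> C \<Longrightarrow> A =\<^sub>\<plusminus> C" for A :: "'b::group_add"
  by (auto simp: eq_upto_sign_def)

lemma eq_upto_sign_mult: "A =\<^sub>\<plusminus> A' \<Longrightarrow> B =\<^sub>\<plusminus> B' \<Longrightarrow> A ** B =\<^sub>\<plusminus> A' ** B'" for A A' B B' :: "'b::comm_ring_1^'n^'n"
  by (auto simp: eq_upto_sign_def matrix_mult_minus)

lemma eq_upto_sign_trace: "A =\<^sub>\<plusminus> B \<Longrightarrow> trace A =\<^sub>\<plusminus> trace B" for A :: "'b::comm_ring_1^'n^'n"
  by (auto simp: eq_upto_sign_def trace_minus)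

lemma trace_conjugate: "B ** A = mat 1 \<Longrightarrow> trace (A ** C ** B) = trace C" for A B C :: "'b::comm_ring_1^'n^'n"
  by (metis matrix_mul_assoc matrix_mul_rid trace_mul_sym matrix_mul_lid)

lemma x_pow_inverse [simp]:
  "x_pow e 1 * x_pow e (- 1) = 1" "x_pow e (- 1) * x_pow e 1 = 1"
  "x_pow e 1 * (x_pow e (- 1) * z) = z" "x_pow e (- 1) * (x_pow e 1 * z) = z"
proof -
  show *: "x_pow e 1 * x_pow e (- 1) = 1" "x_pow e (- 1) * x_pow e 1 = 1"
    by (simp_all add: x_pow_def Poly_Mapping.mult_single flip: Poly_Mapping.single_add)
  then show "x_pow e 1 * (x_pow e (- 1) * z) = z" "x_pow e (- 1) * (x_pow e 1 * z) = z"
    by (simp_all flip: mult.assoc)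
qed

lemma y_half_pow_inverse [simp]:
  "y_half_pow e 1 * y_half_pow e (- 1) = 1" "y_half_pow e (- 1) * y_half_pow e 1 = 1"
  "y_half_pow e 1 * (y_half_pow e (- 1) * z) = z" "y_half_pow e (- 1) * (y_half_pow e 1 * z) = z"
proof -
  show *: "y_half_pow e 1 * y_half_pow e (- 1) = 1" "y_half_pow e (- 1) * y_half_pow e 1 = 1"
    by (simp_all add: y_half_pow_def Poly_Mapping.mult_single flip: Poly_Mapping.single_add)
  then show "y_half_pow e 1 * (y_half_pow e (- 1) * z) = z" "y_half_pow e (- 1) * (y_half_pow e 1 * z) = z"
    by (simp_all flip: mult.assoc)
qed

lemma sum_list_signed:
  fixes f g :: "'b \<Rightarrow> int"
  assumes "\<And>x. f x = (if b then g x else - g x)"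
  shows "(\<Sum>x\<leftarrow>xs. f x) = (if b then \<Sum>x\<leftarrow>xs. g x else - (\<Sum>x\<leftarrow>xs. g x))"
  using assms by (induction xs) auto

section \<open>Step matrices in a reference gauge\<close>

context laminated
begin

text \<open>The matrices of the elementary steps in the gauge where every local orientation is opposite to the
  reference orientation of the triangle.  This choice makes the matrices of reduced paths
  non-negative up to sign.\<close>

abbreviation x_var :: "'a set \<Rightarrow> 3 \<Rightarrow> 'a set laurent" where "x_var t k \<equiv> x_pow (edge \<Sigma> t k) 1"
abbreviation x_inv :: "'a set \<Rightarrow> 3 \<Rightarrow> 'a set laurent" where "x_inv t k \<equiv> x_pow (edge \<Sigma> t k) (- 1)"

definition along :: "'a set \<Rightarrow> 3 \<Rightarrow> 3 \<Rightarrow> ('a set laurent)^2^2" where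
  "along t c k = (if c = k + 1 then mat2 0 (- x_var t k) (x_inv t k) 0 else mat2 0 (x_var t k) (- x_inv t k) 0)"

definition turn :: "'a set \<Rightarrow> 3 \<Rightarrow> 3 \<Rightarrow> ('a set laurent)^2^2" where
  "turn t c k = (let a = x_var t c * x_inv t k * x_inv t (third c k) in mat2 1 0 (if k = c + 1 then - a else a) 1)"

definition half :: "'a set \<Rightarrow> 3 \<Rightarrow> bool \<Rightarrow> 'a set laurent" where
  "half t k b = y_half_pow (edge \<Sigma> t k) (if b = (shear \<Sigma> (L (edge \<Sigma> t k)) t k = 1) then - 1 else 1)"

text \<open>If the reference orientations disagree across the arc, the gauge changes by the diagonal
  matrix with entries 1 and -1; this puts the minus sign into the lower entry and makes the
  determinant -1. The other reference matrices have determinant 1.\<close>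

definition cross :: "'a set \<Rightarrow> 3 \<Rightarrow> 3 \<Rightarrow> ('a set laurent)^2^2" where
  "cross t c k = mat2 (half t k (c = k + 1)) 0 0
     (if coherent \<Sigma> t k then half t k (c \<noteq> k + 1) else - half t k (c \<noteq> k + 1))"

lemma half_inverse [simp]:
  "half t k b * half t k (\<not> b) = 1" "half t k (\<not> b) * half t k b = 1"
  "half t k True * half t k False = 1" "half t k False * half t k True = 1"
  "half t k b * (half t k (\<not> b) * z) = z" "half t k (\<not> b) * (half t k b * z) = z"
  "half t k True * (half t k False * z) = z" "half t k False * (half t k True * z) = z"
  by (auto simp: half_def)

lemma shear_partner:
  assumes "arc_side t k" "partner \<Sigma> t k = (t', k')"
  shows "shear \<Sigma> l t' k' = (if coherent \<Sigma> t k then shear \<Sigma> l t k else - shear \<Sigma> l t k)"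
proof -
  have p: "(t', k') \<noteq> (t, k)" "partner \<Sigma> t' k' = (t, k)"
    by (rule arc_side_partner[OF assms(1)]; use assms(2) in auto)+
  show ?thesis unfolding shear_def
  proof (rule sum_list_signed)
    fix x :: "'a passage \<times> 'a passage"
    obtain u i j where x: "fst x = (u, i, j)" by (cases "fst x")
    consider "(u, j) = (t, k)" | "(u, j) = (t', k')" | "(u, j) \<noteq> (t, k)" "(u, j) \<noteq> (t', k')" by blast
    then show "(case fst x of (u, i, j) \<Rightarrow> if (u, j) = (t', k') then sz_sign \<Sigma> x
        else if (u, j) = partner \<Sigma> t' k' then if coherent \<Sigma> t' k' then sz_sign \<Sigma> x else - sz_sign \<Sigma> x else 0) =
      (if coherent \<Sigma> t k then case fst x of (u, i, j) \<Rightarrow> if (u, j) = (t, k) then sz_sign \<Sigma> x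
        else if (u, j) = partner \<Sigma> t k then if coherent \<Sigma> t k then sz_sign \<Sigma> x else - sz_sign \<Sigma> x else 0
       else - (case fst x of (u, i, j) \<Rightarrow> if (u, j) = (t, k) then sz_sign \<Sigma> x
        else if (u, j) = partner \<Sigma> t k then if coherent \<Sigma> t k then sz_sign \<Sigma> x else - sz_sign \<Sigma> x else 0))"
      unfolding x p(2) assms(2) coherent_partner[OF assms] prod.case using p(1) by cases auto
  qed
qed

lemma half_partner:
  assumes "arc_side t k" "partner \<Sigma> t k = (t', k')"
  shows "half t' k' b = half t k (b = coherent \<Sigma> t k)"
proof -
  have e: "edge \<Sigma> t' k' = edge \<Sigma> t k"
    by (rule arc_side_partner[OF assms(1)]; use assms(2) in auto)
  show ?thesis
    unfolding half_def e shear_partner[OF assms] using shear_values[OF assms(1)] by auto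
qed

text \<open>Leads from position \<open>(k + 1, k)\<close> to the corresponding position
  \<open>(k + 2, k + 1)\<close> of the next side.\<close>

definition side_turn :: "'a set \<Rightarrow> 3 \<Rightarrow> ('a set laurent)^2^2" where
  "side_turn t k = turn t (k + 2) k ** along t (k + 1) k"

lemma side_turn_eq: "side_turn t k = mat2 0 (- x_var t k) (x_inv t k) (x_var t (k + 2) * x_inv t (k + 1))"
  by (simp add: side_turn_def turn_def along_def Let_def algebra_simps)

text \<open>Transport inside the triangle from position \<open>(k + 1, k)\<close> to position
  \<open>(1, 0)\<close>, by side turns in the cyclic order of the sides. It lets a single fibre
  stand for the whole triangle.\<close>

definition frame :: "'a set \<Rightarrow> 3 \<Rightarrow> ('a set laurent)^2^2" where
  "frame t k = (if k = 0 then mat 1 else if k = 1 then side_turn t 2 ** side_turn t 1 else side_turn t 2)"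

lemma det_side_turn [simp]: "det (side_turn t k) = 1"
  by (simp add: side_turn_eq)

lemma det_frame [simp]: "det (frame t k) = 1"
  by (simp add: frame_def det_mul)

text \<open>A circuit through the six positions of a triangle; its value -1 instead of 1 is why
  transport inside triangles is compared up to sign only.\<close>

lemma hexagon: "side_turn t 2 ** side_turn t 1 ** side_turn t 0 = - mat 1"
proof -
  have "side_turn t 0 = mat2 0 (- x_var t 0) (x_inv t 0) (x_var t 2 * x_inv t 1)"
    "side_turn t 1 = mat2 0 (- x_var t 1) (x_inv t 1) (x_var t 0 * x_inv t 2)"
    "side_turn t 2 = mat2 0 (- x_var t 2) (x_inv t 2) (x_var t 1 * x_inv t 0)"
    using side_turn_eq[of t 0] side_turn_eq[of t "0 + 1", unfolded index3_arith]
      side_turn_eq[of t "0 + 2", unfolded index3_arith] by simp_all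
  then show ?thesis by (simp add: mat_1_eq_mat2 mult_ac)
qed

lemma frame_side_turn: "frame t (k + 1) ** side_turn t k =\<^sub>\<plusminus> frame t k"
  using exhaust_012[of k] hexagon[of t] by (auto simp: frame_def eq_upto_sign_def)

abbreviation frame_inv :: "'a set \<Rightarrow> 3 \<Rightarrow> ('a set laurent)^2^2" where
  "frame_inv t k \<equiv> inverse2 (frame t k)"

lemma frame_inv [simp]: "frame_inv t k ** frame t k = mat 1" "frame t k ** frame_inv t k = mat 1"
  by (simp_all add: inverse2)

lemma frame_inv_cancel [simp]:
  "frame_inv t k ** (frame t k ** A) = A" "frame t k ** (frame_inv t k ** A) = A"
  by (simp_all add: matrix_mul_assoc)

text \<open>Leads across the arc from position \<open>(k + 1, k)\<close> to position
  \<open>(k' + 1, k')\<close> of the partner side \<open>(t', k')\<close>. For coherent triangles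
  that corner of the partner is the far end of the arc, whence the preceding
  \<open>along\<close>.\<close>

definition through :: "'a set \<Rightarrow> 3 \<Rightarrow> ('a set laurent)^2^2" where
  "through t k = (if coherent \<Sigma> t k then cross t (k + 2) k ** along t (k + 1) k else cross t (k + 1) k)"

definition side_matrix :: "'a set \<Rightarrow> 3 \<Rightarrow> ('a set laurent)^2^2" where
  "side_matrix t k = (case partner \<Sigma> t k of (t', k') \<Rightarrow> frame t' k' ** through t k ** frame_inv t k)"

lemma along_along [simp]: "along t (k + 1) k ** along t (k + 2) k = mat 1" "along t (k + 2) k ** along t (k + 1) k = mat 1"
  by (simp_all add: along_def mat_1_eq_mat2)

lemma turn_turn: "turn t (k + 2) k ** turn t (k + 2) (k + 1) = mat 1"
  by (simp add: turn_def mat_1_eq_mat2 Let_def mult_ac)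

text \<open>Crossing an arc and crossing back: the powers of \<open>y_\<tau>\<close> cancel by
  \<open>half_partner\<close>, those of \<open>x_\<tau>\<close> because the path runs along the arc
  twice or not at all.\<close>

lemma through_partner:
  assumes "arc_side t k" "partner \<Sigma> t k = (t', k')"
  shows "through t' k' ** through t k =\<^sub>\<plusminus> mat 1"
proof -
  have e: "edge \<Sigma> t' k' = edge \<Sigma> t k"
    by (rule arc_side_partner[OF assms(1)]; use assms(2) in auto)
  show ?thesis
    by (auto simp: through_def cross_def along_def coherent_partner[OF assms] half_partner[OF assms] e
        mat_1_eq_mat2 eq_upto_sign_def mult_ac)
qed

lemma det_through: "det (through t k) = (if coherent \<Sigma> t k then 1 else - 1)"
  by (simp add: through_def cross_def along_def mult_ac)

lemma det_side_matrix: "det (side_matrix t k) = (if coherent \<Sigma> t k then 1 else - 1)"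
proof -
  have "det (frame_inv t k) * det (frame t k) = det (mat 1 :: ('a set laurent)^2^2)" by (metis det_mul frame_inv(1))
  then have "det (frame_inv t k) = 1" by simp
  then show ?thesis by (simp add: side_matrix_def det_mul det_through split: prod.split)
qed

lemma side_matrix_partner:
  assumes "arc_side t k" "partner \<Sigma> t k = (t', k')"
  shows "side_matrix t' k' ** side_matrix t k =\<^sub>\<plusminus> mat 1"
proof -
  have p: "partner \<Sigma> t' k' = (t, k)" by (rule arc_side_partner[OF assms(1)]; use assms(2) in auto)
  have "side_matrix t' k' ** side_matrix t k = frame t k ** (through t' k' ** through t k) ** frame_inv t k"
    by (simp add: side_matrix_def p assms(2) flip: matrix_mul_assoc)
  also have "\<dots> =\<^sub>\<plusminus> frame t k ** mat 1 ** frame_inv t k"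
    by (intro eq_upto_sign_mult through_partner[OF assms]) auto
  finally show ?thesis by simp
qed

text \<open>Extends \<open>frame\<close> to the other end of a side by going back along that
  side.\<close>

fun pos_frame :: "'a position \<Rightarrow> ('a set laurent)^2^2" where
  "pos_frame (t, c, k) = (if c = k + 1 then frame t k else frame t k ** along t (k + 2) k)"

fun reference_matrix :: "'a position \<Rightarrow> step \<Rightarrow> ('a set laurent)^2^2" where
  "reference_matrix (t, c, k) Turn = turn t c k"
| "reference_matrix (t, c, k) Along = along t c k"
| "reference_matrix (t, c, k) Cross = cross t c k"

text \<open>A change of basis that trivialises, up to sign, the steps inside triangles; each
  crossing becomes the side matrix of its arc, so all data sit on the arcs as in a local system
  given by gluing maps.\<close>

lemma pos_frame_step:
  assumes "is_position \<Sigma> p" "s = Cross \<longrightarrow> edge \<Sigma> (fst p) (snd (snd p)) \<in> arcs \<Sigma>"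
  shows "pos_frame (move \<Sigma> p s) ** reference_matrix p s =\<^sub>\<plusminus>
    (if s = Cross then side_matrix (fst p) (snd (snd p)) else mat 1) ** pos_frame p"
proof -
  obtain t c k where p: "p = (t, c, k)" by (cases p)
  have t: "t \<in> triangles \<Sigma>" and "c \<noteq> k" using assms(1) by (auto simp: p is_position_def)
  then have c: "c = k + 1 \<or> c = k + 2" using index3_cases[of c k] by auto
  show ?thesis
  proof (cases s)
    case Along
    then show ?thesis using c by (auto simp: p simp flip: matrix_mul_assoc)
  next
    case Turn
    from c show ?thesis
    proof
      assume c: "c = k + 2"
      have "frame t (k + 1) ** turn t (k + 2) k = frame t (k + 1) ** side_turn t k ** along t (k + 2) k"
        by (simp add: side_turn_def flip: matrix_mul_assoc)
      also have "\<dots> =\<^sub>\<plusminus> frame t k ** along t (k + 2) k" by (intro eq_upto_sign_mult frame_side_turn) simp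
      finally show ?thesis by (simp add: p Turn c)
    next
      assume c: "c = k + 1"
      define j where "j = k + 2"
      have k: "k = j + 1" by (simp add: j_def)
      have "frame t j ** along t (j + 2) j ** turn t (j + 2) (j + 1) =\<^sub>\<plusminus>
          (frame t (j + 1) ** side_turn t j) ** along t (j + 2) j ** turn t (j + 2) (j + 1)"
        by (intro eq_upto_sign_mult eq_upto_sign_sym[OF frame_side_turn]) simp_all
      also have "\<dots> = frame t (j + 1) ** (turn t (j + 2) j ** (along t (j + 1) j ** along t (j + 2) j) ** turn t (j + 2) (j + 1))"
        by (simp only: side_turn_def matrix_mul_assoc)
      also have "\<dots> = frame t (j + 1)" by (simp add: turn_turn)
      finally show ?thesis by (simp add: p Turn c k)
    qed
  next
    case Cross
    then have side: "arc_side t k" using assms(2) t by (simp add: p arc_side_def)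
    obtain t' k' where pt: "partner \<Sigma> t k = (t', k')" by (cases "partner \<Sigma> t k")
    have e: "edge \<Sigma> t' k' = edge \<Sigma> t k"
      by (rule arc_side_partner[OF side]; use pt in auto)
    have A: "along t' (k' + 2) k' = along t (k + 2) k" "along t' (k' + 1) k' = along t (k + 1) k"
      by (simp_all add: along_def e)
    \<comment> \<open>Going round an arc is trivial up to sign: \<open>Along\<close> may be
      performed before or after \<open>Cross\<close>. This reduces both corners of the side to the
      one used by \<open>through\<close>.\<close>
    have commute: "along t (k + 2) k ** cross t (k + 1) k =\<^sub>\<plusminus> cross t (k + 2) k ** along t (k + 1) k"
      "along t (k + 2) k ** cross t (k + 2) k =\<^sub>\<plusminus> cross t (k + 1) k ** along t (k + 2) k"
      by (auto simp: along_def cross_def eq_upto_sign_def algebra_simps)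
    show ?thesis
    proof (cases "coherent \<Sigma> t k")
      case True
      have "frame t' k' ** (along t (k + 2) k ** cross t (k + 1) k) =\<^sub>\<plusminus> frame t' k' ** (cross t (k + 2) k ** along t (k + 1) k)"
        by (rule eq_upto_sign_mult[OF eq_upto_sign_refl commute(1)])
      then show ?thesis
        using c True by (auto simp: p Cross pt A side_matrix_def through_def simp flip: matrix_mul_assoc)
    next
      case False
      have "frame t' k' ** (along t (k + 2) k ** cross t (k + 2) k) =\<^sub>\<plusminus> frame t' k' ** (cross t (k + 1) k ** along t (k + 2) k)"
        by (rule eq_upto_sign_mult[OF eq_upto_sign_refl commute(2)])
      then show ?thesis
        using c False by (auto simp: p Cross pt A side_matrix_def through_def simp flip: matrix_mul_assoc)
    qed
  qed
qed

text \<open>Change of basis from the given local orientation to the reference gauge; trivial where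
  that orientation is already opposite to the one of the triangle.\<close>

definition gauge :: "int \<Rightarrow> ('a set laurent)^2^2" where
  "gauge w = mat2 1 0 0 (if w = 1 then - 1 else 1)"

lemma gauge_gauge [simp]: "gauge w ** gauge w = mat 1"
  by (simp add: gauge_def mat_1_eq_mat2)

text \<open>A matrix of type 3' is one of type 3 with a nontrivial gauge factor at one end only. The
  choice of \<omega> thus merely changes bases at the positions, and traces of closed paths do not
  see it.\<close>

lemma step_matrix_gauge:
  assumes \<omega>: "local_orientations \<Sigma> \<omega>"
    and p: "is_position \<Sigma> p" "s = Cross \<longrightarrow> edge \<Sigma> (fst p) (snd (snd p)) \<in> arcs \<Sigma>"
  shows "step_matrix \<Sigma> \<omega> L p s =
    gauge (\<omega> (fst (move \<Sigma> p s)) (fst (snd (move \<Sigma> p s)))) ** reference_matrix p s ** gauge (\<omega> (fst p) (fst (snd p)))"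
proof -
  obtain t c k where pe: "p = (t, c, k)" by (cases p)
  have t: "t \<in> triangles \<Sigma>" and c: "c \<noteq> k" using p(1) by (auto simp: pe is_position_def)
  have w: "\<omega> t d = 1 \<or> \<omega> t d = - 1" for d using \<omega> t by (auto simp: local_orientations_def)
  show ?thesis
  proof (cases s)
    case Turn
    then show ?thesis using w[of c] by (cases "k = c + 1"; elim disjE) (simp_all add: pe turn_def gauge_def Let_def)
  next
    case Along
    then show ?thesis using w[of c] w[of "third c k"]
      by (cases "c = k + 1"; elim disjE) (simp_all add: pe along_def gauge_def Let_def)
  next
    case Cross
    then have side: "arc_side t k" using p(2) t by (simp add: pe arc_side_def)
    obtain t' c' k' where m: "move \<Sigma> (t, c, k) Cross = (t', c', k')" "partner \<Sigma> t k = (t', k')" "arc_side t' k'"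
      by (rule move_Cross_cases[OF side c]) blast
    have w': "\<omega> t c = (if coherent \<Sigma> t k then \<omega> t' c' else - \<omega> t' c')"
      using \<omega>[unfolded local_orientations_def, THEN conjunct2, rule_format, of t c k] side c
      unfolding arc_side_def m(1) by simp
    have kc: "k = c + 2 \<longleftrightarrow> c = k + 1" using c index3_cases[of c k] by auto
    \<comment> \<open>Reversing the orientation flips both \<open>clockwise\<close> and
      \<open>b\<close>, so the crossing matrix as such is independent of \<omega>. For incoherent
      triangles exactly one gauge factor is nontrivial and compensates the sign in
      \<open>cross\<close>.\<close>
    have sm: "step_matrix \<Sigma> \<omega> L p s = mat2 (half t k (c = k + 1)) 0 0 (half t k (c \<noteq> k + 1))"
      using w[of c] shear_values[OF side] unfolding insert_iff empty_iff pe Cross step_matrix.simps Let_def kc half_def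
      by (cases "c = k + 1"; elim disjE) (simp_all del: index3_arith(5-))
    show ?thesis unfolding sm using w[of c] w' m(1)
      by (cases "coherent \<Sigma> t k"; elim disjE) (simp_all add: pe Cross cross_def gauge_def del: move.simps)
  qed
qed

end

section \<open>Holonomy of the matrices and of the orientation\<close>

context laminated
begin

definition arc_matrix :: "'a set \<Rightarrow> ('a set laurent)^2^2" where
  "arc_matrix e = (case chosen_side e of (t, k) \<Rightarrow> side_matrix t k)"

definition arc_map :: "'a set \<Rightarrow> ('a set laurent)^2^2 \<Rightarrow> ('a set laurent)^2^2" where
  "arc_map e v = arc_matrix e ** v"

text \<open>The local system of orientations, with fibre the integers: crossing into a triangle of
  opposite reference orientation changes the sign.\<close>

definition arc_sign :: "'a set \<Rightarrow> int \<Rightarrow> int" where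
  "arc_sign e v = (case chosen_side e of (t, k) \<Rightarrow> if coherent \<Sigma> t k then v else - v)"

lemma det_arc_matrix: "det (arc_matrix e) * det (arc_matrix e) = 1"
  by (simp add: arc_matrix_def det_side_matrix split: prod.split)

lemma inv_arc_map: "bij (arc_map e)" "inv (arc_map e) = (\<lambda>v. inverse2 (arc_matrix e) ** v)"
proof -
  let ?h = "\<lambda>v. inverse2 (arc_matrix e) ** v"
  have 1: "?h (arc_map e v) = v" "arc_map e (?h v) = v" for v
    using inverse2[OF det_arc_matrix[of e]] by (simp_all add: arc_map_def matrix_mul_assoc)
  then show "bij (arc_map e)" by (intro o_bij[of ?h]) auto
  show "inv (arc_map e) = ?h" by (rule inv_equality) (use 1 in auto)
qed

lemma inv_arc_sign: "bij (arc_sign e)" "inv (arc_sign e) = arc_sign e"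
proof -
  have 1: "arc_sign e (arc_sign e v) = v" for v by (simp add: arc_sign_def split: prod.split)
  then show "bij (arc_sign e)" by (intro o_bij[of "arc_sign e"]) auto
  show "inv (arc_sign e) = arc_sign e" by (rule inv_equality) (use 1 in auto)
qed

text \<open>The backward direction gets the exact inverse, whereas the side matrices of partner
  sides are inverse only up to sign; this turns projective data into a genuine local system.\<close>

definition holonomy :: "'a set \<Rightarrow> 3 \<Rightarrow> ('a set laurent)^2^2" where
  "holonomy t k = (if chosen_side (edge \<Sigma> t k) = (t, k) then arc_matrix (edge \<Sigma> t k) else inverse2 (arc_matrix (edge \<Sigma> t k)))"

lemma side_map_arc_map: "side_map arc_map t k v = holonomy t k ** v"
  by (simp add: side_map_def holonomy_def inv_arc_map) (simp add: arc_map_def)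

lemma chosen_side_cases:
  assumes "arc_side t k"
  obtains "chosen_side (edge \<Sigma> t k) = (t, k)" | t' k' where "chosen_side (edge \<Sigma> t k) = (t', k')" "partner \<Sigma> t k = (t', k')"
    "chosen_side (edge \<Sigma> t k) \<noteq> (t, k)"
proof -
  obtain u j where uj: "chosen_side (edge \<Sigma> t k) = (u, j)" by (cases "chosen_side (edge \<Sigma> t k)")
  have "u \<in> triangles \<Sigma>" "edge \<Sigma> u j = edge \<Sigma> t k"
    using chosen_side[OF _ uj] assms by (auto simp: arc_side_def)
  then have "(u, j) = (t, k) \<or> partner \<Sigma> t k = (u, j)"
    by (rule_tac arc_side_partner[OF assms]) metis
  then show ?thesis using that uj by metis
qed

lemma holonomy_side_matrix:
  assumes "arc_side t k"
  shows "holonomy t k =\<^sub>\<plusminus> side_matrix t k"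
  using assms
proof (cases rule: chosen_side_cases)
  case 1
  then show ?thesis by (simp add: holonomy_def arc_matrix_def)
next
  case (2 t' k')
  let ?H = "inverse2 (side_matrix t' k')"
  have d: "det (side_matrix t' k') * det (side_matrix t' k') = 1" by (simp add: det_side_matrix)
  have "?H ** (side_matrix t' k' ** side_matrix t k) =\<^sub>\<plusminus> ?H ** mat 1"
    by (rule eq_upto_sign_mult[OF eq_upto_sign_refl side_matrix_partner[OF assms 2(2)]])
  then have "side_matrix t k =\<^sub>\<plusminus> ?H" by (simp add: matrix_mul_assoc inverse2[OF d])
  then show ?thesis using 2 by (simp add: holonomy_def arc_matrix_def eq_upto_sign_sym)
qed

lemma det_holonomy:
  assumes "arc_side t k"
  shows "det (holonomy t k) = (if coherent \<Sigma> t k then 1 else - 1)"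
  using assms
proof (cases rule: chosen_side_cases)
  case 1
  then show ?thesis by (simp add: holonomy_def arc_matrix_def det_side_matrix)
next
  case (2 t' k')
  then show ?thesis
    using coherent_partner[OF assms 2(2)] by (simp add: holonomy_def det_inverse2[OF det_arc_matrix]) (simp add: arc_matrix_def det_side_matrix)
qed

lemma side_map_arc_sign:
  assumes "arc_side t k"
  shows "side_map arc_sign t k v = (if coherent \<Sigma> t k then v else - v)"
  using assms
proof (cases rule: chosen_side_cases)
  case 1
  then show ?thesis by (simp add: side_map_def arc_sign_def)
next
  case (2 t' k')
  then show ?thesis using coherent_partner[OF assms 2(2)] by (simp add: side_map_def inv_arc_sign) (simp add: arc_sign_def)
qed

fun path_holonomy :: "'a position \<Rightarrow> step list \<Rightarrow> ('a set laurent)^2^2" where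
  "path_holonomy p [] = mat 1"
| "path_holonomy p (s # ss) = path_holonomy (move \<Sigma> p s) ss ** (if s = Cross then holonomy (fst p) (snd (snd p)) else mat 1)"

lemma path_map_arc_map: "path_map arc_map p ss v = path_holonomy p ss ** v"
  by (induction ss arbitrary: p v) (auto simp: side_map_arc_map matrix_mul_assoc)

lemma path_map_arc_sign:
  "elementary_path \<Sigma> p ss \<Longrightarrow> path_map arc_sign p ss v = path_map arc_sign p ss 1 * v"
proof (induction ss arbitrary: p v)
  case (Cons s ss)
  have e: "elementary_path \<Sigma> (move \<Sigma> p s) ss" using Cons.prems by simp
  have "s = Cross \<longrightarrow> arc_side (fst p) (snd (snd p))" using Cons.prems by (auto simp: arc_side_def is_position_def)
  then show ?case
    using Cons.IH[OF e, of v] Cons.IH[OF e, of "- v"] Cons.IH[OF e, of "- 1"] by (auto simp: side_map_arc_sign)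
qed simp

text \<open>Both sides collect the same factor at each crossing: 1 for coherent triangles and -1
  otherwise.\<close>

lemma det_path_holonomy:
  "elementary_path \<Sigma> p ss \<Longrightarrow> det (path_holonomy p ss) = of_int (path_map arc_sign p ss 1)"
proof (induction ss arbitrary: p)
  case (Cons s ss)
  have e: "elementary_path \<Sigma> (move \<Sigma> p s) ss" using Cons.prems by simp
  have "s = Cross \<longrightarrow> arc_side (fst p) (snd (snd p))" using Cons.prems by (auto simp: arc_side_def is_position_def)
  then show ?case
    using Cons.IH[OF e] path_map_arc_sign[OF e, of "- 1"]
    by (auto simp: side_map_arc_sign det_mul det_holonomy)
qed simp

fun reference_path_matrix :: "'a position \<Rightarrow> step list \<Rightarrow> ('a set laurent)^2^2" where
  "reference_path_matrix p [] = mat 1"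
| "reference_path_matrix p (s # ss) = reference_path_matrix (move \<Sigma> p s) ss ** reference_matrix p s"

abbreviation pos_gauge :: "('a set \<Rightarrow> 3 \<Rightarrow> int) \<Rightarrow> 'a position \<Rightarrow> ('a set laurent)^2^2" where
  "pos_gauge \<omega> p \<equiv> gauge (\<omega> (fst p) (fst (snd p)))"

lemma path_matrix_gauge:
  assumes "local_orientations \<Sigma> \<omega>"
  shows "elementary_path \<Sigma> p ss \<Longrightarrow>
    path_matrix \<Sigma> \<omega> L p ss = pos_gauge \<omega> (endpoint \<Sigma> p ss) ** reference_path_matrix p ss ** pos_gauge \<omega> p"
proof (induction ss arbitrary: p)
  case Nil
  then show ?case by (simp add: endpoint_def)
next
  case (Cons s ss)
  have e: "is_position \<Sigma> p" "s = Cross \<longrightarrow> edge \<Sigma> (fst p) (snd (snd p)) \<in> arcs \<Sigma>" "elementary_path \<Sigma> (move \<Sigma> p s) ss"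
    using Cons.prems by auto
  let ?q = "move \<Sigma> p s"
  have "path_matrix \<Sigma> \<omega> L p (s # ss) = pos_gauge \<omega> (endpoint \<Sigma> ?q ss) ** reference_path_matrix ?q ss **
      (pos_gauge \<omega> ?q ** pos_gauge \<omega> ?q) ** reference_matrix p s ** pos_gauge \<omega> p"
    unfolding path_matrix.simps Cons.IH[OF e(3)] step_matrix_gauge[OF assms e(1,2)] by (simp only: matrix_mul_assoc)
  then show ?case by (simp add: endpoint_Cons matrix_mul_assoc)
qed

lemma pos_frame_path:
  "elementary_path \<Sigma> p ss \<Longrightarrow>
    pos_frame (endpoint \<Sigma> p ss) ** reference_path_matrix p ss =\<^sub>\<plusminus> path_holonomy p ss ** pos_frame p"
proof (induction ss arbitrary: p)
  case Nil
  then show ?case by (simp add: endpoint_def)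
next
  case (Cons s ss)
  have e: "is_position \<Sigma> p" "s = Cross \<longrightarrow> edge \<Sigma> (fst p) (snd (snd p)) \<in> arcs \<Sigma>" "elementary_path \<Sigma> (move \<Sigma> p s) ss"
    using Cons.prems by auto
  let ?q = "move \<Sigma> p s" and ?S = "if s = Cross then side_matrix (fst p) (snd (snd p)) else mat 1"
  let ?H = "if s = Cross then holonomy (fst p) (snd (snd p)) else mat 1"
  have "s = Cross \<longrightarrow> arc_side (fst p) (snd (snd p))" using e by (auto simp: arc_side_def is_position_def)
  then have H: "?S =\<^sub>\<plusminus> ?H" using holonomy_side_matrix by (simp add: eq_upto_sign_sym)
  have "pos_frame (endpoint \<Sigma> p (s # ss)) ** reference_path_matrix p (s # ss) =
      (pos_frame (endpoint \<Sigma> ?q ss) ** reference_path_matrix ?q ss) ** reference_matrix p s"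
    by (simp add: endpoint_Cons matrix_mul_assoc)
  also have "\<dots> =\<^sub>\<plusminus> (path_holonomy ?q ss ** pos_frame ?q) ** reference_matrix p s"
    by (rule eq_upto_sign_mult[OF Cons.IH[OF e(3)] eq_upto_sign_refl])
  also have "\<dots> = path_holonomy ?q ss ** (pos_frame ?q ** reference_matrix p s)"
    by (simp only: matrix_mul_assoc)
  also have "\<dots> =\<^sub>\<plusminus> path_holonomy ?q ss ** (?S ** pos_frame p)"
    by (rule eq_upto_sign_mult[OF eq_upto_sign_refl pos_frame_step[OF e(1,2)]])
  also have "\<dots> =\<^sub>\<plusminus> path_holonomy ?q ss ** (?H ** pos_frame p)"
    by (rule eq_upto_sign_mult[OF eq_upto_sign_refl eq_upto_sign_mult[OF H eq_upto_sign_refl]])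
  also have "\<dots> = path_holonomy p (s # ss) ** pos_frame p"
    by (simp only: path_holonomy.simps matrix_mul_assoc)
  finally show ?case .
qed

text \<open>On a closed path the gauge and the frame at the end are those at the start, so they only
  conjugate and drop out of the trace.\<close>

lemma trace_path_matrix:
  assumes "local_orientations \<Sigma> \<omega>" "elementary_path \<Sigma> p ss" "endpoint \<Sigma> p ss = p"
  shows "trace (path_matrix \<Sigma> \<omega> L p ss) =\<^sub>\<plusminus> trace (path_holonomy p ss)"
proof -
  let ?F = "pos_frame p" and ?N = "reference_path_matrix p ss" and ?W = "path_holonomy p ss"
  have "det ?F = 1" by (cases p) (simp add: det_mul along_def)
  then have F: "inverse2 ?F ** ?F = mat 1" "?F ** inverse2 ?F = mat 1" by (simp_all add: inverse2)
  have "trace (path_matrix \<Sigma> \<omega> L p ss) = trace ?N"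
    unfolding path_matrix_gauge[OF assms(1,2)] assms(3) by (rule trace_conjugate) simp
  also have "\<dots> = trace (?F ** ?N ** inverse2 ?F)" by (rule trace_conjugate[OF F(1), symmetric])
  also have "\<dots> =\<^sub>\<plusminus> trace (?W ** ?F ** inverse2 ?F)"
    by (rule eq_upto_sign_trace[OF eq_upto_sign_mult[OF pos_frame_path[OF assms(2), unfolded assms(3)] eq_upto_sign_refl]])
  also have "\<dots> = trace ?W" by (simp add: F(2) flip: matrix_mul_assoc)
  finally show ?thesis .
qed

sublocale hol: local_system X patches patch "glue_map arc_map"
  by (rule local_system_glue_map[OF inv_arc_map(1)])

sublocale sgn: local_system X patches patch "glue_map arc_sign"
  by (rule local_system_glue_map[OF inv_arc_sign(1)])

lemma hol_transport_mult: "hol.transport \<gamma> v w \<Longrightarrow> hol.transport \<gamma> (v ** A) (w ** A)"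
proof (rule hol.transport_map[of "\<lambda>v. v ** A"])
  show "glue_map arc_map i x (v ** A) = glue_map arc_map i x v ** A" for i x v
    by (cases i) (auto simp: arc_map_def matrix_mul_assoc)
qed

lemma sgn_transport_mult: "sgn.transport \<gamma> v w \<Longrightarrow> sgn.transport \<gamma> (a * v) (a * w)"
proof (rule sgn.transport_map[of "\<lambda>v. a * v"])
  show "glue_map arc_sign i x (a * v) = a * glue_map arc_sign i x v" for i x v
    by (cases i) (auto simp: arc_sign_def split: prod.split)
qed

text \<open>A free homotopy moves the base point along \<open>r\<close>. Transport along
  \<open>r\<close> is left multiplication by a matrix \<Phi>, since it commutes with right
  multiplication, and \<Phi> intertwines the two holonomies.\<close>

lemma holonomy_conjugate:
  assumes el: "elementary_path \<Sigma> p ss" and hom: "homotopic_loops X \<beta> (path_curve \<Sigma> p ss)" and T: "hol.transport \<beta> (mat 1) T"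
  obtains \<Phi> \<Psi> where "\<Psi> ** \<Phi> = mat 1" "\<Phi> ** \<Psi> = mat 1" "\<Phi> ** T ** \<Psi> = path_holonomy p ss"
proof -
  note f = path_curve_facts[OF el]
  obtain r where r: "path r" "path_image r \<subseteq> X" and tr: "\<And>v w v' w'. hol.transport \<beta> v w \<Longrightarrow> hol.transport r v v' \<Longrightarrow>
    hol.transport r w w' \<Longrightarrow> hol.transport (path_curve \<Sigma> p ss) v' w'"
    using hol.transport_homotopic_loops[OF hom] by blast
  obtain \<Phi> where \<Phi>: "hol.transport r (mat 1) \<Phi>" using hol.transport_exists(1)[OF r] by blast
  obtain \<Psi> where \<Psi>: "hol.transport r \<Psi> (mat 1)" using hol.transport_exists(2)[OF r] by blast
  have 1: "\<Phi> ** \<Psi> = mat 1"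
    using hol.transport_unique[OF r \<Psi> hol_transport_mult[OF \<Phi>, of \<Psi>]] by simp
  have 2: "\<Psi> ** \<Phi> = mat 1"
    using hol.transport_unique[OF r \<Phi> hol_transport_mult[OF \<Psi>, of \<Phi>]] by simp
  have "hol.transport (path_curve \<Sigma> p ss) \<Phi> (\<Phi> ** T)"
    using tr[OF T \<Phi> hol_transport_mult[OF \<Phi>, of T, simplified]] .
  moreover have "hol.transport (path_curve \<Sigma> p ss) \<Phi> (path_holonomy p ss ** \<Phi>)"
    using transport_path_curve[where G = arc_map and v = \<Phi>, OF inv_arc_map(1) el] by (simp add: path_map_arc_map)
  ultimately have "\<Phi> ** T = path_holonomy p ss ** \<Phi>"
    using hol.transport_unique[OF f(1,2)] by blast
  then have "\<Phi> ** T ** \<Psi> = path_holonomy p ss" using 1 by (simp flip: matrix_mul_assoc)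
  then show ?thesis using that[OF 2 1] by blast
qed

text \<open>The fibre is commutative, so conjugation by the transport \<open>b\<close> along the
  track of the base point cancels.\<close>

lemma sgn_transport_homotopic:
  assumes el: "elementary_path \<Sigma> p ss" and hom: "homotopic_loops X \<beta> (path_curve \<Sigma> p ss)" and T: "sgn.transport \<beta> 1 a"
  shows "path_map arc_sign p ss 1 = a"
proof -
  note f = path_curve_facts[OF el]
  obtain r where r: "path r" "path_image r \<subseteq> X" and tr: "\<And>v w v' w'. sgn.transport \<beta> v w \<Longrightarrow> sgn.transport r v v' \<Longrightarrow>
    sgn.transport r w w' \<Longrightarrow> sgn.transport (path_curve \<Sigma> p ss) v' w'"
    using sgn.transport_homotopic_loops[OF hom] by blast
  obtain b where b: "sgn.transport r 1 b" using sgn.transport_exists(1)[OF r] by blast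
  have "b \<noteq> 0"
    using sgn.transport_unique[OF r b sgn_transport_mult[OF b, of 0]] by auto
  have "sgn.transport (path_curve \<Sigma> p ss) b (a * b)"
    using tr[OF T b] sgn_transport_mult[OF b, of a] by simp
  moreover have "sgn.transport (path_curve \<Sigma> p ss) b (path_map arc_sign p ss b)"
    using transport_path_curve[where G = arc_sign and v = b, OF inv_arc_sign(1) el] .
  ultimately have "path_map arc_sign p ss b = a * b" using sgn.transport_unique[OF f(1,2)] by blast
  then show ?thesis using path_map_arc_sign[OF el, of b] \<open>b \<noteq> 0\<close> by simp
qed

end

section \<open>One-sided curves reverse the orientation\<close>

lemma (in local_system) flat_invariant:
  assumes K: "connected K" "continuous_on K f" "f ` K \<subseteq> X" and flat: "flat K f \<sigma>"
    and A: "\<And>i x v. i \<in> I \<Longrightarrow> x \<in> U i \<Longrightarrow> s i x v \<in> A \<longleftrightarrow> v \<in> A"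
    and ab: "a \<in> K" "\<sigma> a \<in> A" "b \<in> K"
  shows "\<sigma> b \<in> A"
proof (rule connected_induction_simple[OF K(1) ab(1,3), of "\<lambda>z. \<sigma> z \<in> A"])
  fix z assume z: "z \<in> K"
  then obtain i where i: "i \<in> I" "f z \<in> U i" using cover K(3) by blast
  have "\<forall>\<^sub>F w in at z within K. f w \<in> U i \<and> s i (f w) (\<sigma> w) = s i (f z) (\<sigma> z)"
    using eventually_in_U[OF K(2) z K(3) i] flat z i by (simp add: flat_def eventually_conj_iff)
  then obtain S where S: "open S" "z \<in> S" "\<And>w. w \<in> S \<Longrightarrow> w \<noteq> z \<Longrightarrow> w \<in> K \<Longrightarrow>
      f w \<in> U i \<and> s i (f w) (\<sigma> w) = s i (f z) (\<sigma> z)"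
    unfolding eventually_at_topological by blast
  have "\<sigma> w \<in> A \<longleftrightarrow> \<sigma> z \<in> A" if "w \<in> S \<inter> K" for w
  proof (cases "w = z")
    case False
    then have "f w \<in> U i" "s i (f w) (\<sigma> w) = s i (f z) (\<sigma> z)" using S(3) that by auto
    then show ?thesis using A[OF i(1), of "f w" "\<sigma> w"] A[OF i, of "\<sigma> z"] by metis
  qed simp
  then have "\<forall>x\<in>K \<inter> S. \<forall>y\<in>K \<inter> S. \<sigma> x \<in> A \<longrightarrow> \<sigma> y \<in> A" by blast
  moreover have "openin (top_of_set K) (K \<inter> S)" using S(1) by (rule openin_open_Int)
  ultimately show "\<exists>T. openin (top_of_set K) T \<and> z \<in> T \<and> (\<forall>x\<in>T. \<forall>y\<in>T. \<sigma> x \<in> A \<longrightarrow> \<sigma> y \<in> A)"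
    using S(2) z by blast
qed (use ab in auto)

text \<open>Around every point of \<open>C\<close> a ball is chosen on which patches and coordinates
  behave uniformly. On balls of half the radius the extension does not depend on the centre: of two
  overlapping ones, the full ball of larger radius contains the other centre. The invariant set
  \<open>A\<close> later keeps the values within 1 and -1.\<close>

lemma flat_extends_to_nbhd:
  fixes X :: "'a::metric_space set"
  assumes ls: "local_system X I U s" and fin: "finite I" and C: "C \<subseteq> X"
    and flat: "local_system.flat I U s C (\<lambda>x. x) \<tau>"
    and A: "\<And>i x v. i \<in> I \<Longrightarrow> x \<in> U i \<Longrightarrow> s i x v \<in> A \<longleftrightarrow> v \<in> A" "\<And>x. x \<in> C \<Longrightarrow> \<tau> x \<in> A"
  obtains N \<tau>' where "openin (top_of_set X) N" "C \<subseteq> N" "local_system.flat I U s N (\<lambda>x. x) \<tau>'" "\<And>y. y \<in> N \<Longrightarrow> \<tau>' y \<in> A"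
proof -
  interpret local_system X I U s by fact
  define Q where "Q = (\<lambda>x j r. j \<in> I \<and> x \<in> U j \<and> r > 0 \<and>
      (\<forall>i\<in>I. x \<in> U i \<longrightarrow> (\<forall>y\<in>X. dist y x < r \<longrightarrow> y \<in> U i)) \<and>
      (\<forall>i\<in>I. \<forall>l\<in>I. x \<in> U i \<longrightarrow> x \<in> U l \<longrightarrow> (\<forall>y\<in>X. dist y x < r \<longrightarrow> (\<forall>v w. s i y v = s i x w \<longrightarrow> s l y v = s l x w))) \<and>
      (\<forall>i\<in>I. x \<in> U i \<longrightarrow> (\<forall>y\<in>C. dist y x < r \<longrightarrow> s i y (\<tau> y) = s i x (\<tau> x))))"
  have "\<exists>j r. Q x j r" if x: "x \<in> C" for x
  proof -
    have xX: "x \<in> X" using x C by blast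
    obtain j where j: "j \<in> I" "x \<in> U j" using cover[OF xX] by blast
    let ?I = "{i \<in> I. x \<in> U i}"
    have 1: "\<forall>\<^sub>F y in at x within X. \<forall>i\<in>?I. y \<in> U i"
      by (rule eventually_ball_finite) (use fin eventually_in_U[of X "\<lambda>x. x", OF _ xX] in auto)
    have 2: "\<forall>\<^sub>F y in at x within X. \<forall>i\<in>?I. \<forall>l\<in>?I. \<forall>v w. s i y v = s i x w \<longrightarrow> s l y v = s l x w"
      by (intro eventually_ball_finite ballI) (use fin transition in auto)
    have 3: "\<forall>\<^sub>F y in at x within C. \<forall>i\<in>?I. s i y (\<tau> y) = s i x (\<tau> x)"
      by (rule eventually_ball_finite) (use fin flat x in \<open>auto simp: flat_def\<close>)
    obtain d1 where d1: "d1 > 0" "\<And>y. y \<in> X \<Longrightarrow> y \<noteq> x \<Longrightarrow> dist y x < d1 \<Longrightarrow> \<forall>i\<in>?I. y \<in> U i"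
      using 1 unfolding eventually_at by blast
    obtain d2 where d2: "d2 > 0" "\<And>y. y \<in> X \<Longrightarrow> y \<noteq> x \<Longrightarrow> dist y x < d2 \<Longrightarrow>
        \<forall>i\<in>?I. \<forall>l\<in>?I. \<forall>v w. s i y v = s i x w \<longrightarrow> s l y v = s l x w"
      using 2 unfolding eventually_at by blast
    obtain d3 where d3: "d3 > 0" "\<And>y. y \<in> C \<Longrightarrow> y \<noteq> x \<Longrightarrow> dist y x < d3 \<Longrightarrow> \<forall>i\<in>?I. s i y (\<tau> y) = s i x (\<tau> x)"
      using 3 unfolding eventually_at by blast
    let ?r = "min d1 (min d2 d3)"
    have p1: "y \<in> U i" if "i \<in> I" "x \<in> U i" "y \<in> X" "dist y x < ?r" for i y
      using that d1(2)[of y] by (cases "y = x") auto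
    have p2: "s l y v = s l x w" if "i \<in> I" "l \<in> I" "x \<in> U i" "x \<in> U l" "y \<in> X" "dist y x < ?r" "s i y v = s i x w" for i l y v w
    proof (cases "y = x")
      case True
      then show ?thesis using that s_inj by metis
    next
      case False
      have "dist y x < d2" using that(6) by simp
      from d2(2)[OF that(5) False this] show ?thesis using that by blast
    qed
    have p3: "s i y (\<tau> y) = s i x (\<tau> x)" if "i \<in> I" "x \<in> U i" "y \<in> C" "dist y x < ?r" for i y
      using that d3(2)[of y] by (cases "y = x") auto
    have p0: "?r > 0" using d1(1) d2(1) d3(1) by simp
    show ?thesis unfolding Q_def
    proof (intro exI[of _ j] exI[of _ ?r] conjI ballI allI impI)
      show "j \<in> I" "x \<in> U j" "?r > 0" by (rule j p0)+
    qed (fact p1, rule p2, assumption+, fact p3)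
  qed
  then obtain j r where Q: "\<And>x. x \<in> C \<Longrightarrow> Q x (j x) (r x)" by metis
  have jr: "j x \<in> I" "x \<in> U (j x)" "r x > 0" if "x \<in> C" for x
    using Q[OF that] by (simp_all add: Q_def)
  have inU: "y \<in> U i" if "x \<in> C" "i \<in> I" "x \<in> U i" "y \<in> X" "dist y x < r x" for x i y
    using Q[OF that(1)] that(2-) unfolding Q_def by blast
  have trans: "s l y v = s l x w" if "x \<in> C" "i \<in> I" "l \<in> I" "x \<in> U i" "x \<in> U l" "y \<in> X" "dist y x < r x"
    "s i y v = s i x w" for x i l y v w
    using Q[OF that(1)] that(2-) unfolding Q_def by blast
  have const: "s i y (\<tau> y) = s i x (\<tau> x)" if "x \<in> C" "i \<in> I" "x \<in> U i" "y \<in> C" "dist y x < r x" for x i y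
    using Q[OF that(1)] that(2-) unfolding Q_def by blast
  define N where "N = {y \<in> X. \<exists>x\<in>C. dist y x < r x / 2}"
  define c where "c = (\<lambda>y. SOME x. x \<in> C \<and> dist y x < r x / 2)"
  define \<tau>' where "\<tau>' = (\<lambda>y. inv (s (j (c y)) y) (s (j (c y)) (c y) (\<tau> (c y))))"
  have c: "c y \<in> C" "dist y (c y) < r (c y) / 2" if "y \<in> N" for y
    using someI_ex[of "\<lambda>x. x \<in> C \<and> dist y x < r x / 2"] that by (auto simp: N_def c_def)
  have c': "y \<in> U (j (c y))" "s (j (c y)) y (\<tau>' y) = s (j (c y)) (c y) (\<tau> (c y))" if "y \<in> N" for y
  proof -
    have "dist y (c y) < r (c y)" using c[OF that] jr(3)[OF c(1)[OF that]] by simp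
    then show u: "y \<in> U (j (c y))"
      using inU[OF c(1)[OF that] jr(1)[OF c(1)[OF that]] jr(2)[OF c(1)[OF that]]] that by (simp add: N_def)
    show "s (j (c y)) y (\<tau>' y) = s (j (c y)) (c y) (\<tau> (c y))"
      unfolding \<tau>'_def using bij_s[OF jr(1)[OF c(1)[OF that]] u] by (simp add: bij_is_surj surj_f_inv_f)
  qed
  have key: "s (j x) y (\<tau>' y) = s (j x) x (\<tau> x)" if x: "x \<in> C" "y \<in> X" "dist y x < r x / 2" for x y
  proof -
    have y: "y \<in> N" using x by (auto simp: N_def)
    let ?c = "c y"
    note cy = c[OF y] and jc = jr[OF c(1)[OF y]] and jx = jr[OF x(1)]
    have d: "dist y x < r x" "dist y ?c < r ?c" using x(3) jx(3) cy(2) jc(3) by simp_all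
    have cX: "?c \<in> X" "x \<in> X" using cy(1) x(1) C by auto
    show ?thesis
    proof (cases "r ?c \<le> r x")
      case True
      have "dist ?c x < r x" using dist_triangle3[of ?c x y] x(3) cy(2) True by linarith
      then have u: "?c \<in> U (j x)" "s (j x) ?c (\<tau> ?c) = s (j x) x (\<tau> x)"
        using inU[OF x(1) jx(1,2) cX(1)] const[OF x(1) jx(1,2) cy(1)] by auto
      have "s (j x) y (\<tau>' y) = s (j x) ?c (\<tau> ?c)"
        by (rule trans[OF cy(1) jc(1) jx(1) jc(2) u(1) x(2) d(2) c'(2)[OF y]])
      then show ?thesis using u(2) by simp
    next
      case False
      have "dist x ?c < r ?c" using dist_triangle3[of x ?c y] x(3) cy(2) False by linarith
      then have u: "x \<in> U (j ?c)" "s (j ?c) x (\<tau> x) = s (j ?c) ?c (\<tau> ?c)"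
        using inU[OF cy(1) jc(1,2) cX(2)] const[OF cy(1) jc(1,2) x(1)] by auto
      have "s (j ?c) y (\<tau>' y) = s (j ?c) x (\<tau> x)" using c'(2)[OF y] u(2) by simp
      then show ?thesis by (rule trans[OF x(1) jc(1) jx(1) u(1) jx(2) x(2) d(1)])
    qed
  qed
  have "openin (top_of_set X) N"
  proof -
    have "N = X \<inter> (\<Union>x\<in>C. ball x (r x / 2))" by (auto simp: N_def dist_commute)
    then show ?thesis by (simp add: openin_open_Int open_UN)
  qed
  moreover have "C \<subseteq> N"
  proof
    fix x assume x: "x \<in> C"
    then have "dist x x < r x / 2" using jr(3) by simp
    then show "x \<in> N" unfolding N_def using x C by blast
  qed
  moreover have "flat N (\<lambda>x. x) \<tau>'"
  proof (rule flatI)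
    fix z assume z: "z \<in> N"
    let ?c = "c z"
    have "\<forall>\<^sub>F w in at z within N. s (j ?c) w (\<tau>' w) = s (j ?c) z (\<tau>' z)"
      unfolding eventually_at_topological
    proof (intro exI conjI ballI impI)
      show "open (ball ?c (r ?c / 2))" by simp
      show "z \<in> ball ?c (r ?c / 2)" using c(2)[OF z] by (simp add: dist_commute)
      fix w assume "w \<in> N" "w \<in> ball ?c (r ?c / 2)"
      then show "s (j ?c) w (\<tau>' w) = s (j ?c) z (\<tau>' z)"
        using key[OF c(1)[OF z], of w] key[OF c(1)[OF z], of z] c(2)[OF z] z by (simp add: N_def dist_commute)
    qed
    then show "\<exists>i\<in>I. z \<in> U i \<and> (\<forall>\<^sub>F w in at z within N. s i w (\<tau>' w) = s i z (\<tau>' z))"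
      using jr(1)[OF c(1)[OF z]] c'(1)[OF z] by blast
  qed (auto simp: N_def)
  moreover have "\<tau>' y \<in> A" if "y \<in> N" for y
    using A(1)[OF jr(1)[OF c(1)[OF that]] c'(1)[OF that], of "\<tau>' y"] A(1)[OF jr(1,2)[OF c(1)[OF that]], of "\<tau> (c y)"]
      A(2)[OF c(1)[OF that]] c'(2)[OF that] by simp
  ultimately show ?thesis by (rule that)
qed

text \<open>Flatness along the parameter must become flatness on the image as a subset of
  \<open>X\<close>, where points with distant parameters may be close. Compactness of the interval
  keeps the image of all unsuitable parameters away from \<open>x\<close>.\<close>

lemma flat_on_path_image:
  fixes X :: "'a::metric_space set"
  assumes ls: "local_system X I U s" and \<alpha>: "path \<alpha>" "path_image \<alpha> \<subseteq> X"
    and flat: "local_system.flat I U s {0..1} \<alpha> \<sigma>"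
    and inj: "\<And>z w. z \<in> {0..1} \<Longrightarrow> w \<in> {0..1} \<Longrightarrow> \<alpha> z = \<alpha> w \<Longrightarrow> \<sigma> z = \<sigma> w"
  obtains \<tau> where "local_system.flat I U s (path_image \<alpha>) (\<lambda>x. x) \<tau>" "\<And>z. z \<in> {0..1} \<Longrightarrow> \<tau> (\<alpha> z) = \<sigma> z"
proof -
  interpret local_system X I U s by fact
  define \<tau> where "\<tau> = (\<lambda>x. \<sigma> (SOME z. z \<in> {0..1} \<and> \<alpha> z = x))"
  have \<tau>: "\<tau> (\<alpha> z) = \<sigma> z" if "z \<in> {0..1}" for z
    using someI[of "\<lambda>w. w \<in> {0..1} \<and> \<alpha> w = \<alpha> z" z] that inj unfolding \<tau>_def by blast
  have cont: "continuous_on {0..1} \<alpha>" using \<alpha>(1) by (simp add: path_def)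
  have im: "\<alpha> ` {0..1} \<subseteq> X" using \<alpha>(2) by (simp add: path_image_def)
  have "flat (path_image \<alpha>) (\<lambda>x. x) \<tau>"
    unfolding flat_def
  proof (intro ballI impI)
    fix x i assume x: "x \<in> path_image \<alpha>" and i: "i \<in> I" "x \<in> U i"
    \<comment> \<open>All parameters with the coordinate of \<open>x\<close>, not just those near
      one preimage: a closed curve passes its base point at both ends.\<close>
    define G where "G = {z \<in> {0..1}. \<alpha> z \<in> U i \<and> s i (\<alpha> z) (\<sigma> z) = s i x (\<tau> x)}"
    have "openin (top_of_set {0..1}) G"
    proof (subst openin_subopen, intro ballI)
      fix z assume z: "z \<in> G"
      then have z': "z \<in> {0..1}" "\<alpha> z \<in> U i" "s i (\<alpha> z) (\<sigma> z) = s i x (\<tau> x)" by (auto simp: G_def)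
      have "\<forall>\<^sub>F w in at z within {0..1}. \<alpha> w \<in> U i \<and> s i (\<alpha> w) (\<sigma> w) = s i (\<alpha> z) (\<sigma> z)"
      proof (rule eventually_conj[OF eventually_in_U[OF cont z'(1) im i(1) z'(2)]])
        show "\<forall>\<^sub>F w in at z within {0..1}. s i (\<alpha> w) (\<sigma> w) = s i (\<alpha> z) (\<sigma> z)"
          using flat z'(1,2) i(1) unfolding flat_def by blast
      qed
      then obtain S where S: "open S" "z \<in> S" "\<And>w. w \<in> S \<Longrightarrow> w \<noteq> z \<Longrightarrow> w \<in> {0..1} \<Longrightarrow>
          \<alpha> w \<in> U i \<and> s i (\<alpha> w) (\<sigma> w) = s i (\<alpha> z) (\<sigma> z)"
        unfolding eventually_at_topological by blast
      have "{0..1} \<inter> S \<subseteq> G"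
      proof
        fix w assume w: "w \<in> {0..1} \<inter> S"
        then show "w \<in> G" using S(3)[of w] z z' by (cases "w = z") (auto simp: G_def)
      qed
      then show "\<exists>T. openin (top_of_set {0..1}) T \<and> z \<in> T \<and> T \<subseteq> G"
        using S(1,2) z'(1) openin_open_Int by blast
    qed
    then have "closedin (top_of_set {0..1}) ({0..1} - G)" by (intro closedin_diff) auto
    then have "compact ({0..1} - G)" using closedin_compact compact_Icc by blast
    then have "compact (\<alpha> ` ({0..1} - G))"
      by (rule compact_continuous_image[rotated]) (use cont in \<open>auto intro: continuous_on_subset\<close>)
    then have "open (- (\<alpha> ` ({0..1} - G)))" using compact_imp_closed by blast
    moreover have "x \<in> - (\<alpha> ` ({0..1} - G))"
      using i \<tau> by (auto simp: G_def)
    moreover have "s i y (\<tau> y) = s i x (\<tau> x)" if y: "y \<in> - (\<alpha> ` ({0..1} - G))" "y \<in> path_image \<alpha>" for y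
    proof -
      obtain z where z: "z \<in> {0..1}" "y = \<alpha> z" using y(2) by (auto simp: path_image_def)
      then have "z \<in> G" using y(1) by blast
      then show ?thesis using \<tau>[OF z(1)] z(2) by (simp add: G_def)
    qed
    ultimately show "\<forall>\<^sub>F y in at x within path_image \<alpha>. s i y (\<tau> y) = s i x (\<tau> x)"
      unfolding eventually_at_topological by blast
  qed
  then show ?thesis using that \<tau> by blast
qed

lemma continuous_on_locally_constant:
  assumes "\<And>z. z \<in> K \<Longrightarrow> \<forall>\<^sub>F w in at z within K. f w = f z"
  shows "continuous_on K f"
  unfolding continuous_on_def using assms tendsto_eventually by fast

lemma eventually_openin:
  assumes "openin (top_of_set S) A" "z \<in> A" "K \<subseteq> S"
  shows "\<forall>\<^sub>F w in at z within K. w \<in> A"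
proof -
  obtain W where "open W" "A = S \<inter> W" using assms(1) unfolding openin_open by blast
  with assms(2,3) show ?thesis unfolding eventually_at_topological by blast
qed

context laminated
begin

lemma glue_map_arc_sign: "glue_map arc_sign i x v = v \<or> glue_map arc_sign i x v = - v"
  by (cases i) (auto simp: arc_sign_def split: prod.split)

text \<open>On the open triangles the sign is an orientation as it stands. On an arc \<tau> is
  measured from the front only, so the value at a point of a side is replaced by the limit from
  inside the triangle to which the side belongs.\<close>

lemma orientable_on_flat_sign:
  assumes N: "N \<subseteq> X" and flat: "sgn.flat N (\<lambda>x. x) \<tau>" and \<tau>: "\<And>y. y \<in> N \<Longrightarrow> \<tau> y \<in> {1, -1}"
  shows "orientable_on \<Sigma> N"
proof -
  define b where "b = (\<lambda>e x. glue_map arc_sign (Inr e) x (\<tau> x))"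
  \<comment> \<open>\<open>b\<close> equals \<tau> behind the arc and differs from it on the front
    by the gluing sign, and it is locally constant across the arc. Undoing the sign on the chosen
    side yields the value of \<tau> inside \<open>t\<close> on either side.\<close>
  define r where "r = (\<lambda>t k x. if chosen_side (edge \<Sigma> t k) = (t, k) \<and> \<not> coherent \<Sigma> t k then - b (edge \<Sigma> t k) x else b (edge \<Sigma> t k) x)"
  define val where "val = (\<lambda>t p. if \<exists>k. arc_side t k \<and> p \<in> region k then r t (SOME k. arc_side t k \<and> p \<in> region k) (chart \<Sigma> t p)
    else \<tau> (chart \<Sigma> t p))"
  have val_region: "val t p = r t k (chart \<Sigma> t p)" if "arc_side t k" "p \<in> region k" for t k p
  proof -
    have "(SOME k. arc_side t k \<and> p \<in> region k) = k" using that region_disjoint by (intro some_equality) auto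
    then show ?thesis using that by (auto simp: val_def)
  qed
  have val_open: "val t p = \<tau> (chart \<Sigma> t p)" if "p \<in> open_simplex3" for t p
  proof (cases "\<exists>k. arc_side t k \<and> p \<in> region k")
    case True
    then obtain k where k: "arc_side t k" "p \<in> region k" by blast
    show ?thesis
      unfolding val_region[OF k] r_def b_def using front_iff[OF k that] by (auto simp: arc_sign_def)
  next
    case False
    then show ?thesis unfolding val_def by (rule if_not_P)
  qed
  define \<epsilon> :: "'a set \<Rightarrow> real^3 \<Rightarrow> real" where "\<epsilon> = (\<lambda>t p. of_int (val t p))"
  have "orientation_on \<Sigma> N \<epsilon>"
    unfolding orientation_on_def
  proof (intro conjI ballI allI impI)
    fix t assume t: "t \<in> triangles \<Sigma>"
    let ?K = "{p \<in> simplex3. chart \<Sigma> t p \<in> N}"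
    have contK: "continuous_on ?K (chart \<Sigma> t)" using chart_facts(1)[OF t] by (rule continuous_on_subset) auto
    have flatK: "sgn.flat ?K ((\<lambda>x. x) \<circ> chart \<Sigma> t) (\<tau> \<circ> chart \<Sigma> t)"
      by (rule sgn.flat_compose[OF flat contK]) auto
    have K: "?K \<subseteq> cell t" "?K \<subseteq> simplex3" using N by (auto simp: cell_def)
    show "continuous_on ?K (\<epsilon> t)"
    proof (rule continuous_on_locally_constant)
      fix p assume p: "p \<in> ?K"
      then have "p \<in> cell t" using K by blast
      with t show "\<forall>\<^sub>F q in at p within ?K. \<epsilon> t q = \<epsilon> t p"
      proof (cases rule: cell_cases)
        case 1
        have "Inl t \<in> patches" "chart \<Sigma> t p \<in> patch (Inl t)" using t open_in_cell(2)[OF t 1] by (auto simp: patches_def)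
        then have "\<forall>\<^sub>F q in at p within ?K. \<tau> (chart \<Sigma> t q) = \<tau> (chart \<Sigma> t p)"
          using flatK p unfolding sgn.flat_def by fastforce
        moreover have "\<forall>\<^sub>F q in at p within ?K. q \<in> open_simplex3"
          by (rule eventually_openin[OF openin_open_simplex3 1 K(2)])
        ultimately show ?thesis by eventually_elim (simp add: \<epsilon>_def val_open 1)
      next
        case (2 k s)
        let ?e = "edge \<Sigma> t k"
        have pr: "p \<in> region k" using side_point_in_region 2 by simp
        have "Inr ?e \<in> patches" "chart \<Sigma> t p \<in> patch (Inr ?e)"
          using 2(4) chart_in_edge_nbhd[OF 2(4) pr] by (auto simp: patches_def arc_side_def)
        then have "\<forall>\<^sub>F q in at p within ?K. b ?e (chart \<Sigma> t q) = b ?e (chart \<Sigma> t p)"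
          using flatK p unfolding sgn.flat_def b_def by fastforce
        moreover have "\<forall>\<^sub>F q in at p within ?K. q \<in> region k"
          by (rule eventually_openin[OF openin_region pr K(2)])
        ultimately show ?thesis by eventually_elim (simp add: \<epsilon>_def val_region[OF 2(4)] pr r_def)
      qed
    qed
    show "\<epsilon> t p \<in> {1, -1}" if "p \<in> simplex3" "chart \<Sigma> t p \<in> N" for p
    proof -
      have "val t p \<in> {\<tau> (chart \<Sigma> t p), - \<tau> (chart \<Sigma> t p)}"
        using glue_map_arc_sign unfolding val_def r_def b_def by (smt (verit) insertCI minus_minus)
      then show ?thesis using \<tau>[OF that(2)] by (auto simp: \<epsilon>_def)
    qed
  next
    fix t k s assume t: "t \<in> triangles \<Sigma>" and s: "s \<in> {0..1}"
      and h: "edge \<Sigma> t k \<in> arcs \<Sigma> \<and> chart \<Sigma> t (side_point k s) \<in> N"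
    have side: "arc_side t k" using t h by (simp add: arc_side_def)
    obtain t' k' where pt: "partner \<Sigma> t k = (t', k')" "arc_side t' k'" "edge \<Sigma> t' k' = edge \<Sigma> t k" "(t', k') \<noteq> (t, k)"
      and sides: "\<And>u j. u \<in> triangles \<Sigma> \<Longrightarrow> edge \<Sigma> u j = edge \<Sigma> t k \<Longrightarrow> (u, j) = (t, k) \<or> (u, j) = (t', k')"
      by (rule arc_side_partner[OF side]) blast
    have "s \<noteq> 0" "s \<noteq> 1"
      using h N side_point_corner[of k] marked_notin_X[OF chart_facts(4)[OF t, of "k + 1"]]
        marked_notin_X[OF chart_facts(4)[OF t, of "k + 2"]] by auto
    then have s01: "0 < s" "s < 1" using s by auto
    have g01: "0 < glue t k s" "glue t k s < 1" using s01 by (auto simp: glue_def)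
    let ?x = "chart \<Sigma> t (side_point k s)"
    have x: "?x = chart \<Sigma> t' (side_point k' (glue t k s))" using chart_glue[OF side pt(1) s] .
    have v: "val t (side_point k s) = r t k ?x" "val t' (side_point k' (glue t k s)) = r t' k' ?x"
      using val_region[OF side side_point_in_region[OF s01]] val_region[OF pt(2) side_point_in_region[OF g01]] x by simp_all
    obtain u j where uj: "chosen_side (edge \<Sigma> t k) = (u, j)" by (cases "chosen_side (edge \<Sigma> t k)")
    have "arc_side u j" "edge \<Sigma> u j = edge \<Sigma> t k" using chosen_side[OF _ uj] side by (simp_all add: arc_side_def)
    then have "chosen_side (edge \<Sigma> t k) = (t, k) \<or> chosen_side (edge \<Sigma> t k) = (t', k')"
      unfolding uj using sides[of u j] by (simp add: arc_side_def)
    then have "val t (side_point k s) = (if coherent \<Sigma> t k then val t' (side_point k' (glue t k s)) else - val t' (side_point k' (glue t k s)))"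
    proof
      assume c: "chosen_side (edge \<Sigma> t k) = (t, k)"
      show ?thesis unfolding v r_def pt(3) c using pt(4) by auto
    next
      assume c: "chosen_side (edge \<Sigma> t k) = (t', k')"
      show ?thesis unfolding v r_def pt(3) c coherent_partner[OF side pt(1)] using pt(4) by auto
    qed
    then show "case partner \<Sigma> t k of (t', k') \<Rightarrow> \<epsilon> t (side_point k s) =
        (if coherent \<Sigma> t k then \<epsilon> t' (side_point k' (1 - s)) else - \<epsilon> t' (side_point k' s))"
      unfolding pt(1) by (auto simp: \<epsilon>_def glue_def)
  qed
  then show ?thesis unfolding orientable_on_def by blast
qed

text \<open>If the sign came back to 1, it would be well defined on the simple curve, extend to a
  neighbourhood and orient it, against one-sidedness. The only other possible value is -1.\<close>

theorem one_sided_sign: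
  assumes \<alpha>: "closed_curve \<Sigma> \<alpha>" "one_sided \<Sigma> \<alpha>"
  shows "sgn.transport \<alpha> 1 (- 1)"
proof -
  have a: "path \<alpha>" "path_image \<alpha> \<subseteq> X" "simple_path \<alpha>" "\<alpha> 1 = \<alpha> 0"
    using \<alpha>(1) by (auto simp: closed_curve_def simple_path_imp_path pathstart_def pathfinish_def)
  have A: "glue_map arc_sign i x v \<in> {1, -1} \<longleftrightarrow> v \<in> {1, -1}" for i x v
    using glue_map_arc_sign[of i x v] by auto
  obtain \<sigma> where \<sigma>: "sgn.flat {0..1} \<alpha> \<sigma>" "\<sigma> 0 = 1"
    using sgn.liftable_path[OF a(1,2), unfolded sgn.liftable_def, rule_format, of 0 1] by auto
  have s: "\<sigma> z \<in> {1, -1}" if "z \<in> {0..1}" for z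
    by (rule sgn.flat_invariant[OF _ _ _ \<sigma>(1) A, of 0 z]) (use a \<sigma>(2) that in \<open>auto simp: path_def path_image_def\<close>)
  have "\<sigma> 1 \<noteq> 1"
  proof
    assume 1: "\<sigma> 1 = 1"
    have inj: "\<sigma> z = \<sigma> w" if "z \<in> {0..1}" "w \<in> {0..1}" "\<alpha> z = \<alpha> w" for z w
      using a(3) that 1 \<sigma>(2) unfolding simple_path_def loop_free_def by metis
    obtain \<tau> where \<tau>: "sgn.flat (path_image \<alpha>) (\<lambda>x. x) \<tau>" "\<And>z. z \<in> {0..1} \<Longrightarrow> \<tau> (\<alpha> z) = \<sigma> z"
      using flat_on_path_image[OF sgn.local_system_axioms a(1,2) \<sigma>(1) inj] by blast
    have "finite patches" using finite_triangles finite_arcs by (simp add: patches_def)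
    moreover have "\<tau> x \<in> {1, -1}" if "x \<in> path_image \<alpha>" for x
    proof -
      obtain z where "z \<in> {0..1}" "x = \<alpha> z" using \<open>x \<in> path_image \<alpha>\<close> by (auto simp: path_image_def)
      then show ?thesis using \<tau>(2)[of z] s[of z] by simp
    qed
    ultimately obtain N \<tau>' where N: "openin (top_of_set X) N" "path_image \<alpha> \<subseteq> N" "sgn.flat N (\<lambda>x. x) \<tau>'" "\<And>y. y \<in> N \<Longrightarrow> \<tau>' y \<in> {1, -1}"
      using flat_extends_to_nbhd[OF sgn.local_system_axioms _ a(2) \<tau>(1), of "{1, -1}"] A by blast
    have NX: "N \<subseteq> X" using openin_imp_subset[OF N(1)] .
    have "orientable_on \<Sigma> N" by (rule orientable_on_flat_sign[OF NX N(3,4)])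
    moreover have "openin (top_of_set (surf \<Sigma>)) N" using openin_trans[OF N(1) openin_X] .
    ultimately show False using \<alpha>(2) N(2) NX unfolding one_sided_def by blast
  qed
  then have "\<sigma> 1 = - 1" using s[of 1] by auto
  with \<sigma> show ?thesis unfolding sgn.transport_def by (intro exI[of _ \<sigma>]) simp
qed

end

section \<open>Positivity\<close>

definition nonneg :: "'e laurent \<Rightarrow> bool" where
  "nonneg f \<longleftrightarrow> (\<forall>m. 0 \<le> Poly_Mapping.lookup f m)"

lemma nonneg_0 [simp]: "nonneg 0" and nonneg_1 [simp]: "nonneg 1"
  and nonneg_x_pow [simp]: "nonneg (x_pow e n)" and nonneg_y_half_pow [simp]: "nonneg (y_half_pow e n)"
  by (auto simp: nonneg_def x_pow_def y_half_pow_def lookup_one lookup_single when_def)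

lemma nonneg_add: "nonneg f \<Longrightarrow> nonneg g \<Longrightarrow> nonneg (f + g)"
  by (simp add: nonneg_def lookup_add)

lemma nonneg_2: "nonneg 2"
  using nonneg_add[OF nonneg_1 nonneg_1] by simp

lemma Sum_any_nonneg: "(\<And>x. 0 \<le> f x) \<Longrightarrow> 0 \<le> Sum_any f" for f :: "'b \<Rightarrow> int"
  by (simp add: Sum_any.expand_set sum_nonneg)

lemma nonneg_mult: "nonneg f \<Longrightarrow> nonneg g \<Longrightarrow> nonneg (f * g)"
  unfolding nonneg_def lookup_mult by (auto simp: when_def intro!: Sum_any_nonneg mult_nonneg_nonneg)

lemma nonneg_antisym:
  assumes "nonneg f" "nonneg (- f)"
  shows "f = 0"
proof (rule poly_mapping_eqI)
  fix m
  show "Poly_Mapping.lookup f m = Poly_Mapping.lookup 0 m"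
    using assms by (simp add: nonneg_def) (metis antisym)
qed

lemma positive_version_uminus: "f =\<^sub>\<plusminus> g \<Longrightarrow> positive_version f = positive_version g"
proof -
  assume "f =\<^sub>\<plusminus> g"
  then have "(h = f \<or> h = - f) \<longleftrightarrow> (h = g \<or> h = - g)" for h by (auto simp: eq_upto_sign_def)
  then show ?thesis by (simp add: positive_version_def)
qed

text \<open>The description is unique because \<open>f\<close> and \<open>- f\<close> both have
  non-negative coefficients only for 0, where they coincide.\<close>

lemma positive_version_nonneg:
  assumes "nonneg f"
  shows "positive_version f = f"
  unfolding positive_version_def nonneg_def[symmetric]
  by (rule the_equality) (use assms nonneg_antisym in fastforce)+

definition nonneg_upto_sign :: "('e laurent)^2^2 \<Rightarrow> bool" where
  "nonneg_upto_sign A \<longleftrightarrow> (\<exists>B. A =\<^sub>\<plusminus> B \<and> (\<forall>i j. nonneg (B $ i $ j)))"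

lemma nonneg_upto_signI: "A =\<^sub>\<plusminus> mat2 a b c d \<Longrightarrow> nonneg a \<Longrightarrow> nonneg b \<Longrightarrow> nonneg c \<Longrightarrow> nonneg d \<Longrightarrow> nonneg_upto_sign A"
  unfolding nonneg_upto_sign_def by (intro exI[of _ "mat2 a b c d"]) (simp add: forall_2)

lemma nonneg_upto_sign_mult:
  assumes "nonneg_upto_sign A" "nonneg_upto_sign B"
  shows "nonneg_upto_sign (A ** B)"
proof -
  obtain A' B' where *: "A =\<^sub>\<plusminus> A'" "\<forall>i j. nonneg (A' $ i $ j)" "B =\<^sub>\<plusminus> B'" "\<forall>i j. nonneg (B' $ i $ j)"
    using assms unfolding nonneg_upto_sign_def by blast
  have "nonneg ((A' ** B') $ i $ j)" for i j
    using * by (simp add: matrix_matrix_mult_def sum_2 nonneg_add nonneg_mult)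
  then show ?thesis unfolding nonneg_upto_sign_def using eq_upto_sign_mult[OF *(1,3)] by blast
qed

lemma nonneg_upto_sign_trace:
  assumes "nonneg_upto_sign A"
  obtains f where "nonneg f" "trace A =\<^sub>\<plusminus> f"
proof -
  obtain B where B: "A =\<^sub>\<plusminus> B" "\<forall>i j. nonneg (B $ i $ j)" using assms unfolding nonneg_upto_sign_def by blast
  show ?thesis
    by (rule that[OF _ eq_upto_sign_trace[OF B(1)]]) (use B(2) in \<open>simp add: trace_2 nonneg_add\<close>)
qed

context laminated
begin

lemma frame_inv_frame: "frame_inv t (k + 1) ** frame t k =\<^sub>\<plusminus> side_turn t k"
proof -
  have "frame_inv t (k + 1) ** frame t k =\<^sub>\<plusminus> frame_inv t (k + 1) ** (frame t (k + 1) ** side_turn t k)"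
    by (rule eq_upto_sign_mult[OF eq_upto_sign_refl eq_upto_sign_sym[OF frame_side_turn]])
  then show ?thesis by simp
qed

text \<open>A path that enters a triangle through side \<open>j\<close> and leaves it through another side \<open>k\<close> turns left or
  right; both matrices are non-negative.\<close>

lemma turning_nonneg:
  assumes "j \<noteq> k"
  shows "nonneg_upto_sign (along t (k + 1) k ** (frame_inv t k ** frame t j))"
proof -
  from position_cases[of k j] assms consider "k = j + 1" | "k = j + 2" by blast
  then show ?thesis
  proof cases
    case 1
    have "along t (k + 1) k ** (frame_inv t k ** frame t j) =\<^sub>\<plusminus> along t (k + 1) k ** side_turn t j"
      unfolding 1 by (rule eq_upto_sign_mult[OF eq_upto_sign_refl frame_inv_frame])
    also have "\<dots> = - mat2 (x_var t k * x_inv t j) (x_var t (k + 1)) 0 (x_inv t k * x_var t j)"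
      unfolding 1 by (simp add: along_def side_turn_eq mult_ac)
    also have "\<dots> =\<^sub>\<plusminus> mat2 (x_var t k * x_inv t j) (x_var t (k + 1)) 0 (x_inv t k * x_var t j)"
      by (simp add: eq_upto_sign_def)
    finally show ?thesis by (rule nonneg_upto_signI) (simp_all add: nonneg_mult)
  next
    case 2
    have k1: "j + 1 + 1 = k" by (simp add: 2)
    have "frame_inv t k ** frame t j = (frame_inv t (j + 1 + 1) ** frame t (j + 1)) ** (frame_inv t (j + 1) ** frame t j)"
      unfolding k1 by (simp flip: matrix_mul_assoc)
    also have "\<dots> =\<^sub>\<plusminus> side_turn t (j + 1) ** side_turn t j"
      by (rule eq_upto_sign_mult[OF frame_inv_frame frame_inv_frame])
    finally have "along t (k + 1) k ** (frame_inv t k ** frame t j) =\<^sub>\<plusminus> along t (k + 1) k ** (side_turn t (j + 1) ** side_turn t j)"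
      by (rule eq_upto_sign_mult[OF eq_upto_sign_refl])
    also have "\<dots> = - mat2 1 0 (x_inv t k * x_var t (j + 1) * x_inv t j) 1"
      unfolding 2 by (simp add: along_def side_turn_eq mult_ac)
    also have "\<dots> =\<^sub>\<plusminus> mat2 1 0 (x_inv t k * x_var t (j + 1) * x_inv t j) 1"
      by (simp add: eq_upto_sign_def)
    finally show ?thesis by (rule nonneg_upto_signI) (simp_all add: nonneg_mult)
  qed
qed

text \<open>The factor \<open>along t (k + 2) k\<close> cancels \<open>along t (k + 1) k\<close>
  from \<open>turning_nonneg\<close>. Splitting the identity in this way distributes the signs so
  that both factors of a step are non-negative up to sign.\<close>

lemma through_nonneg: "nonneg_upto_sign (through t k ** along t (k + 2) k)"
proof (cases "coherent \<Sigma> t k")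
  case True
  then have "through t k ** along t (k + 2) k = cross t (k + 2) k"
    by (simp add: through_def flip: matrix_mul_assoc)
  also have "\<dots> = mat2 (half t k False) 0 0 (half t k True)" using True by (simp add: cross_def)
  finally have "through t k ** along t (k + 2) k =\<^sub>\<plusminus> mat2 (half t k False) 0 0 (half t k True)" by simp
  then show ?thesis by (rule nonneg_upto_signI) (simp_all add: half_def)
next
  case False
  then have "through t k ** along t (k + 2) k =\<^sub>\<plusminus> mat2 0 (half t k True * x_var t k) (half t k False * x_inv t k) 0"
    by (simp add: through_def cross_def along_def)
  then show ?thesis by (rule nonneg_upto_signI) (simp_all add: half_def nonneg_mult)
qed

text \<open>A walk in the dual graph of the triangulation is given by the sides it leaves the triangles through.\<close>

fun walk :: "'a set \<Rightarrow> 3 list \<Rightarrow> 'a set \<Rightarrow> bool" where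
  "walk t [] u \<longleftrightarrow> t = u"
| "walk t (k # ks) u \<longleftrightarrow> arc_side t k \<and> walk (fst (partner \<Sigma> t k)) ks u"

fun walk_matrix :: "'a set \<Rightarrow> 3 list \<Rightarrow> ('a set laurent)^2^2" where
  "walk_matrix t [] = mat 1"
| "walk_matrix t (k # ks) = walk_matrix (fst (partner \<Sigma> t k)) ks ** side_matrix t k"

text \<open>Here \<open>j\<close> is the side through which \<open>t\<close> has been entered;
  leaving through it again is a backtrack.\<close>

fun reduced :: "'a set \<Rightarrow> 3 \<Rightarrow> 3 list \<Rightarrow> bool" where
  "reduced t j [] \<longleftrightarrow> True"
| "reduced t j (k # ks) \<longleftrightarrow> j \<noteq> k \<and> reduced (fst (partner \<Sigma> t k)) (snd (partner \<Sigma> t k)) ks"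

fun last_entry :: "'a set \<Rightarrow> 3 \<Rightarrow> 3 list \<Rightarrow> 'a set \<times> 3" where
  "last_entry t j [] = (t, j)"
| "last_entry t j (k # ks) = last_entry (fst (partner \<Sigma> t k)) (snd (partner \<Sigma> t k)) ks"

lemma walk_append: "walk t (ks @ ks') u \<longleftrightarrow> (\<exists>v. walk t ks v \<and> walk v ks' u)"
  by (induction ks arbitrary: t) auto

lemma walk_matrix_append: "walk t ks v \<Longrightarrow> walk_matrix t (ks @ ks') = walk_matrix v ks' ** walk_matrix t ks"
  by (induction ks arbitrary: t) (auto simp: matrix_mul_assoc)

lemma last_entry_append: "walk t ks v \<Longrightarrow> last_entry t j (ks @ [k]) = partner \<Sigma> v k"
  by (induction ks arbitrary: t j) auto

lemma fst_last_entry: "walk t ks u \<Longrightarrow> fst (last_entry t j ks) = u"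
  by (induction ks arbitrary: t j) auto

text \<open>Regrouped around the arcs, the walk is a product of alternating turning and crossing
  factors; conjugating by the frames at both ends supplies the missing halves of the outer
  factors.\<close>

lemma reduced_walk_nonneg:
  assumes "walk t ks u" "reduced t j ks" "last_entry t j ks = (v, l)"
  shows "nonneg_upto_sign (frame_inv v l ** (walk_matrix t ks ** frame t j))"
  using assms
proof (induction ks arbitrary: t j)
  case Nil
  then have "frame_inv v l ** (walk_matrix t [] ** frame t j) =\<^sub>\<plusminus> mat2 1 0 0 1"
    by (simp flip: mat_1_eq_mat2)
  then show ?case by (rule nonneg_upto_signI) simp_all
next
  case (Cons k ks)
  obtain t' k' where pt: "partner \<Sigma> t k = (t', k')" by (cases "partner \<Sigma> t k")
  have IH: "nonneg_upto_sign (frame_inv v l ** (walk_matrix t' ks ** frame t' k'))"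
    by (rule Cons.IH) (use Cons.prems pt in auto)
  have "frame_inv v l ** (walk_matrix t (k # ks) ** frame t j) = (frame_inv v l ** (walk_matrix t' ks ** frame t' k')) **
    ((through t k ** along t (k + 2) k) ** (along t (k + 1) k ** (frame_inv t k ** frame t j)))"
  proof -
    have "through t k = through t k ** (along t (k + 2) k ** along t (k + 1) k)" by simp
    then show ?thesis unfolding walk_matrix.simps pt fst_conv side_matrix_def prod.case
      by (metis (no_types, lifting) matrix_mul_assoc)
  qed
  then show ?case
    using nonneg_upto_sign_mult[OF IH nonneg_upto_sign_mult[OF through_nonneg turning_nonneg]] Cons.prems(2) by simp
qed

lemma not_reduced_cases:
  assumes "walk t ks u" "\<not> reduced t j ks"
  obtains ks' where "ks = j # ks'"
  | ks1 k bs v where "ks = ks1 @ k # snd (partner \<Sigma> v k) # bs" "walk t ks1 v"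
  using assms
proof (induction ks arbitrary: t j thesis)
  case (Cons k ks)
  show ?case
  proof (cases "j = k")
    case False
    let ?q = "partner \<Sigma> t k"
    have "walk (fst ?q) ks u" "\<not> reduced (fst ?q) (snd ?q) ks" using Cons.prems(3,4) False by auto
    then show ?thesis
    proof (rule Cons.IH[rotated 2])
      fix ks' assume "ks = snd ?q # ks'"
      then show ?thesis using Cons.prems(2)[of "[]" k t ks'] by simp
    next
      fix ks1 l bs v assume "ks = ks1 @ l # snd (partner \<Sigma> v l) # bs" "walk (fst ?q) ks1 v"
      then show ?thesis using Cons.prems(2)[of "k # ks1" l v bs] Cons.prems(3) by simp
    qed
  qed (use Cons.prems(1) in blast)
qed simp

text \<open>Induction on the length of the walk. The side of its last entry is taken as the entry
  side of its first triangle, so a walk reduced in this sense has no backtrack at the seam either. A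
  backtrack inside is cancelled in place; one at the seam is removed by cyclicity of the trace,
  which moves the base triangle.\<close>

lemma trace_closed_walk:
  assumes "walk t ks t"
  shows "\<exists>f. nonneg f \<and> trace (walk_matrix t ks) =\<^sub>\<plusminus> f"
  using assms
proof (induction "length ks" arbitrary: t ks rule: less_induct)
  case less
  show ?case
  proof (cases ks rule: rev_cases)
    case Nil
    have "trace (walk_matrix t ks) = 2" using Nil by (simp add: trace_2 mat_def)
    then show ?thesis using nonneg_2 by (intro exI[of _ 2]) simp
  next
    case (snoc ks1 j)
    then obtain v where v: "walk t ks1 v" "arc_side v j" "fst (partner \<Sigma> v j) = t"
      using less.prems by (auto simp: walk_append)
    obtain l where l: "partner \<Sigma> v j = (t, l)" using v(3) by (cases "partner \<Sigma> v j") auto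
    have le: "last_entry t l ks = (t, l)" using last_entry_append[OF v(1)] snoc l by simp
    have partner_l: "arc_side t l" "partner \<Sigma> t l = (v, j)"
      by (rule arc_side_partner[OF v(2)]; use l in auto)+
    show ?thesis
    proof (cases "reduced t l ks")
      case True
      have "nonneg_upto_sign (frame_inv t l ** (walk_matrix t ks ** frame t l))"
        by (rule reduced_walk_nonneg[OF less.prems True le])
      then obtain f where f: "nonneg f" "trace (frame_inv t l ** (walk_matrix t ks ** frame t l)) =\<^sub>\<plusminus> f"
        by (rule nonneg_upto_sign_trace)
      have "trace (frame_inv t l ** walk_matrix t ks ** frame t l) = trace (walk_matrix t ks)"
        by (rule trace_conjugate) simp
      then show ?thesis using f by (auto simp: matrix_mul_assoc)
    next
      case False
      with less.prems show ?thesis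
      proof (cases rule: not_reduced_cases)
        case (1 ks')
        \<comment> \<open>A walk of length one with a backtrack at the seam would cross an arc
          through a side that is its own partner.\<close>
        have "ks1 \<noteq> []"
        proof
          assume "ks1 = []"
          then have "v = t" "j = l" using v(1) snoc 1 by auto
          then show False using l by (rule_tac arc_side_partner[OF v(2)]) auto
        qed
        then obtain cs where cs: "ks1 = l # cs" using snoc 1 by (cases ks1) auto
        have w: "walk v cs v" using v(1) partner_l cs by simp
        have ks: "ks = l # (cs @ [j])" using snoc cs by simp
        have "walk_matrix t ks = side_matrix v j ** walk_matrix v cs ** side_matrix t l"
          unfolding ks by (simp add: partner_l walk_matrix_append[OF w])
        then have "trace (walk_matrix t ks) = trace (walk_matrix v cs ** (side_matrix t l ** side_matrix v j))"
          by (metis matrix_mul_assoc trace_mul_sym)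
        also have "\<dots> =\<^sub>\<plusminus> trace (walk_matrix v cs ** mat 1)"
          by (rule eq_upto_sign_trace[OF eq_upto_sign_mult[OF eq_upto_sign_refl side_matrix_partner[OF v(2) l]]])
        finally have "trace (walk_matrix t ks) =\<^sub>\<plusminus> trace (walk_matrix v cs)" by simp
        moreover have "\<exists>f. nonneg f \<and> trace (walk_matrix v cs) =\<^sub>\<plusminus> f"
          by (rule less.hyps[OF _ w]) (simp add: ks)
        ultimately show ?thesis using eq_upto_sign_trans by blast
      next
        case (2 bs k ds w)
        obtain w' k' where wk: "partner \<Sigma> w k = (w', k')" by (cases "partner \<Sigma> w k")
        have ks: "ks = bs @ (k # k' # ds)" using 2(1) wk by simp
        have "walk w (k # k' # ds) t"
          using less.prems 2(2) unfolding ks walk_append by (metis fst_last_entry)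
        then have w: "arc_side w k" "arc_side w' k'" "walk (fst (partner \<Sigma> w' k')) ds t" using wk by auto
        have wk': "partner \<Sigma> w' k' = (w, k)"
          by (rule arc_side_partner[OF w(1)]; use wk in auto)
        have cl: "walk t (bs @ ds) t" using 2(2) w(3) wk' by (auto simp: walk_append)
        have "walk_matrix t ks = walk_matrix w ds ** (side_matrix w' k' ** side_matrix w k) ** walk_matrix t bs"
          unfolding ks walk_matrix_append[OF 2(2)] by (simp add: wk wk' matrix_mul_assoc)
        also have "\<dots> =\<^sub>\<plusminus> walk_matrix w ds ** mat 1 ** walk_matrix t bs"
          by (rule eq_upto_sign_mult[OF eq_upto_sign_mult[OF eq_upto_sign_refl side_matrix_partner[OF w(1) wk]] eq_upto_sign_refl])
        finally have "walk_matrix t ks =\<^sub>\<plusminus> walk_matrix t (bs @ ds)"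
          by (simp add: walk_matrix_append[OF 2(2)])
        then have "trace (walk_matrix t ks) =\<^sub>\<plusminus> trace (walk_matrix t (bs @ ds))" by (rule eq_upto_sign_trace)
        moreover have "\<exists>f. nonneg f \<and> trace (walk_matrix t (bs @ ds)) =\<^sub>\<plusminus> f"
          by (rule less.hyps[OF _ cl]) (simp add: ks)
        ultimately show ?thesis using eq_upto_sign_trans by blast
      qed
    qed
  qed
qed

lemma path_holonomy_walk:
  "elementary_path \<Sigma> p ss \<Longrightarrow> \<exists>ks. walk (fst p) ks (fst (endpoint \<Sigma> p ss)) \<and> path_holonomy p ss =\<^sub>\<plusminus> walk_matrix (fst p) ks"
proof (induction ss arbitrary: p)
  case Nil
  then show ?case by (intro exI[of _ "[]"]) (simp add: endpoint_def)
next
  case (Cons s ss)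
  obtain t c k where p: "p = (t, c, k)" by (cases p)
  have e: "is_position \<Sigma> p" "s = Cross \<longrightarrow> edge \<Sigma> t k \<in> arcs \<Sigma>" "elementary_path \<Sigma> (move \<Sigma> p s) ss"
    using Cons.prems by (auto simp: p)
  obtain ks where ks: "walk (fst (move \<Sigma> p s)) ks (fst (endpoint \<Sigma> (move \<Sigma> p s) ss))"
    "path_holonomy (move \<Sigma> p s) ss =\<^sub>\<plusminus> walk_matrix (fst (move \<Sigma> p s)) ks"
    using Cons.IH[OF e(3)] by blast
  show ?case
  proof (cases "s = Cross")
    case False
    then have "fst (move \<Sigma> p s) = t" by (cases s) (simp_all add: p)
    then show ?thesis using ks False by (intro exI[of _ ks]) (simp add: p endpoint_Cons)
  next
    case True
    have side: "arc_side t k" using e True by (auto simp: p arc_side_def is_position_def)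
    have m: "fst (move \<Sigma> p Cross) = fst (partner \<Sigma> t k)" by (simp add: p split: prod.split)
    have "path_holonomy (move \<Sigma> p Cross) ss ** holonomy t k =\<^sub>\<plusminus> walk_matrix (fst (partner \<Sigma> t k)) ks ** side_matrix t k"
      using ks(2) unfolding True m by (rule eq_upto_sign_mult[OF _ holonomy_side_matrix[OF side]])
    then show ?thesis using ks(1) side unfolding True m
      by (intro exI[of _ "k # ks"]) (simp add: p endpoint_Cons del: move.simps)
  qed
qed

section \<open>The invariant as the trace of a holonomy\<close>

lemma chi_bar_eq_trace:
  assumes \<omega>: "local_orientations \<Sigma> \<omega>" and \<beta>: "path \<beta>" "path_image \<beta> \<subseteq> X" "pathfinish \<beta> = pathstart \<beta>"
    and T: "hol.transport \<beta> (mat 1) T"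
  shows "chi_bar \<Sigma> \<omega> L \<beta> = positive_version (trace T)" "\<exists>f. nonneg f \<and> trace T =\<^sub>\<plusminus> f"
proof -
  have tr: "trace (path_holonomy p ss) = trace T" if m: "elementary_path \<Sigma> p ss" "homotopic_loops X \<beta> (path_curve \<Sigma> p ss)" for p ss
  proof -
    obtain \<Phi> \<Psi> where "\<Psi> ** \<Phi> = mat 1" "\<Phi> ** T ** \<Psi> = path_holonomy p ss"
      by (rule holonomy_conjugate[OF m T])
    then show ?thesis using trace_conjugate by metis
  qed
  \<comment> \<open>All M-paths of \<beta> are freely homotopic to it, so their traces agree up to
    sign and have the same positive version; this makes the definite description unique.\<close>
  have M: "positive_version (trace (path_matrix \<Sigma> \<omega> L p ss)) = positive_version (trace T)" if "M_path \<Sigma> \<beta> p ss" for p ss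
  proof -
    have m: "elementary_path \<Sigma> p ss" "endpoint \<Sigma> p ss = p" "homotopic_loops X \<beta> (path_curve \<Sigma> p ss)"
      using that by (auto simp: M_path_def)
    show ?thesis
      using positive_version_uminus[OF trace_path_matrix[OF \<omega> m(1,2)]] tr[OF m(1,3)] by simp
  qed
  obtain p ss where ps: "M_path \<Sigma> \<beta> p ss" by (rule M_path_exists[OF \<beta>])
  show "chi_bar \<Sigma> \<omega> L \<beta> = positive_version (trace T)"
    unfolding chi_bar_def by (rule the_equality) (use ps M in metis)+
  have m: "elementary_path \<Sigma> p ss" "endpoint \<Sigma> p ss = p" "homotopic_loops X \<beta> (path_curve \<Sigma> p ss)"
    using ps by (auto simp: M_path_def)
  \<comment> \<open>Positivity is seen on the walk in the dual graph that underlies an M-path; it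
    passes to \<open>T\<close> because the traces agree.\<close>
  obtain ks where "walk (fst p) ks (fst p)" "path_holonomy p ss =\<^sub>\<plusminus> walk_matrix (fst p) ks"
    using path_holonomy_walk[OF m(1)] m(2) by auto
  moreover from this(1) obtain f where "nonneg f" "trace (walk_matrix (fst p) ks) =\<^sub>\<plusminus> f"
    using trace_closed_walk by blast
  ultimately have "nonneg f" "trace (path_holonomy p ss) =\<^sub>\<plusminus> f"
    using eq_upto_sign_trans[OF eq_upto_sign_trace] by blast+
  then show "\<exists>f. nonneg f \<and> trace T =\<^sub>\<plusminus> f" using tr[OF m(1,3)] by auto
qed

text \<open>The curve is replaced by an M-path, where determinant and orientation sign can be
  compared crossing by crossing; conjugation leaves the determinant unchanged.\<close>

lemma det_holonomy_one_sided:
  assumes \<alpha>: "closed_curve \<Sigma> \<alpha>" "one_sided \<Sigma> \<alpha>" and T: "hol.transport \<alpha> (mat 1) T"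
  shows "det T = - 1"
proof -
  have a: "path \<alpha>" "path_image \<alpha> \<subseteq> X" "pathfinish \<alpha> = pathstart \<alpha>"
    using \<alpha>(1) by (auto simp: closed_curve_def simple_path_imp_path)
  obtain p ss where "M_path \<Sigma> \<alpha> p ss" by (rule M_path_exists[OF a])
  then have m: "elementary_path \<Sigma> p ss" "homotopic_loops X \<alpha> (path_curve \<Sigma> p ss)"
    by (auto simp: M_path_def)
  obtain \<Phi> \<Psi> where c: "\<Psi> ** \<Phi> = mat 1" "\<Phi> ** T ** \<Psi> = path_holonomy p ss"
    by (rule holonomy_conjugate[OF m T])
  have "det \<Psi> * det \<Phi> = 1" using c(1) by (metis det_I det_mul)
  then have "det T = det \<Phi> * det T * det \<Psi>" by (simp add: mult_ac)
  also have "\<dots> = det (path_holonomy p ss)" by (simp add: det_mul flip: c(2))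
  also have "\<dots> = of_int (path_map arc_sign p ss 1)" by (rule det_path_holonomy[OF m(1)])
  also have "path_map arc_sign p ss 1 = - 1"
    by (rule sgn_transport_homotopic[OF m one_sided_sign[OF \<alpha>]])
  finally show ?thesis by simp
qed

theorem chi_bar_square:
  assumes "local_orientations \<Sigma> \<omega>" "closed_curve \<Sigma> \<alpha>" "one_sided \<Sigma> \<alpha>"
  shows "(chi_bar \<Sigma> \<omega> L \<alpha>)\<^sup>2 = chi_bar \<Sigma> \<omega> L (curve_square \<alpha>) - 2"
proof -
  have a: "path \<alpha>" "path_image \<alpha> \<subseteq> X" "pathfinish \<alpha> = pathstart \<alpha>"
    using assms(2) by (auto simp: closed_curve_def simple_path_imp_path)
  have aa: "path (curve_square \<alpha>)" "path_image (curve_square \<alpha>) \<subseteq> X" "pathfinish (curve_square \<alpha>) = pathstart (curve_square \<alpha>)"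
    using a by (simp_all add: curve_square_def subset_path_image_join)
  obtain T where T: "hol.transport \<alpha> (mat 1) T" using hol.transport_exists(1)[OF a(1,2)] by blast
  have "hol.transport \<alpha> T (T ** T)" using hol_transport_mult[OF T, of T] by simp
  then have TT: "hol.transport (curve_square \<alpha>) (mat 1) (T ** T)"
    unfolding curve_square_def by (rule hol.transport_join[OF T _ a(3)])
  obtain f where f: "nonneg f" "trace T =\<^sub>\<plusminus> f" using chi_bar_eq_trace(2)[OF assms(1) a T] by blast
  have 1: "chi_bar \<Sigma> \<omega> L \<alpha> = f"
    using chi_bar_eq_trace(1)[OF assms(1) a T] positive_version_uminus[OF f(2)] positive_version_nonneg[OF f(1)] by simp
  \<comment> \<open>The sign of \<open>trace T\<close> disappears in the square, and
    \<open>- 2 * det T\<close> is 2; so the result is non-negative without a further choice of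
    sign.\<close>
  have "trace (T ** T) = f\<^sup>2 + 2"
    using f(2) by (auto simp: trace_square_2 det_holonomy_one_sided[OF assms(2,3) T] eq_upto_sign_def)
  moreover have "nonneg (f\<^sup>2 + 2)"
    unfolding power2_eq_square by (intro nonneg_add[OF nonneg_mult[OF f(1) f(1)] nonneg_2])
  ultimately have "chi_bar \<Sigma> \<omega> L (curve_square \<alpha>) = f\<^sup>2 + 2"
    using chi_bar_eq_trace(1)[OF assms(1) aa TT] positive_version_nonneg by simp
  then show ?thesis using 1 by simp
qed

end

theorem proposition7p4:
  fixes \<Sigma> :: "'a::metric_space tsurface"
    and \<omega> :: "'a set \<Rightarrow> 3 \<Rightarrow> int"
    and L :: "'a set \<Rightarrow> 'a lamination_curve"
    and \<alpha> :: "real \<Rightarrow> 'a"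
  assumes "triangulated_surface \<Sigma>"
    and "nonorientable \<Sigma>"
    and "local_orientations \<Sigma> \<omega>"
    and "principal_lamination \<Sigma> L"
    and "closed_curve \<Sigma> \<alpha>"
    and "one_sided \<Sigma> \<alpha>"
  shows "(chi_bar \<Sigma> \<omega> L \<alpha>)\<^sup>2 = chi_bar \<Sigma> \<omega> L (curve_square \<alpha>) - 2"
proof -
  interpret laminated \<Sigma> L using assms(1,4) by unfold_locales
  show ?thesis by (rule chi_bar_square[OF assms(3,5,6)])
qed

end
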